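(* Suppose that Assumption A holds. Then there is a constant $\bar\delta>0$ such that for any $(z^0,\lambda^0)$ with $\delta(z^0,\lambda^0)\le\bar\delta$, the "if" condition in Algorithm sSQPa is always satisfied, and the sequence $\delta(z^k,\lambda^k)$ converges superlinearly to zero with Q-order $1+\sigma$.
   Context: **Problem.** $\min_z\phi(z)$ subject to $g(z)\le 0$, with $\phi:\mathbb R^n\to\mathbb R$, $g:\mathbb R^n\to\mathbb R^m$ twice Lipschitz continuously differentiable. Lagrangian: $\mathcal L(z,\lambda)=\phi(z)+\lambda^Tg(z)$; $\mathcal L_z,\mathcal L_{zz}$ are its gradient and Hessian in $z$; $\nabla g(z)$ is the $n\times m$ matrix with columns $\nabla g_i(z)$. KKT conditions at $z^*$: there is $\lambda^*\in\mathbb R^m$ with $\mathcal L_z(z^*,\lambda^* )=0$, $g(z^* )\le0$, $\lambda^*\ge0$, $(\lambda^* )^Tg(z^* )=0$. $\mathcal S_\lambda$ is the set of all $\lambda^*$ satisfying the KKT conditions at the fixed point $z^*$, and $\mathcal S=\{z^*\}\times\mathcal S_\lambda$. $\mathcal B=\{i: g_i(z^* )=0\}$; $\mathcal B_+=\{i\in\mathcal B:\lambda^*_i>0\text{ for some }\lambda^*\in\mathcal S_\lambda\}$; $\mathcal B_0=\mathcal B\setminus\mathcal B_+$. **Assumption A.** (i) The KKT conditions hold at $z^*$. (ii) MFCQ: there is $\bar y\in\mathbb R^n$ with $\nabla g_i(z^* )^T\bar y<0$ for all $i\in\mathcal B$. (iii) There is $\alpha>0$ such that $w^T\mathcal L_{zz}(z^*,\lambda^*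 )w\ge\alpha\|w\|^2$ for all $\lambda^*\in\mathcal S_\lambda$ and all $w$ with $\nabla g_i(z^* )^Tw=0$ for $i\in\mathcal B_+$ and $\nabla g_i(z^* )^Tw\le0$ for $i\in\mathcal B_0$. (iv) $\phi$ and $g$ are twice Lipschitz continuously differentiable in a neighborhood of $z^*$. **Distances.** $\|\cdot\|$ is the Euclidean norm, $\delta(z,\lambda)=\operatorname{dist}((z,\lambda),\mathcal S)$, and $\eta(z,\lambda)=\left\|\begin{pmatrix}\mathcal L_z(z,\lambda)\\ \min(\lambda,-g(z))\end{pmatrix}\right\|$ with the min taken componentwise. $\mathcal A(z,\lambda)=\{i: g_i(z)\ge-\eta(z,\lambda)^\tau\}$. $e$ is the vector of ones; vector inequalities are componentwise. **Procedure ID0** at $(z,\lambda)$, with constants $0<\hat\tau<\tau<1$. Set $\hat{\mathcal A}=\mathcal A(z,\lambda)\setminus\{i:\lambda_i\ge\eta(z,\lambda)^{\hat\tau}\}$. Repeat: solve the linear program $$\max_{\tilde\lambda}\sum_{i\in\hat{\mathcal A}}\tilde\lambda_i\ \text{ s.t. }\ -\eta(z,\lambda)^\tau e\le\nabla\phi(z)+\sum_{i\in\mathcal A(z,\lambda)}\tilde\lambda_i\nabla g_i(z)\le\eta(z,\lambda)^\tau e,\ \tilde\lambda_i\ge0\ (i\in\mathcal A(z,\lambda)),\ \tilde\lambda_i=0\text{ otherwise}$$ to find $\tilde\lambda$; set $\mathcal C=\{i\in\hat{\mathcal A}:\tilde\lambda_i\ge\eta(z,\lambda)^{\hat\tau}\}$;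 if $\mathcal C=\emptyset$, stop with $\mathcal A_0=\hat{\mathcal A}$, $\mathcal A_+=\mathcal A(z,\lambda)\setminus\hat{\mathcal A}$; otherwise replace $\hat{\mathcal A}$ by $\hat{\mathcal A}\setminus\mathcal C$, and if it is now empty stop with $\mathcal A_0=\emptyset$, $\mathcal A_+=\mathcal A(z,\lambda)$. **Multiplier adjustment** at $(z,\lambda)$: calculate $\mathcal A(z,\lambda)$, call Procedure ID0 to obtain $\mathcal A_+,\mathcal A_0$, then solve $$\max_{\hat t,\hat\lambda}\hat t\ \text{ s.t. }\ \hat t\le\hat\lambda_i\ (i\in\mathcal A_+),\ -\eta(z,\lambda)^\tau e\le\nabla\phi(z)+\sum_{i\in\mathcal A_+}\hat\lambda_i\nabla g_i(z)\le\eta(z,\lambda)^\tau e,\ \hat\lambda_i\ge0\ (i\in\mathcal A_+),\ \hat\lambda_i=0\text{ otherwise},$$ to obtain $\hat\lambda$, and replace $\lambda$ by $\hat\lambda$. **sSQP subproblem** at $(z,\lambda)$ with parameter $\mu\ge0$: seek a solution $(\Delta z,\lambda^+)$, such that $(\Delta z,\lambda^+-\lambda)$ is small, of $$\min_{\Delta z}\max_{\lambda^+\ge0}\ \Delta z^T\nabla\phi(z)+\tfrac12\Delta z^T\mathcal L_{zz}(z,\lambda)\Delta z+(\lambda^+)^T[g(z)+\nabla g(z)^T\Delta z]-\tfrac12\mu\|\lambda^+-\lambda\|^2.$$ **Algorithm sSQPa.** Given $\sigma\in(0,1)$, $0<\hat\tau<\tau<1$, a tolerance $\mathtt{tol}$,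 and an initial point $(z^0,\lambda^0)$ with $\lambda^0\ge0$. Set $k=0$ and apply the multiplier adjustment at $(z^0,\lambda^0)$, replacing $\lambda^0$ by the resulting $\hat\lambda^0$. Repeat: solve the sSQP subproblem with $(z,\lambda)=(z^k,\lambda^k)$ and $\mu=\mu_k=\eta(z^k,\lambda^k)^\sigma$ to obtain $(\Delta z,\lambda^+)$; **if** $\eta(z^k+\Delta z,\lambda^+)\le\eta(z^k,\lambda^k)^{1+\sigma/2}$, set $(z^{k+1},\lambda^{k+1})=(z^k+\Delta z,\lambda^+)$ and $k\leftarrow k+1$; **else** apply the multiplier adjustment at $(z^k,\lambda^k)$, replacing $\lambda^k$ by the resulting $\hat\lambda^k$. Continue until $\eta(z^k,\lambda^k)<\mathtt{tol}$. *)

theory Defs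
  imports "HOL-Analysis.Analysis" "HOL-Library.Landau_Symbols" "HOL-Library.Extended_Nat"
begin

section \<open>Problem data\<close>

text \<open>Points \<open>z\<close> live in \<open>real ^ 'n\<close>, multipliers \<open>\<lambda>\<close> (written \<open>l\<close>) in \<open>real ^ 'm\<close>.
  Inequalities between vectors are the library's componentwise ones.
  Gradients and Hessians are total functions; they are meaningful where the derivatives exist.\<close>

definition grad :: "(real ^ 'n \<Rightarrow> real) \<Rightarrow> real ^ 'n \<Rightarrow> real ^ 'n" where
  "grad f x = (THE D. GDERIV f x :> D)"

definition hess :: "(real ^ 'n \<Rightarrow> real) \<Rightarrow> real ^ 'n \<Rightarrow> real ^ 'n ^ 'n" where
  "hess f x = matrix (frechet_derivative (grad f) (at x))"

definition grad_comp :: "(real ^ 'n \<Rightarrow> real ^ 'm) \<Rightarrow> 'm \<Rightarrow> real ^ 'n \<Rightarrow> real ^ 'n" where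
  "grad_comp g i z = grad (\<lambda>y. g y $ i) z"

definition twice_lipschitz_diff_near :: "(real ^ 'n \<Rightarrow> real) \<Rightarrow> real ^ 'n \<Rightarrow> bool" where
  "twice_lipschitz_diff_near f x \<longleftrightarrow>
     (\<exists>U C. open U \<and> x \<in> U \<and>
        (\<forall>y\<in>U. f differentiable (at y) \<and> grad f differentiable (at y)) \<and>
        C-lipschitz_on U (hess f))"

definition lagrangian ::
    "(real ^ 'n \<Rightarrow> real) \<Rightarrow> (real ^ 'n \<Rightarrow> real ^ 'm) \<Rightarrow> real ^ 'm \<Rightarrow> real ^ 'n \<Rightarrow> real" where
  "lagrangian \<phi> g l z = \<phi> z + l \<bullet> g z"

section \<open>Optimality conditions and assumptions\<close>

definition multiplier_set ::
    "(real ^ 'n \<Rightarrow> real) \<Rightarrow> (real ^ 'n \<Rightarrow> real ^ 'm) \<Rightarrow> real ^ 'n \<Rightarrow> (real ^ 'm) set" where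
  "multiplier_set \<phi> g zs =
     {l. grad (lagrangian \<phi> g l) zs = 0 \<and> g zs \<le> 0 \<and> 0 \<le> l \<and> l \<bullet> g zs = 0}"

definition active :: "(real ^ 'n \<Rightarrow> real ^ 'm) \<Rightarrow> real ^ 'n \<Rightarrow> 'm set" where
  "active g zs = {i. g zs $ i = 0}"

definition active_pos ::
    "(real ^ 'n \<Rightarrow> real) \<Rightarrow> (real ^ 'n \<Rightarrow> real ^ 'm) \<Rightarrow> real ^ 'n \<Rightarrow> 'm set" where
  "active_pos \<phi> g zs = {i \<in> active g zs. \<exists>l \<in> multiplier_set \<phi> g zs. l $ i > 0}"

definition active_zero ::
    "(real ^ 'n \<Rightarrow> real) \<Rightarrow> (real ^ 'n \<Rightarrow> real ^ 'm) \<Rightarrow> real ^ 'n \<Rightarrow> 'm set" where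
  "active_zero \<phi> g zs = active g zs - active_pos \<phi> g zs"

definition MFCQ :: "(real ^ 'n \<Rightarrow> real ^ 'm) \<Rightarrow> real ^ 'n \<Rightarrow> bool" where
  "MFCQ g zs \<longleftrightarrow> (\<exists>y. \<forall>i \<in> active g zs. grad_comp g i zs \<bullet> y < 0)"

definition second_order_condition ::
    "(real ^ 'n \<Rightarrow> real) \<Rightarrow> (real ^ 'n \<Rightarrow> real ^ 'm) \<Rightarrow> real ^ 'n \<Rightarrow> bool" where
  "second_order_condition \<phi> g zs \<longleftrightarrow>
     (\<exists>\<alpha>>0. \<forall>l \<in> multiplier_set \<phi> g zs. \<forall>w.
        (\<forall>i \<in> active_pos \<phi> g zs. grad_comp g i zs \<bullet> w = 0) \<and>
        (\<forall>i \<in> active_zero \<phi> g zs. grad_comp g i zs \<bullet> w \<le> 0) \<longrightarrow>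
        w \<bullet> (hess (lagrangian \<phi> g l) zs *v w) \<ge> \<alpha> * (norm w)\<^sup>2)"

definition assumption_A ::
    "(real ^ 'n \<Rightarrow> real) \<Rightarrow> (real ^ 'n \<Rightarrow> real ^ 'm) \<Rightarrow> real ^ 'n \<Rightarrow> bool" where
  "assumption_A \<phi> g zs \<longleftrightarrow>
     multiplier_set \<phi> g zs \<noteq> {} \<and>
     MFCQ g zs \<and>
     second_order_condition \<phi> g zs \<and>
     twice_lipschitz_diff_near \<phi> zs \<and>
     (\<forall>i. twice_lipschitz_diff_near (\<lambda>z. g z $ i) zs)"

section \<open>Distance and residual\<close>

text \<open>The norm of a product type is the Euclidean norm of the stacked vector.\<close>

definition dist_sol ::
    "(real ^ 'n \<Rightarrow> real) \<Rightarrow> (real ^ 'n \<Rightarrow> real ^ 'm) \<Rightarrow> real ^ 'n \<Rightarrow>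
     real ^ 'n \<Rightarrow> real ^ 'm \<Rightarrow> real" where
  "dist_sol \<phi> g zs z l = infdist (z, l) ({zs} \<times> multiplier_set \<phi> g zs)"

definition eta ::
    "(real ^ 'n \<Rightarrow> real) \<Rightarrow> (real ^ 'n \<Rightarrow> real ^ 'm) \<Rightarrow> real ^ 'n \<Rightarrow> real ^ 'm \<Rightarrow> real" where
  "eta \<phi> g z l =
     norm (grad (lagrangian \<phi> g l) z, (\<chi> i. min (l $ i) (- (g z $ i))) :: real ^ 'm)"

definition act_est ::
    "(real ^ 'n \<Rightarrow> real) \<Rightarrow> (real ^ 'n \<Rightarrow> real ^ 'm) \<Rightarrow> real \<Rightarrow>
     real ^ 'n \<Rightarrow> real ^ 'm \<Rightarrow> 'm set" where
  "act_est \<phi> g \<tau> z l = {i. g z $ i \<ge> - (eta \<phi> g z l powr \<tau>)}"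

section \<open>Procedure ID0 and the multiplier adjustment\<close>

text \<open>The constraints shared by both linear programs: \<open>I\<close> is the index set on which the
  unknown multiplier \<open>lt\<close> may be nonzero.\<close>

definition lp_feasible ::
    "(real ^ 'n \<Rightarrow> real) \<Rightarrow> (real ^ 'n \<Rightarrow> real ^ 'm) \<Rightarrow> real \<Rightarrow> real ^ 'n \<Rightarrow> real ^ 'm \<Rightarrow>
     'm set \<Rightarrow> real ^ 'm \<Rightarrow> bool" where
  "lp_feasible \<phi> g \<tau> z l I lt \<longleftrightarrow>
     vec (- (eta \<phi> g z l powr \<tau>)) \<le> grad \<phi> z + (\<Sum>i\<in>I. lt $ i *\<^sub>R grad_comp g i z) \<and>
     grad \<phi> z + (\<Sum>i\<in>I. lt $ i *\<^sub>R grad_comp g i z) \<le> vec (eta \<phi> g z l powr \<tau>) \<and>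
     (\<forall>i\<in>I. lt $ i \<ge> 0) \<and> (\<forall>i. i \<notin> I \<longrightarrow> lt $ i = 0)"

definition id0_lp ::
    "(real ^ 'n \<Rightarrow> real) \<Rightarrow> (real ^ 'n \<Rightarrow> real ^ 'm) \<Rightarrow> real \<Rightarrow> real ^ 'n \<Rightarrow> real ^ 'm \<Rightarrow>
     'm set \<Rightarrow> real ^ 'm \<Rightarrow> bool" where
  "id0_lp \<phi> g \<tau> z l Ahat lt \<longleftrightarrow>
     is_arg_max (\<lambda>l'. \<Sum>i\<in>Ahat. l' $ i) (lp_feasible \<phi> g \<tau> z l (act_est \<phi> g \<tau> z l)) lt"

text \<open>\<open>id0_loop \<dots> Ahat A0\<close>: the loop, entered with working set \<open>Ahat\<close>, may stop with
  \<open>\<A>\<^sub>0 = A0\<close>. It is a relation because the linear programs may have several solutions.\<close>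

inductive id0_loop ::
    "(real ^ 'n \<Rightarrow> real) \<Rightarrow> (real ^ 'n \<Rightarrow> real ^ 'm) \<Rightarrow> real \<Rightarrow> real \<Rightarrow>
     real ^ 'n \<Rightarrow> real ^ 'm \<Rightarrow> 'm set \<Rightarrow> 'm set \<Rightarrow> bool"
  for \<phi> g \<tau>hat \<tau> z l where
  stop_done:
    "id0_lp \<phi> g \<tau> z l Ahat lt \<Longrightarrow>
     {i \<in> Ahat. lt $ i \<ge> eta \<phi> g z l powr \<tau>hat} = {} \<Longrightarrow>
     id0_loop \<phi> g \<tau>hat \<tau> z l Ahat Ahat"
| stop_empty:
    "id0_lp \<phi> g \<tau> z l Ahat lt \<Longrightarrow>
     C = {i \<in> Ahat. lt $ i \<ge> eta \<phi> g z l powr \<tau>hat} \<Longrightarrow> C \<noteq> {} \<Longrightarrow> Ahat - C = {} \<Longrightarrow>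
     id0_loop \<phi> g \<tau>hat \<tau> z l Ahat {}"
| repeat_loop:
    "id0_lp \<phi> g \<tau> z l Ahat lt \<Longrightarrow>
     C = {i \<in> Ahat. lt $ i \<ge> eta \<phi> g z l powr \<tau>hat} \<Longrightarrow> C \<noteq> {} \<Longrightarrow> Ahat - C \<noteq> {} \<Longrightarrow>
     id0_loop \<phi> g \<tau>hat \<tau> z l (Ahat - C) A0 \<Longrightarrow>
     id0_loop \<phi> g \<tau>hat \<tau> z l Ahat A0"

definition ID0 ::
    "(real ^ 'n \<Rightarrow> real) \<Rightarrow> (real ^ 'n \<Rightarrow> real ^ 'm) \<Rightarrow> real \<Rightarrow> real \<Rightarrow>
     real ^ 'n \<Rightarrow> real ^ 'm \<Rightarrow> 'm set \<Rightarrow> 'm set \<Rightarrow> bool" where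
  "ID0 \<phi> g \<tau>hat \<tau> z l Aplus A0 \<longleftrightarrow>
     id0_loop \<phi> g \<tau>hat \<tau> z l
       (act_est \<phi> g \<tau> z l - {i. l $ i \<ge> eta \<phi> g z l powr \<tau>hat}) A0 \<and>
     Aplus = act_est \<phi> g \<tau> z l - A0"

text \<open>If \<open>\<A>\<^sub>+\<close> is empty, the scalar \<open>t\<close> in the linear program is unconstrained and the
  objective unbounded, although the multiplier is completely determined (it is \<open>0\<close>).
  In that case only feasibility is required.\<close>

definition multiplier_adjustment ::
    "(real ^ 'n \<Rightarrow> real) \<Rightarrow> (real ^ 'n \<Rightarrow> real ^ 'm) \<Rightarrow> real \<Rightarrow> real \<Rightarrow>
     real ^ 'n \<Rightarrow> real ^ 'm \<Rightarrow> real ^ 'm \<Rightarrow> bool" where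
  "multiplier_adjustment \<phi> g \<tau>hat \<tau> z l lhat \<longleftrightarrow>
     (\<exists>Aplus A0. ID0 \<phi> g \<tau>hat \<tau> z l Aplus A0 \<and>
        lp_feasible \<phi> g \<tau> z l Aplus lhat \<and>
        (Aplus \<noteq> {} \<longrightarrow>
           (\<exists>that. is_arg_max fst
              (\<lambda>(t, l'). (\<forall>i\<in>Aplus. t \<le> l' $ i) \<and> lp_feasible \<phi> g \<tau> z l Aplus l')
              (that, lhat))))"

section \<open>The sSQP subproblem\<close>

definition ssqp_objective ::
    "(real ^ 'n \<Rightarrow> real) \<Rightarrow> (real ^ 'n \<Rightarrow> real ^ 'm) \<Rightarrow> real \<Rightarrow> real ^ 'n \<Rightarrow> real ^ 'm \<Rightarrow>
     real ^ 'n \<Rightarrow> real ^ 'm \<Rightarrow> real" where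
  "ssqp_objective \<phi> g \<mu> z l d l' =
     d \<bullet> grad \<phi> z + 1/2 * (d \<bullet> (hess (lagrangian \<phi> g l) z *v d))
     + l' \<bullet> (g z + (\<chi> i. grad_comp g i z \<bullet> d)) - 1/2 * \<mu> * (norm (l' - l))\<^sup>2"

text \<open>The outer objective: the value of the inner maximization, possibly \<open>\<infinity>\<close> when \<open>\<mu> = 0\<close>.\<close>

definition ssqp_outer ::
    "(real ^ 'n \<Rightarrow> real) \<Rightarrow> (real ^ 'n \<Rightarrow> real ^ 'm) \<Rightarrow> real \<Rightarrow> real ^ 'n \<Rightarrow> real ^ 'm \<Rightarrow>
     real ^ 'n \<Rightarrow> ereal" where
  "ssqp_outer \<phi> g \<mu> z l d = (SUP l' \<in> {l'. 0 \<le> l'}. ereal (ssqp_objective \<phi> g \<mu> z l d l'))"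

text \<open>Solutions are local in \<open>\<Delta>z\<close>: the Hessian of the Lagrangian may be indefinite, and then the
  outer objective may be unbounded below globally. The last conjunct
  is automatic for \<open>\<mu> > 0\<close>, where the inner maximizer is unique and the outer objective is
  differentiable. For \<open>\<mu> = 0\<close>, where the problem degenerates to the usual quadratic program,
  it says that \<open>\<lambda>\<^sup>+\<close> is a Lagrange multiplier of that program; without it
  the inner maximizer would be arbitrary on the constraints active at \<open>\<Delta>z\<close>.\<close>

definition ssqp_solution ::
    "(real ^ 'n \<Rightarrow> real) \<Rightarrow> (real ^ 'n \<Rightarrow> real ^ 'm) \<Rightarrow> real \<Rightarrow> real ^ 'n \<Rightarrow> real ^ 'm \<Rightarrow>
     real ^ 'n \<Rightarrow> real ^ 'm \<Rightarrow> bool" where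
  "ssqp_solution \<phi> g \<mu> z l d lplus \<longleftrightarrow>
     is_arg_max (ssqp_objective \<phi> g \<mu> z l d) (\<lambda>l'. 0 \<le> l') lplus \<and>
     (\<exists>r>0. \<forall>d'\<in>ball d r. ssqp_outer \<phi> g \<mu> z l d \<le> ssqp_outer \<phi> g \<mu> z l d') \<and>
     grad (\<lambda>d'. ssqp_objective \<phi> g \<mu> z l d' lplus) d = 0"

section \<open>Algorithm sSQPa\<close>

text \<open>The radius \<open>\<rho>\<close> makes explicit what it means for \<open>(\<Delta>z, \<lambda>\<^sup>+ - \<lambda>)\<close> to be small.\<close>

definition ssqp_step ::
    "(real ^ 'n \<Rightarrow> real) \<Rightarrow> (real ^ 'n \<Rightarrow> real ^ 'm) \<Rightarrow> real \<Rightarrow> real \<Rightarrow> real ^ 'n \<Rightarrow> real ^ 'm \<Rightarrow>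
     real ^ 'n \<Rightarrow> real ^ 'm \<Rightarrow> bool" where
  "ssqp_step \<phi> g \<sigma> \<rho> z l d lplus \<longleftrightarrow>
     ssqp_solution \<phi> g (eta \<phi> g z l powr \<sigma>) z l d lplus \<and> norm (d, lplus - l) \<le> \<rho>"

definition if_condition ::
    "(real ^ 'n \<Rightarrow> real) \<Rightarrow> (real ^ 'n \<Rightarrow> real ^ 'm) \<Rightarrow> real \<Rightarrow> real ^ 'n \<Rightarrow> real ^ 'm \<Rightarrow>
     real ^ 'n \<Rightarrow> real ^ 'm \<Rightarrow> bool" where
  "if_condition \<phi> g \<sigma> z l d lplus \<longleftrightarrow>
     eta \<phi> g (z + d) lplus \<le> eta \<phi> g z l powr (1 + \<sigma>/2)"

text \<open>\<open>ssqpa_run \<dots> N z l d lp\<close>: the algorithm, started at \<open>(z0, l0)\<close>, may execute its loop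
  body \<open>N\<close> times (\<open>N = \<infinity>\<close> allowed), where pass \<open>k\<close> starts from \<open>(z k, l k)\<close> and computes
  \<open>(d k, lp k)\<close>. The stopping test comes after each pass, so pass \<open>k + 1\<close> is executed only if
  \<open>\<not> \<eta> < tol\<close> at \<open>(z (k + 1), l (k + 1))\<close>. The
  index counts passes; it agrees with the iteration counter of the algorithm as long as
  the else-branch is not taken.\<close>

definition ssqpa_run ::
    "(real ^ 'n \<Rightarrow> real) \<Rightarrow> (real ^ 'n \<Rightarrow> real ^ 'm) \<Rightarrow> real \<Rightarrow> real \<Rightarrow> real \<Rightarrow> real \<Rightarrow> real \<Rightarrow>
     real ^ 'n \<Rightarrow> real ^ 'm \<Rightarrow> enat \<Rightarrow>
     (nat \<Rightarrow> real ^ 'n) \<Rightarrow> (nat \<Rightarrow> real ^ 'm) \<Rightarrow> (nat \<Rightarrow> real ^ 'n) \<Rightarrow> (nat \<Rightarrow> real ^ 'm) \<Rightarrow> bool"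
  where
  "ssqpa_run \<phi> g \<sigma> \<tau>hat \<tau> tol \<rho> z0 l0 N z l d lp \<longleftrightarrow>
     z 0 = z0 \<and> multiplier_adjustment \<phi> g \<tau>hat \<tau> z0 l0 (l 0) \<and>
     (\<forall>k. enat k < N \<longrightarrow>
        (k > 0 \<longrightarrow> \<not> eta \<phi> g (z k) (l k) < tol) \<and>
        ssqp_step \<phi> g \<sigma> \<rho> (z k) (l k) (d k) (lp k) \<and>
        (if if_condition \<phi> g \<sigma> (z k) (l k) (d k) (lp k)
         then z (Suc k) = z k + d k \<and> l (Suc k) = lp k
         else z (Suc k) = z k \<and> multiplier_adjustment \<phi> g \<tau>hat \<tau> (z k) (l k) (l (Suc k))))"

text \<open>Stated with \<open>O\<close> and \<open>o\<close> rather than with quotients, so that sequences reaching \<open>0\<close> in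
  finitely many steps are covered.\<close>

definition Q_superlinear_to_zero :: "(nat \<Rightarrow> real) \<Rightarrow> bool" where
  "Q_superlinear_to_zero x \<longleftrightarrow> x \<longlonglongrightarrow> 0 \<and> (\<lambda>k. x (Suc k)) \<in> o(x)"

definition Q_order :: "real \<Rightarrow> (nat \<Rightarrow> real) \<Rightarrow> bool" where
  "Q_order p x \<longleftrightarrow> (\<lambda>k. x (Suc k)) \<in> O(\<lambda>k. x k powr p)"

end

theory Submission
  imports Defs
begin

text \<open>The key is an energy identity. Let \<open>(D, \<nu>)\<close> be the difference between the new iterate and a
  point \<open>(zs, ls)\<close> of the solution set. Testing the difference of the two KKT systems with \<open>D\<close> gives
  \<open>D \<bullet> H D + \<mu> |\<nu>|\<^sup>2 + p\<close> equal to residual terms, where \<open>p = - ls \<bullet> rr \<ge> 0\<close> collects the slacks \<open>rr\<close> of the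
  linearised constraints, and the second-order condition makes the left-hand side coercive up to
  the violation of the critical cone, which \<open>p\<close> and \<open>\<mu> |\<nu>|\<close> control. With \<open>\<mu> = 0\<close> and Hoffman's bound
  for the multiplier set this yields the error bound \<open>\<delta> = O(\<eta>)\<close>; with \<open>\<mu> = \<eta>\<^sup>\<sigma>\<close> it yields
  \<open>|\<Delta>z| + |\<lambda>\<^sup>+ - \<lambda>| = O(\<delta>)\<close>, and then the KKT residual at the new point is \<open>O(\<mu> \<delta>) = O(\<delta>\<^sup>1\<^sup>+\<^sup>\<sigma>)\<close>.
  The multiplier adjustment enters only through the fact that it returns a multiplier close to the
  multiplier set.\<close>

section \<open>Hoffman's bound and elementary estimates\<close>

text \<open>Multipliers need not be unique, so the KKT system is singular and no argument with an
  invertible Jacobian is available; the multiplier error enters the energy only with the weight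
  \<mu>. What makes this weak term sufficient is \<delta> \<le> \<kappa> \<mu>, which the error
  bound supplies: it turns every \<delta>^2 into \<kappa> \<mu> \<delta>, so that the cross terms
  can be absorbed. By itself the energy estimate keeps the new distance only of order \<delta>; the
  rate arises by applying the error bound a second time, at the new point. All these estimates speak
  of a given solution with a small step. That one exists is a separate matter, because the Hessian
  may be indefinite and the outer objective unbounded below. It is minimised over a small closed
  ball around the step \<open>zs - z\<close>, and a growth estimate obtained from a penalising test
  multiplier keeps the minimiser off the boundary.\<close>

lemma norm_matrix_vector_mult_le:
  fixes A :: "real^'n^'m"
  shows "norm (A *v x) \<le> norm A * norm x"
proof -
  have "norm (A *v x) = L2_set (\<lambda>i. norm ((A *v x) $ i)) UNIV" by (rule norm_vec_def)
  also have "\<dots> \<le> L2_set (\<lambda>i. norm (A $ i) * norm x) UNIV"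
    by (rule L2_set_mono) (simp_all add: matrix_mult_dot Cauchy_Schwarz_ineq2)
  also have "\<dots> = norm A * norm x"
    by (simp add: norm_vec_def[of A] L2_set_left_distrib)
  finally show ?thesis .
qed

lemma onorm_matrix_le:
  fixes A :: "real^'n^'m"
  shows "onorm ((*v) A) \<le> norm A"
  by (rule onorm_le) (rule norm_matrix_vector_mult_le)

text \<open>If \<open>y\<close> is the projection of \<open>x\<close>, then \<open>v = x - y\<close> is nonnegative on \<open>I = {i. y $ i = 0}\<close> and
  \<open>v \<bullet> w \<le> 0\<close> for every \<open>w\<close> in the kernel of \<open>A\<close> that is nonnegative on \<open>I\<close>. For each \<open>I\<close> the unit vectors
  of this kind form a compact set on which \<open>A\<close> does not vanish.\<close>

lemma hoffman_nonneg:
  fixes A :: "real^'m \<Rightarrow> 'b::real_normed_vector"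
  assumes A: "bounded_linear A" and ne: "\<exists>y\<ge>0. A y = b"
  obtains C where "C > 0"
    "\<And>x. 0 \<le> x \<Longrightarrow> \<exists>y\<ge>0. A y = b \<and> norm (x - y) \<le> C * norm (A x - b)"
proof -
  interpret bounded_linear A by (rule A)
  define S where "S = {y. 0 \<le> y \<and> A y = b}"
  have contA: "continuous_on X A" for X
    using continuous_on continuous_on_id by blast
  have closed_nn: "closed {y::real^'m. 0 \<le> y}"
    by (simp add: less_eq_vec_def closed_Collect_all closed_Collect_le continuous_on_component)
  have "closed S"
    unfolding S_def using closed_nn
    by (intro closed_Collect_conj closed_Collect_eq contA) (auto simp: continuous_on_const)
  have "S \<noteq> {}" using ne by (auto simp: S_def)
  define Q where "Q I = {v::real^'m. norm v = 1 \<and> (\<forall>i\<in>I. 0 \<le> v $ i) \<and>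
      (\<forall>w. A w = 0 \<and> (\<forall>i\<in>I. 0 \<le> w $ i) \<longrightarrow> v \<bullet> w \<le> 0)}" for I
  have Qc: "\<exists>c>0. \<forall>v\<in>Q I. c \<le> norm (A v)" for I
  proof (cases "Q I = {}")
    case True then show ?thesis by (auto intro: exI[of _ 1])
  next
    case False
    have "closed (Q I)"
    proof -
      have "Q I = sphere 0 1 \<inter> (\<Inter>i\<in>I. {v. 0 \<le> v $ i}) \<inter>
        (\<Inter>w\<in>{w. A w = 0 \<and> (\<forall>i\<in>I. 0 \<le> w $ i)}. {v. v \<bullet> w \<le> 0})"
        by (auto simp: Q_def)
      then show ?thesis
        by (auto intro!: closed_Int closed_INT closed_Collect_le continuous_intros)
    qed
    moreover have "bounded (Q I)"
      by (rule bounded_subset[of "cball 0 1"]) (auto simp: Q_def)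
    ultimately have "compact (Q I)" by (simp add: compact_eq_bounded_closed)
    then obtain v where v: "v \<in> Q I" "\<And>u. u \<in> Q I \<Longrightarrow> norm (A v) \<le> norm (A u)"
      using continuous_attains_inf[of "Q I" "\<lambda>v. norm (A v)"] False
      by (auto intro: continuous_on_norm contA)
    \<comment> \<open>Otherwise \<open>v\<close> itself is an admissible \<open>w\<close> in the
      definition of \<open>Q\<close>, which forces \<open>v \<bullet> v \<le> 0\<close>.\<close>
    have "A v \<noteq> 0"
    proof
      assume "A v = 0"
      with v(1) have "v \<bullet> v \<le> 0" by (auto simp: Q_def)
      then have "v = 0" by (metis inner_gt_zero_iff linorder_not_less)
      with v(1) show False by (simp add: Q_def)
    qed
    then show ?thesis using v by (intro exI[of _ "norm (A v)"]) auto
  qed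
  then obtain c where c: "\<And>I. c I > 0" "\<And>I v. v \<in> Q I \<Longrightarrow> c I \<le> norm (A v)"
    by metis
  \<comment> \<open>There are finitely many index sets \<open>I\<close>. Summing over all of them
    gives a constant independent of \<open>x\<close>, although the zero set of the projection of
    \<open>x\<close> varies.\<close>
  define C where "C = (\<Sum>I\<in>UNIV. 1 / c I)"
  have Cc: "1 / c I \<le> C" for I
    unfolding C_def by (rule member_le_sum) (auto intro: less_imp_le c)
  have "C > 0" using Cc[of UNIV] c(1)[of UNIV] by (meson divide_pos_pos less_le_trans zero_less_one)
  moreover have "\<exists>y\<ge>0. A y = b \<and> norm (x - y) \<le> C * norm (A x - b)" if x: "0 \<le> x" for x
  proof -
    obtain y where y: "y \<in> S" "infdist x S = dist x y"
      using infdist_attains_inf[OF \<open>closed S\<close> \<open>S \<noteq> {}\<close>] by blast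
    have ymin: "norm (x - y) \<le> norm (x - u)" if "u \<in> S" for u
      using infdist_le[OF that, of x] y(2) by (simp add: dist_norm)
    have y0: "0 \<le> y" and yb: "A y = b" using y by (auto simp: S_def)
    define v where "v = x - y"
    define I where "I = {i. y $ i = 0}"
    have "norm v \<le> C * norm (A x - b)"
    proof (cases "v = 0")
      case True with \<open>C > 0\<close> show ?thesis by simp
    next
      case False
      \<comment> \<open>If \<open>v \<bullet> w > 0\<close>, a short step from the projection
        \<open>y\<close> along \<open>w\<close> stays in \<open>S\<close> and comes closer to
        \<open>x\<close>.\<close>
      have vw: "v \<bullet> w \<le> 0" if w: "A w = 0" "\<forall>i\<in>I. 0 \<le> w $ i" for w
      proof (rule ccontr)
        assume "\<not> v \<bullet> w \<le> 0"
        then have pos: "v \<bullet> w > 0" by simp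
        have "\<exists>s>0. \<forall>t. 0 \<le> t \<and> t \<le> s \<longrightarrow> 0 \<le> y $ i + t * w $ i" for i
        proof (cases "i \<in> I \<or> w $ i \<ge> 0")
          case True
          then have "w $ i \<ge> 0" using w by auto
          then show ?thesis using y0 by (intro exI[of _ 1]) (auto simp: less_eq_vec_def)
        next
          case False
          then have yi: "y $ i > 0" using y0 by (auto simp: I_def less_eq_vec_def order.strict_iff_order)
          have wi: "w $ i < 0" using False by auto
          show ?thesis
          proof (intro exI conjI allI impI)
            show "y $ i / - w $ i > 0" using yi wi by (simp add: divide_pos_neg)
            fix t assume "0 \<le> t \<and> t \<le> y $ i / - w $ i"
            then show "0 \<le> y $ i + t * w $ i" using wi by (simp add: field_simps)
          qed
        qed
        then obtain s where s: "\<And>i. s i > 0" "\<And>i t. 0 \<le> t \<Longrightarrow> t \<le> s i \<Longrightarrow> 0 \<le> y $ i + t * w $ i"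
          by metis
        define s0 where "s0 = Min (range s)"
        have s0: "s0 > 0" "\<And>i. s0 \<le> s i" by (auto simp: s0_def s)
        \<comment> \<open>The first bound keeps \<open>y + t *\<^sub>R w\<close> nonnegative; the
          second keeps the loss \<open>t\<^sup>2 * (norm w)\<^sup>2\<close> below the gain
          \<open>2 * t * (v \<bullet> w)\<close>.\<close>
        define t where "t = min s0 (v \<bullet> w / (1 + (norm w)\<^sup>2))"
        have den: "1 + (norm w)\<^sup>2 > 0" by (smt (verit) zero_le_power2)
        have t: "0 < t" "t \<le> s0" "t \<le> v \<bullet> w / (1 + (norm w)\<^sup>2)"
          using s0 pos den by (simp_all add: t_def)
        have t3: "t * (1 + (norm w)\<^sup>2) \<le> v \<bullet> w"
          using t(3) den by (simp add: pos_le_divide_eq)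
        have "y + t *\<^sub>R w \<in> S"
          using s(2)[of t] t s0(2) y yb w by (auto simp: S_def less_eq_vec_def add scaleR order_trans)
        from ymin[OF this] have "(norm v)\<^sup>2 \<le> (norm (v - t *\<^sub>R w))\<^sup>2"
          by (simp add: v_def algebra_simps)
        also have "\<dots> = (norm v)\<^sup>2 - 2 * t * (v \<bullet> w) + t\<^sup>2 * (norm w)\<^sup>2"
          unfolding power2_norm_eq_inner
          by (simp add: inner_diff_left inner_diff_right inner_commute algebra_simps power2_eq_square)
        finally have "2 * t * (v \<bullet> w) \<le> t * (t * (norm w)\<^sup>2)" by (simp add: power2_eq_square)
        then have "2 * (v \<bullet> w) \<le> t * (norm w)\<^sup>2" using t(1) by simp
        with t t3 pos show False by (smt (verit) distrib_left mult_cancel_left1)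
      qed
      have vI: "\<forall>i\<in>I. 0 \<le> v $ i" using x by (auto simp: v_def I_def less_eq_vec_def)
      have "(1 / norm v) *\<^sub>R v \<in> Q I"
        using False vI vw by (auto simp: Q_def divide_nonpos_nonneg)
      then have "c I \<le> norm (A ((1 / norm v) *\<^sub>R v))" by (rule c)
      then have "norm v \<le> 1 / c I * norm (A v)"
        using False c(1)[of I] by (simp add: scaleR field_simps)
      also have "\<dots> \<le> C * norm (A v)" by (rule mult_right_mono[OF Cc]) simp
      also have "A v = A x - b" by (simp add: v_def diff yb)
      finally show ?thesis .
    qed
    then show ?thesis using y0 yb v_def by blast
  qed
  ultimately show thesis by (rule that)
qed

section \<open>Elementary estimates for norms and real inequalities\<close>

lemma onorm_inner_le: "onorm (\<lambda>h. h \<bullet> (v::'a::euclidean_space)) \<le> norm v"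
  by (rule onorm_le) (metis Cauchy_Schwarz_ineq2 mult.commute real_norm_def)

lemma norm_vec_le_card:
  fixes x :: "real^'m"
  assumes "\<And>i. \<bar>x $ i\<bar> \<le> c"
  shows "norm x \<le> real CARD('m) * c"
proof -
  have "norm x \<le> (\<Sum>i\<in>UNIV. \<bar>x $ i\<bar>)" by (rule norm_le_l1_cart)
  also have "\<dots> \<le> (\<Sum>i\<in>(UNIV::'m set). c)" by (intro sum_mono assms)
  finally show ?thesis by simp
qed

lemma inner_self_sum: "x \<bullet> x = (\<Sum>i\<in>UNIV. (x $ i)\<^sup>2)" for x :: "real^'m"
  by (simp add: inner_vec_def power2_eq_square)

lemma sum_sq_le_norm: "(\<Sum>i\<in>I. (x $ i)\<^sup>2) \<le> (norm x)\<^sup>2" for x :: "real^'m"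
  unfolding power2_norm_eq_inner inner_self_sum by (rule sum_mono2) auto

lemma square_sum3_le: "(x + y + z)\<^sup>2 \<le> 3 * (x\<^sup>2 + y\<^sup>2 + z\<^sup>2)" for x y z :: real
proof -
  have "0 \<le> (x - y)\<^sup>2 + (y - z)\<^sup>2 + (x - z)\<^sup>2" by simp
  then show ?thesis by (simp add: power2_eq_square algebra_simps)
qed

text \<open>If \<open>d > \<epsilon>\<close>, then
  \<open>\<epsilon>\<^sup>2 \<le> \<epsilon> * d\<close> and one factor \<open>d\<close> cancels,
  leaving \<open>a * d \<le> 3 * Q * \<epsilon>\<close>. The summand \<open>1\<close> in the
  constant covers the case \<open>d \<le> \<epsilon>\<close>.\<close>

lemma quadratic_le_imp_linear_le:
  fixes a d \<epsilon> Q :: real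
  assumes a: "0 < a" and "0 \<le> \<epsilon>" "0 \<le> d" "0 \<le> Q" and le: "a * d\<^sup>2 \<le> Q * (\<epsilon>\<^sup>2 + 2 * \<epsilon> * d)"
  shows "d \<le> (1 + 3 * Q / a) * \<epsilon>"
proof (cases "d \<le> \<epsilon>")
  case True
  have "0 \<le> 3 * Q / a * \<epsilon>" using assms by simp
  with True show ?thesis by (simp add: distrib_right)
next
  case False
  then have d: "d > 0" "\<epsilon> \<le> d" using assms by auto
  have "a * d\<^sup>2 \<le> Q * (\<epsilon>\<^sup>2 + 2 * \<epsilon> * d)" by (rule le)
  also have "\<dots> \<le> Q * (\<epsilon> * d + 2 * \<epsilon> * d)"
    using assms d by (intro mult_left_mono add_mono) (auto simp: power2_eq_square mult_left_mono)
  finally have "(a * d) * d \<le> (3 * Q * \<epsilon>) * d" by (simp add: power2_eq_square algebra_simps)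
  then have "a * d \<le> 3 * Q * \<epsilon>" using d by simp
  then have "d \<le> 3 * Q / a * \<epsilon>" using a by (simp add: field_simps)
  then show ?thesis using assms by (simp add: distrib_right)
qed

text \<open>The objective is expanded exactly around \<open>t\<close> with slope
  \<open>q = c - \<mu> * (t - u)\<close>, so the linear case \<open>\<mu> = 0\<close> and the
  strictly concave case are treated together. Necessity uses a step so short that the quadratic loss
  stays below the linear gain.\<close>

lemma concave_max_on_nonneg_iff:
  fixes c \<mu> t u :: real
  assumes \<mu>: "0 \<le> \<mu>" and t: "0 \<le> t"
  shows "(\<forall>s\<ge>0. s * c - \<mu> / 2 * (s - u)\<^sup>2 \<le> t * c - \<mu> / 2 * (t - u)\<^sup>2) \<longleftrightarrow>
    c - \<mu> * (t - u) \<le> 0 \<and> t * (c - \<mu> * (t - u)) = 0"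
proof -
  define q where "q = c - \<mu> * (t - u)"
  have diff: "(s * c - \<mu> / 2 * (s - u)\<^sup>2) - (t * c - \<mu> / 2 * (t - u)\<^sup>2) = (s - t) * q - \<mu> / 2 * (s - t)\<^sup>2" for s
    by (simp add: q_def power2_eq_square field_simps)
  \<comment> \<open>The step length has \<open>\<mu> + 1\<close> rather than \<mu> in its
    denominator, which keeps it meaningful for \<open>\<mu> = 0\<close>.\<close>
  have small: "\<mu> / 2 * (x / (\<mu> + 1)) < x" if "0 < x" for x
    using that \<mu> by (simp add: field_simps add_nonneg_pos)
  show ?thesis
  proof
    assume max: "\<forall>s\<ge>0. s * c - \<mu> / 2 * (s - u)\<^sup>2 \<le> t * c - \<mu> / 2 * (t - u)\<^sup>2"
    have le: "(s - t) * q - \<mu> / 2 * (s - t)\<^sup>2 \<le> 0" if "0 \<le> s" for s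
      using max that diff[of s] by fastforce
    have "q \<le> 0"
    proof (rule ccontr)
      assume "\<not> q \<le> 0"
      then have q: "q > 0" by simp
      define h where "h = q / (\<mu> + 1)"
      have h: "h > 0" using q \<mu> by (simp add: h_def add_pos_nonneg)
      have "h * q - \<mu> / 2 * h\<^sup>2 \<le> 0" using le[of "t + h"] t h by simp
      then have "h * (q - \<mu> / 2 * h) \<le> 0" by (simp add: power2_eq_square algebra_simps)
      then have "q \<le> \<mu> / 2 * h" using h by (simp add: mult_le_0_iff)
      then show False using small[OF q] by (simp add: h_def)
    qed
    moreover have "t * q = 0"
    proof (rule ccontr)
      assume "t * q \<noteq> 0"
      then have t0: "t > 0" and q: "- q > 0" using t \<open>q \<le> 0\<close> by auto
      define h where "h = min t ((- q) / (\<mu> + 1))"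
      have h: "h > 0" "h \<le> t" "h \<le> (- q) / (\<mu> + 1)" using t0 q \<mu> by (auto simp: h_def divide_neg_pos add_nonneg_pos)
      have "- (h * q) - \<mu> / 2 * h\<^sup>2 \<le> 0" using le[of "t - h"] h by simp
      then have "h * (- q - \<mu> / 2 * h) \<le> 0" by (simp add: power2_eq_square algebra_simps)
      then have "- q \<le> \<mu> / 2 * h" using h by (simp add: mult_le_0_iff)
      also have "\<dots> \<le> \<mu> / 2 * ((- q) / (\<mu> + 1))" using h \<mu> by (intro mult_left_mono) auto
      finally show False using small[OF q] by simp
    qed
    ultimately show "c - \<mu> * (t - u) \<le> 0 \<and> t * (c - \<mu> * (t - u)) = 0" by (simp add: q_def)
  next
    assume "c - \<mu> * (t - u) \<le> 0 \<and> t * (c - \<mu> * (t - u)) = 0"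
    then have q: "q \<le> 0" "t * q = 0" by (auto simp: q_def)
    show "\<forall>s\<ge>0. s * c - \<mu> / 2 * (s - u)\<^sup>2 \<le> t * c - \<mu> / 2 * (t - u)\<^sup>2"
    proof (intro allI impI)
      fix s :: real assume "0 \<le> s"
      then have "s * q \<le> 0" using q by (simp add: mult_nonneg_nonpos)
      moreover have "0 \<le> \<mu> / 2 * (s - t)\<^sup>2" using \<mu> by simp
      ultimately have "(s - t) * q - \<mu> / 2 * (s - t)\<^sup>2 \<le> 0"
        using q(2) left_diff_distrib[of s t q] by linarith
      then show "s * c - \<mu> / 2 * (s - u)\<^sup>2 \<le> t * c - \<mu> / 2 * (t - u)\<^sup>2" using diff[of s] by simp
    qed
  qed
qed

section \<open>Absorbing the cross terms of the energy inequality\<close>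

text \<open>\<open>D\<close> and \<open>n\<close> stand for the primal and the multiplier error of
  the new iterate, \<delta> for the distance of the old one; the last premise is the energy
  inequality after its residuals have been estimated with constant \<open>P\<close>. For
  \<open>\<mu> = 0\<close> the left-hand side carries no information on \<open>n\<close>, hence the
  guard in the conclusion.\<close>

definition absorbs :: "real \<Rightarrow> real \<Rightarrow> real \<Rightarrow> real \<Rightarrow> real \<Rightarrow> real \<Rightarrow> bool" where
  "absorbs a P C5 \<kappa> \<delta>1 C \<longleftrightarrow>
     (\<forall>\<delta> \<mu> D n. 0 \<le> \<delta> \<longrightarrow> \<delta> \<le> \<delta>1 \<longrightarrow> 0 \<le> \<mu> \<longrightarrow> \<mu> \<le> 1 \<longrightarrow> \<delta> \<le> \<kappa> * \<mu> \<longrightarrow> 0 \<le> D \<longrightarrow> 0 \<le> n \<longrightarrow>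
       a * D\<^sup>2 + \<mu> / 2 * n\<^sup>2 \<le> P * (\<delta> * D + \<delta> * n + \<delta>\<^sup>2) * D + n * (P * (\<mu> * \<delta> + \<delta> * D)) + C5 * (P * (\<mu> * \<delta> + \<delta> * D))\<^sup>2 \<longrightarrow>
       D \<le> C * \<delta> \<and> (\<mu> > 0 \<longrightarrow> n \<le> C * \<delta>))"

text \<open>Each term on the right is bounded separately, the mixed ones by Young's inequality.
  \<open>t1\<close>, \<open>t2\<close>, \<open>t3\<close>, \<open>t5\<close> take
  \<open>a / 8 * D\<^sup>2\<close> each and \<open>t2\<close>, \<open>t4\<close> take
  \<open>\<mu> / 8 * n\<^sup>2\<close> each, half of the left-hand side in all. The rest is of order
  \<open>\<mu> * \<delta>\<^sup>2\<close>, because \<delta> \<le> \<kappa> \<mu> trades a factor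
  \<delta> for \<mu>; this factor \<mu> is what allows dividing by \<mu> to bound
  \<open>n\<close>.\<close>

lemma energy_absorb:
  fixes a P C5 \<kappa> :: real
  assumes a: "a > 0" and P: "P > 0" and C5: "C5 > 0" and \<kappa>: "\<kappa> > 0"
  shows "\<exists>\<delta>1>0. \<exists>C>0. absorbs a P C5 \<kappa> \<delta>1 C"
proof -
  \<comment> \<open>The entry \<open>1\<close> and the third entry serve \<open>t5\<close>, the
    second \<open>t1\<close>, the last \<open>t2\<close>.\<close>
  define \<delta>1 where "\<delta>1 = Min {1, a / (8 * P), a / (16 * C5 * P\<^sup>2), a / (64 * P\<^sup>2 * \<kappa>)}"
  have \<delta>1: "\<delta>1 > 0" using assms by (auto simp: \<delta>1_def)
  have \<delta>s: "\<delta>1 \<le> 1" "\<delta>1 \<le> a / (8 * P)" "\<delta>1 \<le> a / (16 * C5 * P\<^sup>2)" "\<delta>1 \<le> a / (64 * P\<^sup>2 * \<kappa>)"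
    unfolding \<delta>1_def by (rule Min_le; simp)+
  define C' where "C' = 2 * C5 * P\<^sup>2 + 2 * P\<^sup>2 * \<kappa>\<^sup>2 / a + 2 * P\<^sup>2"
  have C': "C' > 0" using assms by (simp add: C'_def add_pos_pos)
  define C where "C = sqrt (2 * C' / a) + sqrt (4 * C')"
  have C: "C > 0" using C' a by (simp add: C_def add_pos_pos)
  have "D \<le> C * \<delta> \<and> (\<mu> > 0 \<longrightarrow> n \<le> C * \<delta>)"
    if \<delta>: "0 \<le> \<delta>" "\<delta> \<le> \<delta>1" and \<mu>: "0 \<le> \<mu>" "\<mu> \<le> 1" and \<delta>\<mu>: "\<delta> \<le> \<kappa> * \<mu>" and D: "0 \<le> D" and n: "0 \<le> n"
      and le: "a * D\<^sup>2 + \<mu> / 2 * n\<^sup>2 \<le> P * (\<delta> * D + \<delta> * n + \<delta>\<^sup>2) * D + n * (P * (\<mu> * \<delta> + \<delta> * D)) + C5 * (P * (\<mu> * \<delta> + \<delta> * D))\<^sup>2"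
    for \<delta> \<mu> D n
  proof -
    have young: "2 * (x * y) \<le> s * x\<^sup>2 + y\<^sup>2 / s" if "s > 0" for s x y :: real
    proof -
      have "0 \<le> (s * x - y)\<^sup>2" by simp
      then have "2 * (x * y) * s \<le> s\<^sup>2 * x\<^sup>2 + y\<^sup>2" by (simp add: power2_eq_square algebra_simps)
      then have "(2 * (x * y) * s) / s \<le> (s\<^sup>2 * x\<^sup>2 + y\<^sup>2) / s" using that by (intro divide_right_mono) auto
      then show ?thesis using that by (simp add: add_divide_distrib power2_eq_square)
    qed
    have t1: "P * \<delta> * D\<^sup>2 \<le> a / 8 * D\<^sup>2"
    proof (rule mult_right_mono)
      have "P * \<delta> \<le> P * \<delta>1" using \<delta> P by simp
      also have "\<dots> \<le> a / 8" using \<delta>s(2) P by (simp add: field_simps)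
      finally show "P * \<delta> \<le> a / 8" .
    qed simp
    have t2: "2 * (P * \<delta> * n * D) \<le> a / 8 * D\<^sup>2 + \<mu> / 8 * n\<^sup>2"
    proof -
      have "2 * (D * (P * \<delta> * n)) \<le> a / 8 * D\<^sup>2 + (P * \<delta> * n)\<^sup>2 / (a / 8)"
        using a by (intro young) simp
      also have "(P * \<delta> * n)\<^sup>2 / (a / 8) \<le> \<mu> / 8 * n\<^sup>2"
      proof -
        have "\<delta> * \<delta> \<le> a / (64 * P\<^sup>2 * \<kappa>) * (\<kappa> * \<mu>)"
          using \<delta> \<delta>s(4) \<delta>\<mu> a P \<kappa> by (intro mult_mono) auto
        also have "\<dots> = a * \<mu> / (64 * P\<^sup>2)" using \<kappa> by simp
        finally have "64 * P\<^sup>2 * \<delta>\<^sup>2 \<le> a * \<mu>" using P by (simp add: power2_eq_square field_simps)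
        then have "64 * P\<^sup>2 * \<delta>\<^sup>2 * n\<^sup>2 \<le> a * \<mu> * n\<^sup>2" by (intro mult_right_mono) auto
        then show ?thesis using a by (simp add: power_mult_distrib field_simps)
      qed
      finally show ?thesis by (simp add: mult_ac)
    qed
    have t3: "P * \<delta>\<^sup>2 * D \<le> a / 8 * D\<^sup>2 + 2 * P\<^sup>2 * \<kappa>\<^sup>2 / a * (\<mu> * \<delta>\<^sup>2)"
    proof -
      have "2 * (D * (P * \<delta>\<^sup>2 / 2)) \<le> a / 8 * D\<^sup>2 + (P * \<delta>\<^sup>2 / 2)\<^sup>2 / (a / 8)"
        using a by (intro young) simp
      also have "(P * \<delta>\<^sup>2 / 2)\<^sup>2 / (a / 8) = 2 * P\<^sup>2 / a * (\<delta>\<^sup>2 * \<delta>\<^sup>2)"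
        by (simp add: power2_eq_square field_simps)
      also have "\<dots> \<le> 2 * P\<^sup>2 / a * (\<kappa>\<^sup>2 * \<mu> * \<delta>\<^sup>2)"
      proof (intro mult_left_mono mult_right_mono)
        have "\<delta>\<^sup>2 \<le> (\<kappa> * \<mu>)\<^sup>2" using \<delta> \<delta>\<mu> by (intro power_mono)
        also have "\<dots> = \<kappa>\<^sup>2 * (\<mu> * \<mu>)" by (simp add: power2_eq_square)
        also have "\<dots> \<le> \<kappa>\<^sup>2 * (\<mu> * 1)" using \<mu> by (intro mult_left_mono) auto
        finally show "\<delta>\<^sup>2 \<le> \<kappa>\<^sup>2 * \<mu>" by simp
      qed (use a in auto)
      finally show ?thesis by (simp add: mult_ac)
    qed
    have t4: "P * \<mu> * \<delta> * n \<le> \<mu> / 8 * n\<^sup>2 + 2 * P\<^sup>2 * (\<mu> * \<delta>\<^sup>2)"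
    proof -
      have "2 * (n * (P * \<delta> / 2)) \<le> 1 / 8 * n\<^sup>2 + (P * \<delta> / 2)\<^sup>2 / (1 / 8)"
        by (intro young) simp
      also have "\<dots> = 1 / 8 * n\<^sup>2 + 2 * P\<^sup>2 * \<delta>\<^sup>2" by (simp add: power2_eq_square field_simps)
      finally have "\<mu> * (2 * (n * (P * \<delta> / 2))) \<le> \<mu> * (1 / 8 * n\<^sup>2 + 2 * P\<^sup>2 * \<delta>\<^sup>2)"
        using \<mu> by (intro mult_left_mono)
      then show ?thesis by (simp add: algebra_simps)
    qed
    have t5: "C5 * (P * (\<mu> * \<delta> + \<delta> * D))\<^sup>2 \<le> 2 * C5 * P\<^sup>2 * (\<mu> * \<delta>\<^sup>2) + a / 8 * D\<^sup>2"
    proof -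
      have "(\<mu> * \<delta> + \<delta> * D)\<^sup>2 \<le> 2 * ((\<mu> * \<delta>)\<^sup>2 + (\<delta> * D)\<^sup>2)"
        using sum_squares_bound[of "\<mu> * \<delta>" "\<delta> * D"] by (simp add: power2_sum)
      also have "\<dots> \<le> 2 * (\<mu> * \<delta>\<^sup>2 + \<delta> * D\<^sup>2)"
      proof (intro mult_left_mono add_mono)
        have "\<mu> * \<mu> \<le> \<mu> * 1" using \<mu> by (intro mult_left_mono) auto
        then have "(\<mu> * \<mu>) * \<delta>\<^sup>2 \<le> (\<mu> * 1) * \<delta>\<^sup>2" by (rule mult_right_mono) simp
        then show "(\<mu> * \<delta>)\<^sup>2 \<le> \<mu> * \<delta>\<^sup>2" by (simp add: power2_eq_square mult_ac)
        have "\<delta> * \<delta> \<le> \<delta> * 1" using \<delta> \<delta>s by (intro mult_left_mono) auto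
        then have "(\<delta> * \<delta>) * D\<^sup>2 \<le> (\<delta> * 1) * D\<^sup>2" by (rule mult_right_mono) simp
        then show "(\<delta> * D)\<^sup>2 \<le> \<delta> * D\<^sup>2" by (simp add: power2_eq_square mult_ac)
      qed simp
      finally have "C5 * P\<^sup>2 * (\<mu> * \<delta> + \<delta> * D)\<^sup>2 \<le> C5 * P\<^sup>2 * (2 * (\<mu> * \<delta>\<^sup>2 + \<delta> * D\<^sup>2))"
        using C5 by (intro mult_left_mono) auto
      moreover have "2 * C5 * P\<^sup>2 * \<delta> * D\<^sup>2 \<le> a / 8 * D\<^sup>2"
      proof (rule mult_right_mono)
        have "2 * C5 * P\<^sup>2 * \<delta> \<le> 2 * C5 * P\<^sup>2 * \<delta>1" using \<delta> C5 by (intro mult_left_mono) auto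
        also have "\<dots> \<le> a / 8" using \<delta>s(3) P C5 by (simp add: field_simps)
        finally show "2 * C5 * P\<^sup>2 * \<delta> \<le> a / 8" .
      qed simp
      moreover have "C5 * P\<^sup>2 * (2 * (\<mu> * \<delta>\<^sup>2 + \<delta> * D\<^sup>2)) = 2 * C5 * P\<^sup>2 * (\<mu> * \<delta>\<^sup>2) + 2 * C5 * P\<^sup>2 * \<delta> * D\<^sup>2"
        by (simp add: algebra_simps)
      moreover have "C5 * (P * (\<mu> * \<delta> + \<delta> * D))\<^sup>2 = C5 * P\<^sup>2 * (\<mu> * \<delta> + \<delta> * D)\<^sup>2"
        by (simp only: power_mult_distrib mult.assoc)
      ultimately show ?thesis by linarith
    qed
    have rhs: "P * (\<delta> * D + \<delta> * n + \<delta>\<^sup>2) * D + n * (P * (\<mu> * \<delta> + \<delta> * D))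
        = P * \<delta> * D\<^sup>2 + 2 * (P * \<delta> * n * D) + P * \<delta>\<^sup>2 * D + P * \<mu> * \<delta> * n"
      by (simp add: power2_eq_square algebra_simps)
    have "a * D\<^sup>2 + \<mu> / 2 * n\<^sup>2 \<le> a / 2 * D\<^sup>2 + \<mu> / 4 * n\<^sup>2 + C' * (\<mu> * \<delta>\<^sup>2)"
      using le[unfolded rhs] t1 t2 t3 t4 t5 unfolding C'_def distrib_right by linarith
    then have main: "a / 2 * D\<^sup>2 + \<mu> / 4 * n\<^sup>2 \<le> C' * (\<mu> * \<delta>\<^sup>2)" by linarith
    have pos: "0 \<le> a / 2 * D\<^sup>2" "0 \<le> \<mu> / 4 * n\<^sup>2" using a \<mu> by auto
    have "a / 2 * D\<^sup>2 \<le> C' * \<delta>\<^sup>2"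
    proof -
      have "\<mu> * \<delta>\<^sup>2 \<le> 1 * \<delta>\<^sup>2" using \<mu> by (intro mult_right_mono) auto
      then have "C' * (\<mu> * \<delta>\<^sup>2) \<le> C' * \<delta>\<^sup>2" using C' by simp
      then show ?thesis using main pos by linarith
    qed
    then have "D\<^sup>2 \<le> 2 * C' / a * \<delta>\<^sup>2" using a by (simp add: field_simps)
    then have "D \<le> sqrt (2 * C' / a * \<delta>\<^sup>2)" by (rule real_le_rsqrt)
    then have D1: "D \<le> sqrt (2 * C' / a) * \<delta>" using \<delta> by (simp only: real_sqrt_mult real_sqrt_abs abs_of_nonneg)
    have nonneg: "0 \<le> sqrt (2 * C' / a) * \<delta>" "0 \<le> sqrt (4 * C') * \<delta>" using \<delta> C' a by auto
    have "n \<le> C * \<delta>" if "\<mu> > 0"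
    proof -
      have "\<mu> * (n\<^sup>2 / 4) \<le> \<mu> * (C' * \<delta>\<^sup>2)" using main pos by (simp add: mult_ac)
      then have "n\<^sup>2 \<le> 4 * C' * \<delta>\<^sup>2" using that by simp
      then have "n \<le> sqrt (4 * C' * \<delta>\<^sup>2)" by (rule real_le_rsqrt)
      then have "n \<le> sqrt (4 * C') * \<delta>" using \<delta> by (simp only: real_sqrt_mult real_sqrt_abs abs_of_nonneg)
      then show ?thesis using nonneg by (simp add: C_def distrib_right)
    qed
    moreover have "D \<le> C * \<delta>" using D1 nonneg by (simp add: C_def distrib_right)
    ultimately show ?thesis by blast
  qed
  then have "absorbs a P C5 \<kappa> \<delta>1 C" unfolding absorbs_def by blast
  then show ?thesis using \<delta>1 C by blast
qed

lemma norm_four_le: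
  fixes a b c d :: "'a::real_normed_vector"
  assumes "x = - a - b - c + d"
  shows "norm x \<le> norm a + norm b + norm c + norm d"
proof -
  have "norm (- a - b - c + d) \<le> norm (- a - b - c) + norm d" by (rule norm_triangle_ineq)
  also have "norm (- a - b - c) \<le> norm (- a - b) + norm c" by (rule norm_triangle_ineq4)
  also have "norm (- a - b) \<le> norm a + norm b" using norm_triangle_ineq4[of "- a" b] by simp
  finally show ?thesis using assms by simp
qed

section \<open>Powers of small quantities and Q-order convergence\<close>

lemma powr_le_small:
  fixes p c :: real
  assumes "0 < p" "0 < c"
  obtains e1 where "e1 > 0" "\<And>e. 0 \<le> e \<Longrightarrow> e \<le> e1 \<Longrightarrow> e powr p \<le> c"
proof (rule that[of "c powr (1 / p)"])
  show "c powr (1 / p) > 0" using assms by simp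
  fix e assume "0 \<le> e" "e \<le> c powr (1 / p)"
  then have "e powr p \<le> (c powr (1 / p)) powr p" using assms by (intro powr_mono2) auto
  then show "e powr p \<le> c" using assms by (simp add: powr_powr)
qed

text \<open>In \<open>C * e = C * e powr (1 - p) * e powr p\<close> the factor
  \<open>C * e powr (1 - p)\<close> tends to zero. Hence errors of the order of the residual fit
  into tolerances that are a power of the residual with exponent below 1.\<close>

lemma linear_le_powr:
  fixes p C :: real
  assumes "0 < p" "p < 1" "0 < C"
  obtains e1 where "e1 > 0" "\<And>e. 0 \<le> e \<Longrightarrow> e \<le> e1 \<Longrightarrow> C * e \<le> e powr p"
proof -
  obtain e1 where e1: "e1 > 0" "\<And>e. 0 \<le> e \<Longrightarrow> e \<le> e1 \<Longrightarrow> e powr (1 - p) \<le> 1 / C"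
    using powr_le_small[of "1 - p" "1 / C"] assms by auto
  have "C * e \<le> e powr p" if e: "0 \<le> e" "e \<le> e1" for e
  proof -
    have "C * e = C * (e powr (1 - p)) * e powr p"
      using e by (cases "e = 0") (auto simp: powr_add[symmetric])
    also have "\<dots> \<le> C * (1 / C) * e powr p"
      using e1(2)[OF e] assms by (intro mult_right_mono mult_left_mono) auto
    finally show ?thesis using assms by simp
  qed
  with e1(1) show thesis by (rule that)
qed

text \<open>Halving gives convergence to zero. Once \<open>x k\<close> is small,
  \<open>C * x k powr \<sigma>\<close> lies below any prescribed \<open>c\<close>, and the order
  estimate becomes the little-o.\<close>

lemma Q_order_imp_superlinear:
  fixes x :: "nat \<Rightarrow> real"
  assumes \<sigma>: "0 < \<sigma>" and C: "0 < C" and x0: "\<And>k. 0 \<le> x k"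
    and half: "\<And>k. x (Suc k) \<le> x k / 2" and step: "\<And>k. x (Suc k) \<le> C * x k powr (1 + \<sigma>)"
  shows "Q_superlinear_to_zero x" "Q_order (1 + \<sigma>) x"
proof -
  have geo: "x k \<le> x 0 * (1 / 2) ^ k" for k
  proof (induction k)
    case (Suc k) then show ?case using half[of k] by simp
  qed simp
  have "(\<lambda>k. x 0 * (1 / 2) ^ k) \<longlonglongrightarrow> x 0 * 0"
    by (intro tendsto_mult tendsto_const LIMSEQ_power_zero) simp
  then have lim: "x \<longlonglongrightarrow> 0"
    by (intro tendsto_sandwich[of "\<lambda>_. 0" x sequentially "\<lambda>k. x 0 * (1 / 2) ^ k"])
      (auto simp: x0 geo)
  have "(\<lambda>k. x (Suc k)) \<in> o(x)"
  proof (rule landau_o.smallI)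
    fix c :: real assume c: "c > 0"
    obtain e1 where e1: "e1 > 0" "\<And>e. 0 \<le> e \<Longrightarrow> e \<le> e1 \<Longrightarrow> e powr \<sigma> \<le> c / C"
      using powr_le_small[OF \<sigma>, of "c / C"] c C by auto
    have "eventually (\<lambda>k. x k < e1) sequentially" using lim e1(1) by (rule order_tendstoD)
    then show "eventually (\<lambda>k. norm (x (Suc k)) \<le> c * norm (x k)) sequentially"
    proof eventually_elim
      case (elim k)
      have "x (Suc k) \<le> C * x k powr (1 + \<sigma>)" by (rule step)
      also have "\<dots> = C * x k powr \<sigma> * x k" using x0[of k] by (cases "x k = 0") (auto simp: powr_add)
      also have "\<dots> \<le> C * (c / C) * x k"
        using e1(2)[OF x0[of k]] elim C x0 by (intro mult_right_mono mult_left_mono) auto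
      also have "\<dots> = c * x k" using C by simp
      finally show ?case using x0 by simp
    qed
  qed
  with lim show "Q_superlinear_to_zero x" by (simp add: Q_superlinear_to_zero_def)
  show "Q_order (1 + \<sigma>) x"
    unfolding Q_order_def by (rule landau_o.bigI[OF C]) (auto simp: x0 step)
qed

lemma norm_weighted_sum_le:
  fixes f :: "'m::finite \<Rightarrow> 'b::real_normed_vector" and v :: "real^'m"
  assumes "\<And>i. norm (f i) \<le> c" "0 \<le> c"
  shows "norm (\<Sum>i\<in>UNIV. v $ i *\<^sub>R f i) \<le> real CARD('m) * c * norm v"
proof -
  have "norm (\<Sum>i\<in>UNIV. v $ i *\<^sub>R f i) \<le> (\<Sum>i\<in>(UNIV::'m set). norm v * c)"
    using assms by (intro sum_norm_le) (auto intro!: mult_mono simp: component_le_norm_cart)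
  then show ?thesis by (simp add: mult_ac)
qed

lemma matrix_vector_mult_sum_left:
  fixes A :: "'i \<Rightarrow> real^'n^'m"
  shows "(\<Sum>i\<in>I. c i *\<^sub>R A i) *v x = (\<Sum>i\<in>I. c i *\<^sub>R (A i *v x))"
  by (induction I rule: infinite_finite_induct)
    (simp_all add: matrix_vector_mult_add_rdistrib scaleR_matrix_vector_assoc)

section \<open>Twice Lipschitz differentiable functions\<close>

lemma gderiv_unique:
  assumes "GDERIV f x :> D" "GDERIV f x :> E"
  shows "D = E"
proof -
  have "(\<lambda>h. h \<bullet> D) = (\<lambda>h. h \<bullet> E)"
    using assms unfolding gderiv_def by (rule has_derivative_unique)
  then have "(D - E) \<bullet> D = (D - E) \<bullet> E" by meson
  then have "(D - E) \<bullet> (D - E) = 0" by (simp add: inner_diff_right)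
  then show ?thesis by simp
qed

lemma grad_eqI: "GDERIV f x :> D \<Longrightarrow> grad f x = D"
  unfolding grad_def by (rule the_equality) (auto intro: gderiv_unique)

lemma differentiable_gderiv:
  fixes f :: "real^'n \<Rightarrow> real"
  assumes "f differentiable (at x)"
  shows "GDERIV f x :> grad f x"
proof -
  obtain f' where f': "(f has_derivative f') (at x)" using assms by (auto simp: differentiable_def)
  then interpret bounded_linear f' by (rule has_derivative_bounded_linear)
  have "f' h = h \<bullet> (\<Sum>b\<in>Basis. f' b *\<^sub>R b)" for h
  proof -
    have "f' h = f' (\<Sum>b\<in>Basis. (h \<bullet> b) *\<^sub>R b)" by (simp add: euclidean_representation)
    also have "\<dots> = (\<Sum>b\<in>Basis. (h \<bullet> b) * f' b)" by (simp add: sum scaleR)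
    finally show ?thesis by (simp add: inner_sum_right mult.commute)
  qed
  then have "f' = (\<lambda>h. h \<bullet> (\<Sum>b\<in>Basis. f' b *\<^sub>R b))" by (rule ext)
  then have "GDERIV f x :> (\<Sum>b\<in>Basis. f' b *\<^sub>R b)"
    using f' unfolding gderiv_def by simp
  moreover from this have "grad f x = (\<Sum>b\<in>Basis. f' b *\<^sub>R b)" by (rule grad_eqI)
  ultimately show ?thesis by simp
qed

lemma hess_has_derivative:
  fixes f :: "real^'n \<Rightarrow> real"
  assumes "grad f differentiable (at x)"
  shows "(grad f has_derivative (*v) (hess f x)) (at x)"
proof -
  have d: "(grad f has_derivative frechet_derivative (grad f) (at x)) (at x)"
    using assms by (rule frechet_derivative_works[THEN iffD1])
  then have "linear (frechet_derivative (grad f) (at x))"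
    by (rule has_derivative_linear)
  then have "(*v) (hess f x) = frechet_derivative (grad f) (at x)"
    by (auto simp: hess_def matrix_works)
  with d show ?thesis by simp
qed

lemma hess_eqI:
  assumes "(grad f has_derivative (*v) A) (at x)"
  shows "hess f x = A"
proof -
  have "frechet_derivative (grad f) (at x) = (*v) A"
    using frechet_derivative_at[OF assms] by simp
  then show ?thesis by (simp add: hess_def)
qed

text \<open>A single \<open>M\<close> bounds the gradient, the Hessian and the Lipschitz constant of
  the Hessian on a single ball, so that the objective and all constraints can share \<open>r\<close>
  and \<open>M\<close>.\<close>

definition smooth_bounds :: "(real^'n \<Rightarrow> real) \<Rightarrow> real^'n \<Rightarrow> real \<Rightarrow> real \<Rightarrow> bool" where
  "smooth_bounds f x r M \<longleftrightarrow>
    (\<forall>y\<in>ball x r. GDERIV f y :> grad f y \<and> (grad f has_derivative (*v) (hess f y)) (at y) \<and>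
       norm (grad f y) \<le> M \<and> norm (hess f y) \<le> M \<and>
       (\<forall>y'\<in>ball x r. norm (hess f y' - hess f y) \<le> M * norm (y' - y)))"

lemma smooth_bounds_mono:
  assumes "smooth_bounds f x r M" "r' \<le> r" "M \<le> M'"
  shows "smooth_bounds f x r' M'"
proof -
  have sub: "ball x r' \<subseteq> ball x r" using assms(2) by auto
  have "M * norm (y' - y) \<le> M' * norm (y' - y)" for y y' :: "real^'n"
    using assms(3) by (simp add: mult_right_mono)
  then show ?thesis using assms sub unfolding smooth_bounds_def
    by (meson order_trans subset_eq)
qed

text \<open>The gradient is bounded near \<open>x\<close> by its continuity at \<open>x\<close>, the
  Hessian by its Lipschitz property on a radius of at most 1.\<close>

lemma twice_lipschitz_smooth_bounds:
  fixes f :: "real^'n \<Rightarrow> real"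
  assumes "twice_lipschitz_diff_near f x"
  obtains r M where "r > 0" "smooth_bounds f x r M"
proof -
  from assms obtain U C where U: "open U" "x \<in> U"
    and d: "\<And>y. y \<in> U \<Longrightarrow> f differentiable (at y)" "\<And>y. y \<in> U \<Longrightarrow> grad f differentiable (at y)"
    and L: "C-lipschitz_on U (hess f)"
    unfolding twice_lipschitz_diff_near_def by blast
  have cg: "isCont (grad f) x"
    using d(2)[OF U(2)] by (rule differentiable_imp_continuous_within)
  then have "eventually (\<lambda>y. dist (grad f y) (grad f x) < 1) (at x)"
    by (simp add: isCont_def tendsto_iff)
  then have "eventually (\<lambda>y. dist (grad f y) (grad f x) < 1) (nhds x)"
    by (auto simp: eventually_at_filter elim: eventually_mono)
  then obtain s where s: "s > 0" "\<And>y. dist y x < s \<Longrightarrow> dist (grad f y) (grad f x) < 1"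
    by (auto simp: eventually_nhds_metric)
  obtain t where t: "t > 0" "ball x t \<subseteq> U" using U open_contains_ball by blast
  define r where "r = Min {s, t, 1}"
  have r: "r > 0" "r \<le> s" "r \<le> t" "r \<le> 1" using s(1) t(1) by (auto simp: r_def)
  define M where "M = Max {norm (grad f x) + 1, norm (hess f x) + C, C}"
  have C: "C \<ge> 0" using L by (rule lipschitz_on_nonneg)
  have M: "norm (grad f x) + 1 \<le> M" "norm (hess f x) + C \<le> M" "C \<le> M"
    unfolding M_def by (rule Max_ge; simp)+
  have inU: "y \<in> U" if "y \<in> ball x r" for y using that r(3) t(2) by auto
  have "smooth_bounds f x r M" unfolding smooth_bounds_def
  proof (intro ballI conjI)
    fix y assume y: "y \<in> ball x r"
    show "GDERIV f y :> grad f y" using d(1)[OF inU[OF y]] by (rule differentiable_gderiv)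
    show "(grad f has_derivative (*v) (hess f y)) (at y)"
      using d(2)[OF inU[OF y]] by (rule hess_has_derivative)
    have "dist (grad f y) (grad f x) < 1" using y r(2) by (intro s(2)) (simp add: dist_commute)
    then show "norm (grad f y) \<le> M"
      using M(1) norm_triangle_sub[of "grad f y" "grad f x"] by (simp add: dist_norm)
    have "dist (hess f y) (hess f x) \<le> C * dist y x"
      using L inU[OF y] U(2) by (rule lipschitz_onD)
    also have "\<dots> \<le> C" using C y r(4) by (simp add: dist_commute mult_left_le)
    finally show "norm (hess f y) \<le> M"
      using M(2) norm_triangle_sub[of "hess f y" "hess f x"] by (simp add: dist_norm)
    fix y' assume y': "y' \<in> ball x r"
    have "dist (hess f y') (hess f y) \<le> C * dist y' y"
      using L inU[OF y'] inU[OF y] by (rule lipschitz_onD)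
    also have "\<dots> \<le> M * dist y' y" using M(3) by (simp add: mult_right_mono)
    finally show "norm (hess f y' - hess f y) \<le> M * norm (y' - y)" by (simp add: dist_norm)
  qed
  with r(1) show thesis by (rule that)
qed

section \<open>Taylor and Lipschitz estimates on the ball\<close>

context
  fixes f :: "real^'n \<Rightarrow> real" and x :: "real^'n" and r M :: real
  assumes sb: "smooth_bounds f x r M" and M0: "0 \<le> M"
begin

lemma smooth_bounds_grad_taylor:
  assumes "y \<in> ball x r" "y' \<in> ball x r"
  shows "norm (grad f y' - grad f y - hess f y *v (y' - y)) \<le> M * (norm (y' - y))\<^sup>2"
proof -
  have seg: "closed_segment y y' \<subseteq> ball x r"
    using assms by (simp add: closed_segment_subset)
  have "norm (grad f y' - grad f y - hess f y *v (y' - y)) \<le> norm (y' - y) * (M * norm (y' - y))"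
  proof (rule differentiable_bound_linearization[where S = "closed_segment y y'" and ?x0.0 = y and f' = "\<lambda>u. (*v) (hess f u)"])
    show "y + t *\<^sub>R (y' - y) \<in> closed_segment y y'" if "t \<in> {0..1}" for t
      using that by (auto simp: closed_segment_def algebra_simps intro!: exI[of _ t])
    show "(grad f has_derivative (*v) (hess f u)) (at u within closed_segment y y')"
      if "u \<in> closed_segment y y'" for u
      using that seg sb by (auto simp: smooth_bounds_def intro: has_derivative_at_withinI)
    show "onorm ((*v) (hess f u) - (*v) (hess f y)) \<le> M * norm (y' - y)"
      if u: "u \<in> closed_segment y y'" for u
    proof -
      have "(*v) (hess f u) - (*v) (hess f y) = (*v) (hess f u - hess f y)"
        by (auto simp: fun_eq_iff matrix_vector_mult_diff_rdistrib)
      then have "onorm ((*v) (hess f u) - (*v) (hess f y)) \<le> norm (hess f u - hess f y)"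
        using onorm_matrix_le by metis
      also have "\<dots> \<le> M * norm (u - y)"
        using sb u seg assms by (auto simp: smooth_bounds_def)
      also have "\<dots> \<le> M * norm (y' - y)"
        using M0 segment_bound(1)[OF u] by (simp add: mult_left_mono)
      finally show ?thesis .
    qed
  qed simp
  then show ?thesis by (simp add: power2_eq_square mult_ac)
qed

lemma smooth_bounds_grad_lipschitz:
  assumes "y \<in> ball x r" "y' \<in> ball x r"
  shows "norm (grad f y' - grad f y) \<le> M * norm (y' - y)"
proof (rule differentiable_bound[where S = "ball x r"])
  show "(grad f has_derivative (*v) (hess f u)) (at u within ball x r)" if "u \<in> ball x r" for u
    using that sb by (auto simp: smooth_bounds_def intro: has_derivative_at_withinI)
  show "onorm ((*v) (hess f u)) \<le> M" if "u \<in> ball x r" for u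
    using that sb onorm_matrix_le[of "hess f u"] by (force simp: smooth_bounds_def)
qed (use assms in auto)

lemma smooth_bounds_taylor:
  assumes "y \<in> ball x r" "y' \<in> ball x r"
  shows "\<bar>f y' - f y - grad f y \<bullet> (y' - y)\<bar> \<le> M * (norm (y' - y))\<^sup>2"
proof -
  have seg: "closed_segment y y' \<subseteq> ball x r"
    using assms by (simp add: closed_segment_subset)
  have "norm (f y' - f y - (y' - y) \<bullet> grad f y) \<le> norm (y' - y) * (M * norm (y' - y))"
  proof (rule differentiable_bound_linearization[where S = "closed_segment y y'" and ?x0.0 = y and f' = "\<lambda>u h. h \<bullet> grad f u"])
    show "y + t *\<^sub>R (y' - y) \<in> closed_segment y y'" if "t \<in> {0..1}" for t
      using that by (auto simp: closed_segment_def algebra_simps intro!: exI[of _ t])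
    show "(f has_derivative (\<lambda>h. h \<bullet> grad f u)) (at u within closed_segment y y')"
      if "u \<in> closed_segment y y'" for u
      using that seg sb by (auto simp: smooth_bounds_def gderiv_def intro: has_derivative_at_withinI)
    show "onorm ((\<lambda>h. h \<bullet> grad f u) - (\<lambda>h. h \<bullet> grad f y)) \<le> M * norm (y' - y)"
      if u: "u \<in> closed_segment y y'" for u
    proof -
      have "(\<lambda>h. h \<bullet> grad f u) - (\<lambda>h. h \<bullet> grad f y) = (\<lambda>h. h \<bullet> (grad f u - grad f y))"
        by (auto simp: fun_eq_iff inner_diff_right)
      then have "onorm ((\<lambda>h. h \<bullet> grad f u) - (\<lambda>h. h \<bullet> grad f y)) \<le> norm (grad f u - grad f y)"
        using onorm_inner_le by metis
      also have "\<dots> \<le> M * norm (u - y)"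
        using u seg assms by (intro smooth_bounds_grad_lipschitz) auto
      also have "\<dots> \<le> M * norm (y' - y)"
        using M0 segment_bound(1)[OF u] by (simp add: mult_left_mono)
      finally show ?thesis .
    qed
  qed simp
  then show ?thesis by (simp add: power2_eq_square mult_ac inner_commute)
qed

lemma smooth_bounds_lipschitz:
  assumes "y \<in> ball x r" "y' \<in> ball x r"
  shows "\<bar>f y' - f y\<bar> \<le> M * norm (y' - y)"
proof -
  have "norm (f y' - f y) \<le> M * norm (y' - y)"
  proof (rule differentiable_bound[where S = "ball x r"])
    show "(f has_derivative (\<lambda>h. h \<bullet> grad f u)) (at u within ball x r)" if "u \<in> ball x r" for u
      using that sb by (auto simp: smooth_bounds_def gderiv_def intro: has_derivative_at_withinI)
    show "onorm (\<lambda>h. h \<bullet> grad f u) \<le> M" if "u \<in> ball x r" for u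
      using that sb onorm_inner_le[of "grad f u"] by (force simp: smooth_bounds_def)
  qed (use assms in auto)
  then show ?thesis by simp
qed

section \<open>Symmetry of the Hessian\<close>

text \<open>The mean value theorem along \<open>k\<close>, applied to the first difference in
  \<open>h\<close>, turns the second difference into a difference of two gradients. Both are
  expanded at \<open>y\<close>, and the Hessian terms in direction \<open>k\<close> cancel.\<close>

lemma second_difference_bound:
  assumes y: "y \<in> ball x r" and "norm h + norm k < r - dist x y"
  shows "\<bar>f (y + h + k) - f (y + k) - f (y + h) + f y - (hess f y *v h) \<bullet> k\<bar>
    \<le> 2 * M * (norm h + norm k) ^ 3"
proof -
  have inb: "y + a *\<^sub>R h + t *\<^sub>R k \<in> ball x r" if "0 \<le> t" "t \<le> 1" "0 \<le> a" "a \<le> 1" for t a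
  proof -
    have "norm (a *\<^sub>R h + t *\<^sub>R k) \<le> a * norm h + t * norm k"
      using norm_triangle_ineq[of "a *\<^sub>R h" "t *\<^sub>R k"] that by simp
    also have "\<dots> \<le> norm h + norm k"
      using that by (intro add_mono mult_left_le_one_le) auto
    finally have "norm (a *\<^sub>R h + t *\<^sub>R k) < r - dist x y" using assms(2) by simp
    moreover have "dist x (y + a *\<^sub>R h + t *\<^sub>R k) \<le> dist x y + norm (a *\<^sub>R h + t *\<^sub>R k)"
      using norm_triangle_ineq4[of "x - y" "a *\<^sub>R h + t *\<^sub>R k"] by (simp add: dist_norm algebra_simps)
    ultimately show ?thesis by simp
  qed
  have inb1: "y + h + t *\<^sub>R k \<in> ball x r" "y + t *\<^sub>R k \<in> ball x r" if "0 \<le> t" "t \<le> 1" for t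
    using inb[of t 1] inb[of t 0] that by auto
  define u where "u t = f (y + h + t *\<^sub>R k) - f (y + t *\<^sub>R k)" for t :: real
  have du: "(u has_real_derivative (grad f (y + h + t *\<^sub>R k) - grad f (y + t *\<^sub>R k)) \<bullet> k) (at t)"
    if t: "0 \<le> t" "t \<le> 1" for t
  proof -
    have 1: "((\<lambda>t. f (b + t *\<^sub>R k)) has_derivative (\<lambda>s. (s *\<^sub>R k) \<bullet> grad f (b + t *\<^sub>R k))) (at t)"
      if "b + t *\<^sub>R k \<in> ball x r" for b
    proof (rule has_derivative_compose[where g = f])
      show "((\<lambda>t. b + t *\<^sub>R k) has_derivative (\<lambda>s. s *\<^sub>R k)) (at t)"
        by (auto intro!: derivative_eq_intros)
      show "(f has_derivative (\<lambda>h. h \<bullet> grad f (b + t *\<^sub>R k))) (at (b + t *\<^sub>R k))"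
        using that sb by (auto simp: smooth_bounds_def gderiv_def)
    qed
    have "(u has_derivative (\<lambda>s. (s *\<^sub>R k) \<bullet> grad f (y + h + t *\<^sub>R k) - (s *\<^sub>R k) \<bullet> grad f (y + t *\<^sub>R k))) (at t)"
      unfolding u_def using inb1[OF t] by (intro has_derivative_diff 1)
    then show ?thesis
      by (rule has_derivative_imp_has_field_derivative)
        (simp add: inner_diff_left inner_commute algebra_simps)
  qed
  obtain s where s: "0 < s" "s < 1"
    "u 1 - u 0 = (1 - 0) * ((grad f (y + h + s *\<^sub>R k) - grad f (y + s *\<^sub>R k)) \<bullet> k)"
    using MVT2[of 0 1 u "\<lambda>t. (grad f (y + h + t *\<^sub>R k) - grad f (y + t *\<^sub>R k)) \<bullet> k"] du by auto
  define e1 where "e1 = grad f (y + h + s *\<^sub>R k) - grad f y - hess f y *v (h + s *\<^sub>R k)"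
  define e2 where "e2 = grad f (y + s *\<^sub>R k) - grad f y - hess f y *v (s *\<^sub>R k)"
  define a where "a = norm h + norm k"
  have a: "a \<ge> 0" "norm k \<le> a" by (auto simp: a_def)
  have sk: "norm (s *\<^sub>R k) \<le> norm k" using s by (simp add: mult_left_le_one_le)
  have "norm e1 \<le> M * (norm (h + s *\<^sub>R k))\<^sup>2"
    using smooth_bounds_grad_taylor[OF y inb1(1)[of s]] s by (simp add: e1_def add.assoc)
  also have "\<dots> \<le> M * a\<^sup>2"
    using M0 sk norm_triangle_ineq[of h "s *\<^sub>R k"] by (intro mult_left_mono power_mono) (auto simp: a_def)
  finally have e1: "norm e1 \<le> M * a\<^sup>2" .
  have "norm e2 \<le> M * (norm (s *\<^sub>R k))\<^sup>2"
    using smooth_bounds_grad_taylor[OF y inb1(2)[of s]] s by (simp add: e2_def)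
  also have "\<dots> \<le> M * a\<^sup>2"
    using M0 sk a(2) by (intro mult_left_mono power_mono) auto
  finally have e2: "norm e2 \<le> M * a\<^sup>2" .
  have "f (y + h + k) - f (y + k) - f (y + h) + f y - (hess f y *v h) \<bullet> k = u 1 - u 0 - (hess f y *v h) \<bullet> k"
    by (simp add: u_def)
  also have "\<dots> = (e1 - e2) \<bullet> k"
    using s by (simp add: e1_def e2_def inner_diff_left matrix_vector_right_distrib inner_add_left)
  finally have "\<bar>f (y + h + k) - f (y + k) - f (y + h) + f y - (hess f y *v h) \<bullet> k\<bar> \<le> norm (e1 - e2) * norm k"
    by (simp add: Cauchy_Schwarz_ineq2)
  also have "\<dots> \<le> (2 * M * a\<^sup>2) * a"
    using e1 e2 a norm_triangle_ineq4[of e1 e2] M0 by (intro mult_mono) auto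
  finally show ?thesis by (simp add: a_def power3_eq_cube power2_eq_square mult.assoc)
qed

text \<open>The second difference is symmetric in \<open>h\<close> and \<open>k\<close>, and so must
  be its leading term: scaling both vectors by \<open>t\<close> leaves an error cubic in
  \<open>t\<close> against leading terms of order \<open>t\<^sup>2\<close>. Symmetry is not built
  into \<open>hess\<close>, which is read off a Frechet derivative of the gradient.\<close>

lemma hess_symmetric:
  assumes y: "y \<in> ball x r"
  shows "(hess f y *v h) \<bullet> k = (hess f y *v k) \<bullet> h"
proof -
  define D where "D = \<bar>(hess f y *v h) \<bullet> k - (hess f y *v k) \<bullet> h\<bar>"
  define a where "a = norm h + norm k"
  have a: "a \<ge> 0" by (simp add: a_def)
  define s where "s = (r - dist x y) / (1 + a)"
  have s: "s > 0" using y a by (simp add: s_def)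
  have sa: "s * a < r - dist x y"
  proof -
    have "s * (1 + a) = r - dist x y" using a by (simp add: s_def)
    then show ?thesis using s by (simp add: algebra_simps)
  qed
  have "D \<le> t * (4 * M * a ^ 3)" if t: "0 < t" "t \<le> s" for t
  proof -
    have n: "norm (t *\<^sub>R h) + norm (t *\<^sub>R k) = t * a" using t by (simp add: a_def distrib_left)
    have "t * a \<le> s * a" using t a by (simp add: mult_right_mono)
    then have ta: "t * a < r - dist x y" using sa by simp
    have 1: "\<bar>f (y + t *\<^sub>R h + t *\<^sub>R k) - f (y + t *\<^sub>R k) - f (y + t *\<^sub>R h) + f y - t\<^sup>2 * ((hess f y *v h) \<bullet> k)\<bar> \<le> 2 * M * (t * a) ^ 3"
      using second_difference_bound[OF y, of "t *\<^sub>R h" "t *\<^sub>R k"] n ta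
      by (simp add: matrix_vector_mult_scaleR power2_eq_square mult.assoc)
    have 2: "\<bar>f (y + t *\<^sub>R h + t *\<^sub>R k) - f (y + t *\<^sub>R h) - f (y + t *\<^sub>R k) + f y - t\<^sup>2 * ((hess f y *v k) \<bullet> h)\<bar> \<le> 2 * M * (t * a) ^ 3"
      using second_difference_bound[OF y, of "t *\<^sub>R k" "t *\<^sub>R h"] n ta
      by (simp add: matrix_vector_mult_scaleR power2_eq_square mult.assoc add.commute add.left_commute)
    have "\<bar>t\<^sup>2 * ((hess f y *v h) \<bullet> k) - t\<^sup>2 * ((hess f y *v k) \<bullet> h)\<bar> \<le> 4 * M * (t * a) ^ 3"
      using 1 2 by linarith
    then have "t\<^sup>2 * D \<le> t\<^sup>2 * (t * (4 * M * a ^ 3))"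
      unfolding D_def by (simp add: abs_mult power_mult_distrib power3_eq_cube power2_eq_square
          mult_ac flip: right_diff_distrib)
    then show ?thesis using t by simp
  qed
  then have ev: "\<forall>\<^sub>F t in at_right 0. D \<le> t * (4 * M * a ^ 3)"
    using s by (intro eventually_at_rightI[of 0 s]) auto
  have "((\<lambda>t. t * (4 * M * a ^ 3)) \<longlongrightarrow> 0) (at_right 0)"
    by (auto intro!: tendsto_eq_intros)
  then have "D \<le> 0" using ev by (rule tendsto_lowerbound) simp
  then show ?thesis by (simp add: D_def)
qed

end

section \<open>The Lagrangian near the reference point\<close>

text \<open>The matrix with columns the constraint gradients, applied to \<open>v\<close>; kept as a
  sum, the form in which the gradients enter \<open>lp_feasible\<close>.\<close>

definition lin_comb :: "(real^'n \<Rightarrow> real^'m) \<Rightarrow> real^'n \<Rightarrow> real^'m \<Rightarrow> real^'n" where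
  "lin_comb g z v = (\<Sum>i\<in>UNIV. v $ i *\<^sub>R grad_comp g i z)"

lemma lin_comb_add: "lin_comb g z (v + w) = lin_comb g z v + lin_comb g z w"
  by (simp add: lin_comb_def scaleR_add_left sum.distrib)

lemma lin_comb_diff: "lin_comb g z (v - w) = lin_comb g z v - lin_comb g z w"
  by (simp add: lin_comb_def scaleR_diff_left sum_subtractf)

lemma lin_comb_scaleR: "lin_comb g z (c *\<^sub>R v) = c *\<^sub>R lin_comb g z v"
  by (simp add: lin_comb_def scaleR_sum_right)

lemma lin_comb_inner: "lin_comb g z v \<bullet> x = (\<Sum>i\<in>UNIV. v $ i * (grad_comp g i z \<bullet> x))"
  by (simp add: lin_comb_def inner_sum_left)

lemma lin_comb_on:
  assumes "\<And>i. i \<notin> I \<Longrightarrow> v $ i = 0"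
  shows "(\<Sum>i\<in>I. v $ i *\<^sub>R grad_comp g i z) = lin_comb g z v"
  unfolding lin_comb_def using assms by (intro sum.mono_neutral_left) auto

locale smooth_problem =
  fixes \<phi> :: "real^'n \<Rightarrow> real" and g :: "real^'n \<Rightarrow> real^'m" and zs :: "real^'n" and r M :: real
  assumes r_pos: "0 < r" and r_le: "r \<le> 1" and M_ge: "1 \<le> M"
    and smooth_obj: "smooth_bounds \<phi> zs r M"
    and smooth_con: "\<And>i. smooth_bounds (\<lambda>z. g z $ i) zs r M"
begin

abbreviation "H z l \<equiv> hess (lagrangian \<phi> g l) z"
abbreviation "G \<equiv> lin_comb g"

text \<open>The factor \<open>1 + CARD('m)\<close> covers the objective together with a weighted sum
  over all constraints, so that one constant serves gradients, Hessians and Taylor remainders of the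
  Lagrangian.\<close>

definition "K = M * (1 + real CARD('m))"

lemma K_ge: "M \<le> K" "1 \<le> K" "real CARD('m) * M \<le> K" "0 \<le> M" "0 \<le> K"
  using M_ge by (auto simp: K_def algebra_simps add_increasing add_increasing2)

lemma lagrangian_gderiv:
  assumes "z \<in> ball zs r"
  shows "GDERIV (lagrangian \<phi> g l) z :> grad \<phi> z + G z l"
proof -
  have 1: "GDERIV \<phi> z :> grad \<phi> z" using smooth_obj assms by (auto simp: smooth_bounds_def)
  have 2: "GDERIV (\<lambda>z. g z $ i) z :> grad_comp g i z" for i
    using smooth_con assms by (auto simp: smooth_bounds_def grad_comp_def)
  have "((\<lambda>z. \<phi> z + (\<Sum>i\<in>UNIV. l $ i * g z $ i)) has_derivative
     (\<lambda>h. h \<bullet> grad \<phi> z + (\<Sum>i\<in>UNIV. l $ i * (h \<bullet> grad_comp g i z)))) (at z)"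
    using 1 2 unfolding gderiv_def by (intro derivative_intros)
  moreover have "lagrangian \<phi> g l = (\<lambda>z. \<phi> z + (\<Sum>i\<in>UNIV. l $ i * g z $ i))"
    by (simp add: lagrangian_def fun_eq_iff inner_vec_def)
  ultimately show ?thesis unfolding gderiv_def
    by (simp add: lin_comb_def inner_add_right inner_sum_right)
qed

lemma grad_lagrangian: "z \<in> ball zs r \<Longrightarrow> grad (lagrangian \<phi> g l) z = grad \<phi> z + G z l"
  by (rule grad_eqI) (rule lagrangian_gderiv)

lemma H_eq:
  assumes "z \<in> ball zs r"
  shows "H z l = hess \<phi> z + (\<Sum>i\<in>UNIV. l $ i *\<^sub>R hess (\<lambda>z. g z $ i) z)"
proof (rule hess_eqI)
  have 1: "(grad \<phi> has_derivative (*v) (hess \<phi> z)) (at z)"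
    using smooth_obj assms by (auto simp: smooth_bounds_def)
  have 2: "(grad (\<lambda>z. g z $ i) has_derivative (*v) (hess (\<lambda>z. g z $ i) z)) (at z)" for i
    using smooth_con assms by (auto simp: smooth_bounds_def)
  have "((\<lambda>z. grad \<phi> z + G z l) has_derivative
     (\<lambda>h. hess \<phi> z *v h + (\<Sum>i\<in>UNIV. l $ i *\<^sub>R (hess (\<lambda>z. g z $ i) z *v h)))) (at z)"
    unfolding lin_comb_def grad_comp_def using 1 2 by (intro derivative_intros)
  moreover have "(\<lambda>h. hess \<phi> z *v h + (\<Sum>i\<in>UNIV. l $ i *\<^sub>R (hess (\<lambda>z. g z $ i) z *v h))) =
     (*v) (hess \<phi> z + (\<Sum>i\<in>UNIV. l $ i *\<^sub>R hess (\<lambda>z. g z $ i) z))"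
    by (simp add: fun_eq_iff matrix_vector_mult_add_rdistrib matrix_vector_mult_sum_left)
  ultimately have "((\<lambda>z. grad \<phi> z + G z l) has_derivative
     (*v) (hess \<phi> z + (\<Sum>i\<in>UNIV. l $ i *\<^sub>R hess (\<lambda>z. g z $ i) z))) (at z)"
    by simp
  then show "(grad (lagrangian \<phi> g l) has_derivative
     (*v) (hess \<phi> z + (\<Sum>i\<in>UNIV. l $ i *\<^sub>R hess (\<lambda>z. g z $ i) z))) (at z)"
    by (rule has_derivative_transform_within_open[OF _ open_ball assms]) (simp add: grad_lagrangian)
qed

text \<open>Symmetry identifies the gradient of \<open>1/2 * (d \<bullet> (H z l *v d))\<close> with
  \<open>H z l *v d\<close>, as \<open>obj_gderiv\<close> needs; otherwise only the symmetric part
  of the matrix would appear.\<close>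

lemma H_symmetric: "z \<in> ball zs r \<Longrightarrow> (H z l *v x) \<bullet> y = (H z l *v y) \<bullet> x"
  using hess_symmetric[OF smooth_obj K_ge(4)] hess_symmetric[OF smooth_con K_ge(4)]
  by (simp add: H_eq matrix_vector_mult_add_rdistrib matrix_vector_mult_sum_left inner_add_left inner_sum_left)

lemma norm_grad_comp_le: "z \<in> ball zs r \<Longrightarrow> norm (grad_comp g i z) \<le> K"
  using smooth_con[of i] K_ge(1) by (force simp: smooth_bounds_def grad_comp_def)

lemma norm_grad_comp_diff_le:
  assumes "z \<in> ball zs r" "z' \<in> ball zs r"
  shows "norm (grad_comp g i z' - grad_comp g i z) \<le> K * norm (z' - z)"
proof -
  have "norm (grad_comp g i z' - grad_comp g i z) \<le> M * norm (z' - z)"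
    unfolding grad_comp_def by (rule smooth_bounds_grad_lipschitz[OF smooth_con K_ge(4) assms])
  also have "\<dots> \<le> K * norm (z' - z)" by (simp add: K_ge mult_right_mono)
  finally show ?thesis .
qed

lemma norm_grad_obj_diff_le:
  assumes "z \<in> ball zs r" "z' \<in> ball zs r"
  shows "norm (grad \<phi> z' - grad \<phi> z) \<le> K * norm (z' - z)"
proof -
  have "norm (grad \<phi> z' - grad \<phi> z) \<le> M * norm (z' - z)"
    by (rule smooth_bounds_grad_lipschitz[OF smooth_obj K_ge(4) assms])
  also have "\<dots> \<le> K * norm (z' - z)" by (simp add: K_ge mult_right_mono)
  finally show ?thesis .
qed

lemma constraint_lipschitz:
  assumes "z \<in> ball zs r" "z' \<in> ball zs r"
  shows "\<bar>g z' $ i - g z $ i\<bar> \<le> K * norm (z' - z)"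
proof -
  have "\<bar>g z' $ i - g z $ i\<bar> \<le> M * norm (z' - z)"
    by (rule smooth_bounds_lipschitz[OF smooth_con K_ge(4) assms])
  also have "\<dots> \<le> K * norm (z' - z)" by (simp add: K_ge mult_right_mono)
  finally show ?thesis .
qed

lemma constraint_taylor:
  assumes "z \<in> ball zs r" "z' \<in> ball zs r"
  shows "\<bar>g z' $ i - g z $ i - grad_comp g i z \<bullet> (z' - z)\<bar> \<le> K * (norm (z' - z))\<^sup>2"
proof -
  have "\<bar>g z' $ i - g z $ i - grad_comp g i z \<bullet> (z' - z)\<bar> \<le> M * (norm (z' - z))\<^sup>2"
    unfolding grad_comp_def by (rule smooth_bounds_taylor[OF smooth_con K_ge(4) assms])
  also have "\<dots> \<le> K * (norm (z' - z))\<^sup>2" by (simp add: K_ge mult_right_mono)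
  finally show ?thesis .
qed

lemma norm_lin_comb_le:
  assumes "z \<in> ball zs r"
  shows "norm (G z v) \<le> K * norm v"
proof -
  have "norm (G z v) \<le> real CARD('m) * M * norm v"
    unfolding lin_comb_def using smooth_con K_ge(4) assms
    by (intro norm_weighted_sum_le) (auto simp: smooth_bounds_def grad_comp_def)
  also have "\<dots> \<le> K * norm v" by (simp add: K_ge mult_right_mono)
  finally show ?thesis .
qed

lemma norm_lin_comb_diff_le:
  assumes "z \<in> ball zs r" "z' \<in> ball zs r"
  shows "norm (G z' v - G z v) \<le> K * norm (z' - z) * norm v"
proof -
  have "G z' v - G z v = (\<Sum>i\<in>UNIV. v $ i *\<^sub>R (grad_comp g i z' - grad_comp g i z))"
    by (simp add: lin_comb_def scaleR_diff_right sum_subtractf)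
  also have "norm \<dots> \<le> real CARD('m) * (M * norm (z' - z)) * norm v"
    unfolding grad_comp_def using smooth_bounds_grad_lipschitz[OF smooth_con K_ge(4) assms] K_ge(4)
    by (intro norm_weighted_sum_le) auto
  also have "\<dots> = (real CARD('m) * M) * (norm (z' - z) * norm v)" by simp
  also have "\<dots> \<le> K * (norm (z' - z) * norm v)" by (intro mult_right_mono K_ge) auto
  finally show ?thesis by (simp add: mult_ac)
qed

lemma add_weighted_le: "M * a + real CARD('m) * (M * a) * b \<le> K * (1 + b) * a" if "0 \<le> a" "0 \<le> b"
proof -
  have "M * (1 + real CARD('m) * b) \<le> K * (1 + b)"
    using that(2) K_ge(4) by (simp add: K_def algebra_simps)
  from mult_right_mono[OF this that(1)] show ?thesis by (simp add: algebra_simps)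
qed

lemma norm_H_le:
  assumes "z \<in> ball zs r"
  shows "norm (H z l) \<le> K * (1 + norm l)"
proof -
  have "norm (H z l) \<le> norm (hess \<phi> z) + norm (\<Sum>i\<in>UNIV. l $ i *\<^sub>R hess (\<lambda>z. g z $ i) z)"
    unfolding H_eq[OF assms] by (rule norm_triangle_ineq)
  also have "\<dots> \<le> M * 1 + real CARD('m) * (M * 1) * norm l"
    using smooth_obj smooth_con assms K_ge(4)
    by (intro add_mono norm_weighted_sum_le) (auto simp: smooth_bounds_def)
  also have "\<dots> \<le> K * (1 + norm l) * 1" by (rule add_weighted_le) auto
  finally show ?thesis by simp
qed

text \<open>The change is split into a move from \<open>z\<close> to \<open>z'\<close> with the
  weights \<open>l\<close> kept and a change of weights at \<open>z'\<close>. Thus only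
  \<open>norm l\<close> enters the bound, not \<open>norm l'\<close>.\<close>

lemma norm_H_diff_le:
  assumes "z \<in> ball zs r" "z' \<in> ball zs r"
  shows "norm (H z' l' - H z l) \<le> K * ((1 + norm l) * norm (z' - z) + norm (l' - l))"
proof -
  have "H z' l' - H z l = ((hess \<phi> z' - hess \<phi> z) +
      (\<Sum>i\<in>UNIV. l $ i *\<^sub>R (hess (\<lambda>z. g z $ i) z' - hess (\<lambda>z. g z $ i) z)))
      + (\<Sum>i\<in>UNIV. (l' - l) $ i *\<^sub>R hess (\<lambda>z. g z $ i) z')"
    unfolding H_eq[OF assms(1)] H_eq[OF assms(2)]
    by (simp add: scaleR_diff_right scaleR_diff_left sum_subtractf algebra_simps)
  also have "norm \<dots> \<le> (M * norm (z' - z) + real CARD('m) * (M * norm (z' - z)) * norm l)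
      + real CARD('m) * M * norm (l' - l)"
    using smooth_obj smooth_con assms K_ge(4)
    by (intro norm_triangle_mono add_mono norm_weighted_sum_le) (auto simp: smooth_bounds_def)
  also have "\<dots> \<le> K * (1 + norm l) * norm (z' - z) + K * norm (l' - l)"
    by (intro add_mono add_weighted_le mult_right_mono K_ge) auto
  finally show ?thesis by (simp add: algebra_simps)
qed

lemma norm_H_mult_diff_le:
  assumes "z \<in> ball zs r" "z' \<in> ball zs r"
  shows "norm (H z' l' *v x - H z l *v x) \<le> K * ((1 + norm l) * norm (z' - z) + norm (l' - l)) * norm x"
proof -
  have "norm (H z' l' *v x - H z l *v x) \<le> norm (H z' l' - H z l) * norm x"
    by (simp add: norm_matrix_vector_mult_le flip: matrix_vector_mult_diff_rdistrib)
  also have "\<dots> \<le> K * ((1 + norm l) * norm (z' - z) + norm (l' - l)) * norm x"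
    by (intro mult_right_mono norm_H_diff_le assms) auto
  finally show ?thesis .
qed

lemma grad_lagrangian_taylor:
  assumes "z \<in> ball zs r" "z' \<in> ball zs r"
  shows "norm (grad \<phi> z' + G z' l - (grad \<phi> z + G z l) - H z l *v (z' - z))
    \<le> K * (1 + norm l) * (norm (z' - z))\<^sup>2"
proof -
  let ?gi = "\<lambda>i z. g z $ i"
  have "grad \<phi> z' + G z' l - (grad \<phi> z + G z l) - H z l *v (z' - z)
    = (grad \<phi> z' - grad \<phi> z - hess \<phi> z *v (z' - z)) +
      (\<Sum>i\<in>UNIV. l $ i *\<^sub>R (grad (?gi i) z' - grad (?gi i) z - hess (?gi i) z *v (z' - z)))"
    by (simp add: H_eq[OF assms(1)] lin_comb_def grad_comp_def scaleR_diff_right sum_subtractf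
        matrix_vector_mult_add_rdistrib matrix_vector_mult_sum_left)
  also have "norm \<dots> \<le> M * (norm (z' - z))\<^sup>2 + real CARD('m) * (M * (norm (z' - z))\<^sup>2) * norm l"
    using smooth_bounds_grad_taylor[OF smooth_con K_ge(4) assms] K_ge(4)
    by (intro norm_triangle_mono norm_weighted_sum_le smooth_bounds_grad_taylor[OF smooth_obj K_ge(4) assms]) auto
  also have "\<dots> \<le> K * (1 + norm l) * (norm (z' - z))\<^sup>2" by (rule add_weighted_le) auto
  finally show ?thesis .
qed

lemma grad_lagrangian_lipschitz:
  assumes "z \<in> ball zs r" "z' \<in> ball zs r"
  shows "norm (grad \<phi> z' + G z' l - (grad \<phi> z + G z l)) \<le> K * (1 + norm l) * norm (z' - z)"
proof -
  have "grad \<phi> z' + G z' l - (grad \<phi> z + G z l) = (grad \<phi> z' - grad \<phi> z) + (G z' l - G z l)"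
    by simp
  also have "norm \<dots> \<le> K * norm (z' - z) + K * norm (z' - z) * norm l"
    by (intro norm_triangle_mono norm_grad_obj_diff_le norm_lin_comb_diff_le assms)
  finally show ?thesis by (simp add: algebra_simps)
qed

end

lemma twice_lipschitz_smooth_problem:
  fixes \<phi> :: "real^'n \<Rightarrow> real" and g :: "real^'n \<Rightarrow> real^'m"
  assumes "twice_lipschitz_diff_near \<phi> zs" "\<And>i. twice_lipschitz_diff_near (\<lambda>z. g z $ i) zs"
  obtains r M where "smooth_problem \<phi> g zs r M"
proof -
  obtain r0 M0 where 0: "r0 > 0" "smooth_bounds \<phi> zs r0 M0"
    using twice_lipschitz_smooth_bounds[OF assms(1)] by blast
  have "\<exists>r M. r > 0 \<and> smooth_bounds (\<lambda>z. g z $ i) zs r M" for i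
    using twice_lipschitz_smooth_bounds[OF assms(2)[of i]] by metis
  then obtain ri Mi where i: "\<And>i. ri i > 0" "\<And>i. smooth_bounds (\<lambda>z. g z $ i) zs (ri i) (Mi i)"
    by metis
  define r where "r = Min (insert 1 (insert r0 (range ri)))"
  define M where "M = Max (insert 1 (insert M0 (range Mi)))"
  have r: "0 < r" "r \<le> 1" "r \<le> r0" "\<And>i. r \<le> ri i"
    using 0 i by (auto simp: r_def min_le_iff_disj)
  have M: "1 \<le> M" "M0 \<le> M" "\<And>i. Mi i \<le> M" by (auto simp: M_def le_max_iff_disj)
  have "smooth_problem \<phi> g zs r M"
  proof
    show "smooth_bounds \<phi> zs r M" using 0(2) r(3) M(2) by (rule smooth_bounds_mono)
    show "smooth_bounds (\<lambda>z. g z $ i) zs r M" for i using i(2) r(4) M(3) by (rule smooth_bounds_mono)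
  qed (use r M in auto)
  then show thesis by (rule that)
qed

section \<open>The multiplier set and the error bound\<close>

locale kkt_problem = smooth_problem \<phi> g zs r M
  for \<phi> :: "real^'n \<Rightarrow> real" and g :: "real^'n \<Rightarrow> real^'m" and zs r M +
  assumes assm_A: "assumption_A \<phi> g zs"
begin

abbreviation "S \<equiv> multiplier_set \<phi> g zs"
abbreviation "Act \<equiv> active g zs"
abbreviation "Pos \<equiv> active_pos \<phi> g zs"
abbreviation "Zer \<equiv> active_zero \<phi> g zs"
abbreviation "A i \<equiv> grad_comp g i zs"

lemma zs_in_ball: "zs \<in> ball zs r"
  using r_pos by simp

lemma in_ball_zs: "norm (z - zs) < r \<Longrightarrow> z \<in> ball zs r"
  by (simp add: dist_norm norm_minus_commute)

lemma S_nonempty: "S \<noteq> {}"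
  using assm_A by (simp add: assumption_A_def)

lemma g_zs_le: "g zs $ i \<le> 0"
  using S_nonempty by (auto simp: multiplier_set_def less_eq_vec_def)

text \<open>Every summand of \<open>l \<bullet> g zs\<close> is nonpositive, so complementarity
  holds componentwise. This exhibits \<open>S\<close> as a polyhedron given by linear equations and
  signs, the form in which Hoffman's bound applies.\<close>

lemma S_iff: "l \<in> S \<longleftrightarrow> 0 \<le> l \<and> (\<forall>i. i \<notin> Act \<longrightarrow> l $ i = 0) \<and> grad \<phi> zs + G zs l = 0"
proof -
  have "l \<bullet> g zs = 0 \<longleftrightarrow> (\<forall>i. i \<notin> Act \<longrightarrow> l $ i = 0)" if l: "0 \<le> l"
  proof -
    have "0 \<le> - (l $ i * g zs $ i)" for i
      using l g_zs_le by (simp add: less_eq_vec_def mult_nonneg_nonpos)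
    then have "(\<Sum>i\<in>UNIV. - (l $ i * g zs $ i)) = 0 \<longleftrightarrow> (\<forall>i\<in>UNIV. - (l $ i * g zs $ i) = 0)"
      by (intro sum_nonneg_eq_0_iff) auto
    then show ?thesis by (auto simp: inner_vec_def active_def sum_negf)
  qed
  moreover have "g zs \<le> 0" using g_zs_le by (simp add: less_eq_vec_def)
  ultimately show ?thesis by (auto simp: multiplier_set_def grad_lagrangian[OF zs_in_ball])
qed

lemma S_nonneg: "l \<in> S \<Longrightarrow> 0 \<le> l $ i"
  by (simp add: S_iff less_eq_vec_def)

lemma S_zero: "l \<in> S \<Longrightarrow> i \<notin> Act \<Longrightarrow> l $ i = 0"
  by (simp add: S_iff)

lemma S_stationary: "l \<in> S \<Longrightarrow> grad \<phi> zs + G zs l = 0"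
  by (simp add: S_iff)

lemma S_zero_off_Pos: "l \<in> S \<Longrightarrow> i \<notin> Pos \<Longrightarrow> l $ i = 0"
  using S_nonneg[of l i] S_zero[of l i] by (force simp: active_pos_def)

lemma Pos_subset: "Pos \<subseteq> Act"
  by (auto simp: active_pos_def)

lemma Act_eq: "Act = Pos \<union> Zer" "Pos \<inter> Zer = {}"
  by (auto simp: active_pos_def active_zero_def)

section \<open>The multiplier set: boundedness, strict positivity on \<open>Pos\<close>, Hoffman's
  bound\<close>

lemma inactive_gap: "\<exists>c>0. \<forall>i. i \<notin> Act \<longrightarrow> g zs $ i \<le> - c"
proof -
  \<comment> \<open>\<open>insert 1\<close> keeps the minimum over a nonempty set when every
    constraint is active.\<close>
  define c where "c = Min (insert 1 ((\<lambda>i. - (g zs $ i)) ` (- Act)))"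
  have "- (g zs $ i) > 0" if "i \<notin> Act" for i
    using that g_zs_le[of i] by (auto simp: active_def order.strict_iff_order)
  then have "c > 0" by (auto simp: c_def)
  moreover have "c \<le> - (g zs $ i)" if "i \<notin> Act" for i
    using that unfolding c_def by (intro Min_le) auto
  ultimately show ?thesis by force
qed

text \<open>\<open>G z l\<close> is tested with the MFCQ direction \<open>y\<close>: near
  \<open>zs\<close> every active gradient still has inner product at most \<open>- c / 2\<close>
  with \<open>y\<close>, so the residual controls the sum of the nonnegative components. The
  statement covers all \<open>z\<close> near \<open>zs\<close>, because it also has to bound
  multipliers from the subproblem and the linear programs, where gradients are taken at the
  iterate.\<close>

lemma multiplier_bound:
  "\<exists>Q>0. \<exists>s>0. s \<le> r \<and> (\<forall>z l. norm (z - zs) < s \<longrightarrow> 0 \<le> l \<longrightarrow> (\<forall>i. i \<notin> Act \<longrightarrow> l $ i = 0) \<longrightarrow>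
     norm l \<le> Q * (1 + norm (grad \<phi> z + G z l)))"
proof -
  obtain y where y: "\<And>i. i \<in> Act \<Longrightarrow> A i \<bullet> y < 0"
    using assm_A by (auto simp: assumption_A_def MFCQ_def)
  define c where "c = Min (insert 1 ((\<lambda>i. - (A i \<bullet> y)) ` Act))"
  have c: "c > 0" using y by (auto simp: c_def)
  have cA: "A i \<bullet> y \<le> - c" if "i \<in> Act" for i
  proof -
    have "c \<le> - (A i \<bullet> y)" using that unfolding c_def by (intro Min_le) auto
    then show ?thesis by simp
  qed
  \<comment> \<open>The second bound keeps the change \<open>K * s * norm y\<close> of the inner
    products with \<open>y\<close> below \<open>c / 2\<close>.\<close>
  define s where "s = min r (c / (2 * K * (1 + norm y)))"
  have y1: "1 + norm y > 0" by (smt (verit) norm_ge_zero)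
  have s: "s > 0" "s \<le> r" using c K_ge r_pos y1 by (auto simp: s_def)
  have "s \<le> c / (2 * K * (1 + norm y))" by (simp add: s_def)
  then have "s * (2 * K * (1 + norm y)) \<le> c"
    using y1 K_ge(2) by (subst (asm) pos_le_divide_eq) auto
  moreover have "0 \<le> K * s" using K_ge(2) s(1) by simp
  ultimately have sK: "K * s * norm y \<le> c / 2"
    by (simp add: algebra_simps)
  define Q where "Q = 2 / c * (norm y + 1) * (norm (grad \<phi> zs) + K + 1)"
  have "0 < norm y + 1" "0 < norm (grad \<phi> zs) + K + 1" using K_ge(5) by (auto simp: add_nonneg_pos)
  then have "Q > 0" unfolding Q_def using c by (intro mult_pos_pos divide_pos_pos) auto
  have "norm l \<le> Q * (1 + norm (grad \<phi> z + G z l))"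
    if z: "norm (z - zs) < s" and l: "0 \<le> l" "\<forall>i. i \<notin> Act \<longrightarrow> l $ i = 0" for z l
  proof -
    have zb: "z \<in> ball zs r" using z s by (intro in_ball_zs) simp
    have gi: "grad_comp g i z \<bullet> y \<le> - c / 2" if "i \<in> Act" for i
    proof -
      have "(grad_comp g i z - A i) \<bullet> y \<le> norm (grad_comp g i z - A i) * norm y"
        by (rule norm_cauchy_schwarz)
      also have "\<dots> \<le> K * norm (z - zs) * norm y"
        by (intro mult_right_mono norm_grad_comp_diff_le zs_in_ball zb norm_ge_zero)
      also have "\<dots> \<le> K * s * norm y"
        using z K_ge by (intro mult_right_mono mult_left_mono) auto
      finally show ?thesis using cA[OF that] sK by (simp add: inner_diff_left)
    qed
    have "G z l \<bullet> y \<le> (\<Sum>i\<in>UNIV. l $ i * (- c / 2))"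
      unfolding lin_comb_inner
    proof (rule sum_mono)
      fix i show "l $ i * (grad_comp g i z \<bullet> y) \<le> l $ i * (- c / 2)"
        using gi[of i] l mult_left_mono[of "grad_comp g i z \<bullet> y" "- c / 2" "l $ i"]
        by (cases "i \<in> Act") (simp_all add: less_eq_vec_def)
    qed
    also have "\<dots> = - (c / 2) * (\<Sum>i\<in>UNIV. l $ i)"
      by (simp add: sum_distrib_left sum_distrib_right mult.commute sum_negf)
    finally have 1: "c / 2 * (\<Sum>i\<in>UNIV. l $ i) \<le> - (G z l \<bullet> y)" by simp
    have "norm l \<le> (\<Sum>i\<in>UNIV. \<bar>l $ i\<bar>)" by (rule norm_le_l1_cart)
    also have "\<dots> = (\<Sum>i\<in>UNIV. l $ i)" using l by (simp add: less_eq_vec_def)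
    finally have "c / 2 * norm l \<le> c / 2 * (\<Sum>i\<in>UNIV. l $ i)" using c by (intro mult_left_mono) auto
    also note 1
    also have "- (G z l \<bullet> y) = (grad \<phi> z - (grad \<phi> z + G z l)) \<bullet> y" by simp
    also have "\<dots> \<le> norm (grad \<phi> z - (grad \<phi> z + G z l)) * norm y" by (rule norm_cauchy_schwarz)
    also have "\<dots> \<le> (norm (grad \<phi> z) + norm (grad \<phi> z + G z l)) * norm y"
      by (intro mult_right_mono norm_triangle_ineq4) auto
    also have "\<dots> \<le> ((norm (grad \<phi> zs) + K + 1) * (1 + norm (grad \<phi> z + G z l))) * (norm y + 1)"
    proof (intro mult_mono)
      have "norm (grad \<phi> z - grad \<phi> zs) \<le> K * norm (z - zs)"
        by (rule norm_grad_obj_diff_le[OF zs_in_ball zb])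
      also have "\<dots> \<le> K * 1" using z s r_le K_ge by (intro mult_left_mono) auto
      finally have "norm (grad \<phi> z) \<le> norm (grad \<phi> zs) + K"
        using norm_triangle_sub[of "grad \<phi> z" "grad \<phi> zs"] by simp
      moreover have "0 \<le> (norm (grad \<phi> zs) + K) * norm (grad \<phi> z + G z l)" using K_ge by simp
      ultimately show "norm (grad \<phi> z) + norm (grad \<phi> z + G z l)
          \<le> (norm (grad \<phi> zs) + K + 1) * (1 + norm (grad \<phi> z + G z l))"
        by (simp add: distrib_left distrib_right)
    qed (use K_ge in auto)
    finally have "c / 2 * norm l \<le> ((norm (grad \<phi> zs) + K + 1) * (1 + norm (grad \<phi> z + G z l))) * (norm y + 1)" .
    note bnd = this
    have "norm l = 2 / c * (c / 2 * norm l)" using c by simp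
    also have "\<dots> \<le> 2 / c * (((norm (grad \<phi> zs) + K + 1) * (1 + norm (grad \<phi> z + G z l))) * (norm y + 1))"
      using c bnd by (intro mult_left_mono) auto
    also have "\<dots> = Q * (1 + norm (grad \<phi> z + G z l))"
      by (simp only: Q_def mult.assoc mult.commute mult.left_commute)
    finally show ?thesis .
  qed
  then show ?thesis using \<open>Q > 0\<close> s by blast
qed

lemma S_bounded: "\<exists>R. 1 \<le> R \<and> (\<forall>l\<in>S. norm l \<le> R)"
proof -
  obtain Q s where Q: "Q > 0" "s > 0" "\<And>z l. norm (z - zs) < s \<Longrightarrow> 0 \<le> l \<Longrightarrow>
      (\<forall>i. i \<notin> Act \<longrightarrow> l $ i = 0) \<Longrightarrow> norm l \<le> Q * (1 + norm (grad \<phi> z + G z l))"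
    using multiplier_bound by metis
  have "norm l \<le> max 1 Q" if "l \<in> S" for l
    using Q(3)[of zs l] that Q(2) by (auto simp: S_iff)
  then show ?thesis by (intro exI[of _ "max 1 Q"]) auto
qed

text \<open>Chosen once so that the same bound on the multipliers is available throughout the
  locale; \<open>1 \<le> R\<close> makes it a positive divisor.\<close>

definition "R = (SOME R. 1 \<le> R \<and> (\<forall>l\<in>S. norm l \<le> R))"

lemma R: "R \<ge> 1" "l \<in> S \<Longrightarrow> norm l \<le> R"
  using someI_ex[OF S_bounded] by (auto simp: R_def)

lemma continuous_on_lin_comb: "continuous_on X (\<lambda>x. G z (f x))" if "continuous_on X f"
  unfolding lin_comb_def by (intro continuous_intros that)

lemma closed_nonneg: "closed {y::real^'k. 0 \<le> y}"
  by (simp add: less_eq_vec_def closed_Collect_all closed_Collect_le continuous_on_component)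

lemma S_closed: "closed S"
proof -
  have "S = {l. 0 \<le> l} \<inter> {l. \<forall>i. i \<notin> Act \<longrightarrow> l $ i = 0} \<inter> {l. grad \<phi> zs + G zs l = 0}"
    by (auto simp: S_iff)
  moreover have "closed {l. grad \<phi> zs + G zs l = 0}"
    by (intro closed_Collect_eq continuous_intros continuous_on_lin_comb)
  moreover have "closed {l::real^'m. \<forall>i. i \<notin> Act \<longrightarrow> l $ i = 0}"
    by (intro closed_Collect_all closed_Collect_imp open_Collect_const closed_Collect_eq continuous_intros)
  ultimately show ?thesis using closed_nonneg[where 'k='m] by (simp add: closed_Int)
qed

lemma S_compact: "compact S"
  using R(2) S_closed by (auto simp: compact_eq_bounded_closed bounded_iff)

lemma S_midpoint:
  assumes "l \<in> S" "l' \<in> S"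
  shows "(1/2) *\<^sub>R (l + l') \<in> S"
proof -
  have "grad \<phi> zs + G zs ((1/2) *\<^sub>R (l + l')) =
      (1/2) *\<^sub>R ((grad \<phi> zs + G zs l) + (grad \<phi> zs + G zs l'))"
    unfolding lin_comb_scaleR lin_comb_add by (simp add: vec_eq_iff field_simps)
  also have "\<dots> = 0" unfolding S_stationary[OF assms(1)] S_stationary[OF assms(2)] by simp
  finally show ?thesis using assms by (simp add: S_iff less_eq_vec_def)
qed

text \<open>Averaging a multiplier that is positive on \<open>J\<close> with one that is positive at
  \<open>j\<close> stays in \<open>S\<close> and is positive on both, since all components are
  nonnegative. Finiteness of \<open>Pos\<close> then gives the uniform bound \<zeta>.\<close>

lemma strictly_positive_multiplier: "\<exists>lb\<in>S. \<exists>\<zeta>>0. \<forall>i\<in>Pos. \<zeta> \<le> lb $ i"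
proof -
  have "\<exists>lb\<in>S. \<forall>i\<in>J. lb $ i > 0" if "finite J" "J \<subseteq> Pos" for J
    using that
  proof (induction J rule: finite_induct)
    case empty then show ?case using S_nonempty by auto
  next
    case (insert j J)
    then obtain l where l: "l \<in> S" "\<forall>i\<in>J. l $ i > 0" by auto
    obtain l' where l': "l' \<in> S" "l' $ j > 0" using insert.prems by (auto simp: active_pos_def)
    show ?case
    proof (intro bexI[of _ "(1/2) *\<^sub>R (l + l')"] ballI)
      show "(1/2) *\<^sub>R (l + l') \<in> S" using l l' S_midpoint by blast
      fix i assume "i \<in> insert j J"
      then show "((1/2) *\<^sub>R (l + l')) $ i > 0"
        using l l' S_nonneg[OF l(1), of i] S_nonneg[OF l'(1), of i]
        by (auto intro: add_pos_nonneg add_nonneg_pos)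
    qed
  qed
  then obtain lb where lb: "lb \<in> S" "\<forall>i\<in>Pos. lb $ i > 0" by (meson finite order_refl)
  define z where "z = Min (insert 1 ((\<lambda>i. lb $ i) ` Pos))"
  have "z > 0" using lb by (auto simp: z_def)
  moreover have "\<forall>i\<in>Pos. z \<le> lb $ i" by (auto simp: z_def intro: Min_le)
  ultimately show ?thesis using lb by blast
qed

lemma S_hoffman:
  "\<exists>C>0. \<forall>l. 0 \<le> l \<longrightarrow> (\<forall>i. i \<notin> Act \<longrightarrow> l $ i = 0) \<longrightarrow>
     (\<exists>ls\<in>S. norm (l - ls) \<le> C * norm (grad \<phi> zs + G zs l))"
proof -
  \<comment> \<open>The second component records the entries off \<open>Act\<close>, so that
    \<open>L l = b\<close> encodes stationarity and the prescribed zeros at once. For the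
    \<open>l\<close> considered it vanishes, and only the stationarity residual is left in the
    bound.\<close>
  define L where "L l = (G zs l, \<chi> i. if i \<in> Act then 0 else l $ i)" for l :: "real^'m"
  define b where "b = (- grad \<phi> zs, 0 :: real^'m)"
  have "linear L"
    by (rule linearI) (auto simp: L_def lin_comb_add lin_comb_scaleR vec_eq_iff)
  then have "bounded_linear L" by (simp add: linear_conv_bounded_linear)
  have Lb: "L l = b \<longleftrightarrow> (\<forall>i. i \<notin> Act \<longrightarrow> l $ i = 0) \<and> grad \<phi> zs + G zs l = 0" for l
    by (auto simp: L_def b_def vec_eq_iff add_eq_0_iff split: if_splits)
  have "\<exists>l\<ge>0. L l = b" using S_nonempty Lb S_iff by blast
  then obtain C where C: "C > 0" "\<And>l. 0 \<le> l \<Longrightarrow> \<exists>y\<ge>0. L y = b \<and> norm (l - y) \<le> C * norm (L l - b)"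
    using hoffman_nonneg[OF \<open>bounded_linear L\<close>] by metis
  have "\<exists>ls\<in>S. norm (l - ls) \<le> C * norm (grad \<phi> zs + G zs l)"
    if l: "0 \<le> l" "\<forall>i. i \<notin> Act \<longrightarrow> l $ i = 0" for l
  proof -
    have "L l - b = (grad \<phi> zs + G zs l, 0)" using l by (auto simp: L_def b_def vec_eq_iff)
    then have "norm (L l - b) = norm (grad \<phi> zs + G zs l)" by (simp add: norm_Pair)
    then show ?thesis using C(2)[OF l(1)] Lb S_iff by metis
  qed
  with C(1) show ?thesis by blast
qed

abbreviation "dS z l \<equiv> dist_sol \<phi> g zs z l"

lemma dist_sol_attained: "\<exists>ls\<in>S. norm (z - zs) \<le> dS z l \<and> norm (l - ls) \<le> dS z l"
proof -
  have "closed ({zs} \<times> S)" using S_closed by (simp add: closed_Times)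
  then obtain p where p: "p \<in> {zs} \<times> S" "dS z l = dist (z, l) p"
    using S_nonempty infdist_attains_inf[of "{zs} \<times> S" "(z, l)"] unfolding dist_sol_def by blast
  then obtain ls where ls: "ls \<in> S" "dS z l = norm (z - zs, l - ls)"
    by (auto simp: dist_norm)
  moreover have "norm (z - zs) \<le> norm (z - zs, l - ls)" "norm (l - ls) \<le> norm (z - zs, l - ls)"
    by (auto simp: norm_Pair real_le_rsqrt)
  ultimately show ?thesis by auto
qed

lemma near_solution:
  assumes "dS z l < r"
  obtains ls where "ls \<in> S" "norm (z - zs) \<le> dS z l" "norm (l - ls) \<le> dS z l"
    "z \<in> ball zs r" "norm l \<le> R + 1"
proof -
  obtain ls where ls: "ls \<in> S" "norm (z - zs) \<le> dS z l" "norm (l - ls) \<le> dS z l"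
    using dist_sol_attained by blast
  moreover have "z \<in> ball zs r" using ls assms by (intro in_ball_zs) simp
  moreover have "norm l \<le> R + 1" using norm_triangle_sub[of l ls] ls R(2)[OF ls(1)] assms r_le by simp
  ultimately show thesis by (rule that)
qed

lemma norm_H_near_le:
  assumes "z \<in> ball zs r" "norm l \<le> R + 1"
  shows "norm (H z l) \<le> K * (2 + R)"
proof -
  have "norm (H z l) \<le> K * (1 + norm l)" by (rule norm_H_le[OF assms(1)])
  also have "\<dots> \<le> K * (2 + R)" using assms(2) K_ge by (intro mult_left_mono) auto
  finally show ?thesis .
qed

lemma dist_sol_le: "ls \<in> S \<Longrightarrow> dS z l \<le> norm (z - zs) + norm (l - ls)"
proof -
  assume "ls \<in> S"
  then have "dS z l \<le> dist (z, l) (zs, ls)" unfolding dist_sol_def by (intro infdist_le) auto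
  also have "\<dots> = norm (z - zs, l - ls)" by (simp add: dist_norm)
  also have "\<dots> \<le> norm (z - zs) + norm (l - ls)" by (simp add: norm_Pair sqrt_sum_squares_le_sum)
  finally show ?thesis .
qed

lemma dist_sol_nonneg: "0 \<le> dS z l"
  unfolding dist_sol_def by (rule infdist_nonneg)

section \<open>The critical cone: coercivity and the energy estimate\<close>

text \<open>The squared violation of the conditions defining the critical cone. It vanishes exactly
  on the cone and is homogeneous of degree 2, like the quadratic form it is compared with.\<close>

definition "viol x = (\<Sum>i\<in>Pos. (A i \<bullet> x)\<^sup>2) + (\<Sum>i\<in>Zer. (max 0 (A i \<bullet> x))\<^sup>2)"

lemma viol_nonneg: "0 \<le> viol x"
  by (simp add: viol_def sum_nonneg)

lemma viol_scaleR: "0 \<le> t \<Longrightarrow> viol (t *\<^sub>R x) = t\<^sup>2 * viol x"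
proof -
  assume t: "0 \<le> t"
  have "max 0 (t * c) = t * max 0 c" for c
    using t by (simp add: max_def mult_nonneg_nonneg zero_le_mult_iff)
  then show ?thesis
    by (simp add: viol_def power_mult_distrib sum_distrib_left distrib_left)
qed

text \<open>By homogeneity unit vectors suffice. On the compact set \<open>P\<close>, where the form
  is at most \<open>\<alpha> / 2\<close>, the second-order condition excludes
  \<open>viol = 0\<close>; hence \<open>viol\<close> is bounded below there, and a large multiple of
  it outweighs the crude bound \<open>- h\<close>. Compactness of \<open>S\<close> makes the
  constants uniform in the multiplier.\<close>

lemma coercivity:
  "\<exists>a>0. \<exists>C>0. \<forall>l\<in>S. \<forall>x. x \<bullet> (H zs l *v x) \<ge> a * (norm x)\<^sup>2 - C * viol x"
proof -
  obtain \<alpha> where \<alpha>: "\<alpha> > 0" and soc: "\<And>l w. l \<in> S \<Longrightarrow> (\<forall>i\<in>Pos. A i \<bullet> w = 0) \<Longrightarrow> (\<forall>i\<in>Zer. A i \<bullet> w \<le> 0)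
      \<Longrightarrow> w \<bullet> (H zs l *v w) \<ge> \<alpha> * (norm w)\<^sup>2"
    using assm_A unfolding assumption_A_def second_order_condition_def by blast
  define q where "q p = fst p \<bullet> (H zs (snd p) *v fst p)" for p :: "(real^'n) \<times> (real^'m)"
  have qc: "continuous_on X q" for X
    unfolding q_def H_eq[OF zs_in_ball] matrix_vector_mult_add_rdistrib matrix_vector_mult_sum_left
    by (intro continuous_intros bounded_linear.continuous_on[OF matrix_vector_mul_bounded_linear])
  have vc: "continuous_on X (\<lambda>p. viol (fst p))" for X :: "((real^'n) \<times> (real^'m)) set"
    unfolding viol_def by (intro continuous_intros)
  define P where "P = (sphere 0 1 \<times> S) \<inter> {p. q p \<le> \<alpha> / 2}"
  have "compact P" unfolding P_def
    using S_compact by (intro compact_Int_closed compact_Times closed_Collect_le qc continuous_intros) auto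
  have pos: "viol (fst p) > 0" if "p \<in> P" for p
  proof (rule ccontr)
    assume "\<not> viol (fst p) > 0"
    then have "viol (fst p) = 0" using viol_nonneg[of "fst p"] by simp
    then have "(\<Sum>i\<in>Pos. (A i \<bullet> fst p)\<^sup>2) = 0" "(\<Sum>i\<in>Zer. (max 0 (A i \<bullet> fst p))\<^sup>2) = 0"
      unfolding viol_def by (simp_all add: add_nonneg_eq_0_iff sum_nonneg)
    then have "\<forall>i\<in>Pos. A i \<bullet> fst p = 0" "\<forall>i\<in>Zer. A i \<bullet> fst p \<le> 0"
      by (auto simp: sum_nonneg_eq_0_iff)
    from soc[OF _ this, of "snd p"] that \<alpha> show False
      by (auto simp: P_def q_def)
  qed
  obtain v0 where v0: "v0 > 0" "\<And>p. p \<in> P \<Longrightarrow> v0 \<le> viol (fst p)"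
  proof (cases "P = {}")
    case True then show ?thesis using that[of 1] by auto
  next
    case False
    then obtain p where "p \<in> P" "\<And>p'. p' \<in> P \<Longrightarrow> viol (fst p) \<le> viol (fst p')"
      using continuous_attains_inf[OF \<open>compact P\<close> False vc] by blast
    then show ?thesis using that[of "viol (fst p)"] pos by auto
  qed
  define h where "h = K * (1 + R)"
  have h: "h \<ge> 0" using K_ge R by (simp add: h_def)
  have qh: "- h \<le> q (x, l)" if "norm x = 1" "l \<in> S" for x l
  proof -
    have "\<bar>q (x, l)\<bar> \<le> norm x * norm (H zs l *v x)" by (simp add: q_def Cauchy_Schwarz_ineq2)
    also have "\<dots> \<le> norm (H zs l)" using norm_matrix_vector_mult_le[of "H zs l" x] that by simp
    also have "\<dots> \<le> K * (1 + norm l)" by (rule norm_H_le[OF zs_in_ball])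
    also have "\<dots> \<le> h" unfolding h_def using R(2)[OF that(2)] K_ge by (intro mult_left_mono) auto
    finally show ?thesis by simp
  qed
  define C where "C = (\<alpha> / 2 + h) / v0"
  have C: "C > 0" "C * v0 = \<alpha> / 2 + h" using \<alpha> h v0 by (auto simp: C_def add_pos_nonneg)
  have unit: "q (x, l) \<ge> \<alpha> / 2 - C * viol x" if x: "norm x = 1" and l: "l \<in> S" for x l
  proof (cases "q (x, l) \<le> \<alpha> / 2")
    case True
    then have "(x, l) \<in> P" using x l by (simp add: P_def)
    then have "v0 \<le> viol x" using v0(2) by fastforce
    then have "C * v0 \<le> C * viol x" using C by (intro mult_left_mono) auto
    then show ?thesis using qh[OF x l] C by simp
  next
    case False
    moreover have "0 \<le> C * viol x" using C(1) viol_nonneg[of x] by simp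
    ultimately show ?thesis by simp
  qed
  have "x \<bullet> (H zs l *v x) \<ge> \<alpha> / 2 * (norm x)\<^sup>2 - C * viol x" if l: "l \<in> S" for x l
  proof (cases "x = 0")
    case True then show ?thesis using C(1) viol_nonneg[of x] by simp
  next
    case False
    define y where "y = (1 / norm x) *\<^sub>R x"
    have y: "norm y = 1" "x = norm x *\<^sub>R y" using False by (auto simp: y_def)
    have "(norm x)\<^sup>2 * q (y, l) \<ge> (norm x)\<^sup>2 * (\<alpha> / 2 - C * viol y)"
      using unit[OF y(1) l] by (intro mult_left_mono) auto
    moreover have "x \<bullet> (H zs l *v x) = (norm x)\<^sup>2 * q (y, l)"
      by (subst y(2), subst (2) y(2)) (simp add: q_def matrix_vector_mult_scaleR power2_eq_square)
    moreover have "viol x = (norm x)\<^sup>2 * viol y"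
      by (subst y(2)) (rule viol_scaleR, simp)
    ultimately show ?thesis by (simp add: algebra_simps)
  qed
  then show ?thesis using \<alpha> C(1) by (intro exI[of _ "\<alpha>/2"] conjI exI[of _ C]) auto
qed

text \<open>The residuals of the Lagrangian equation and of the linearised constraints bound the
  primal error in full, but the multiplier error only with weight \<open>\<mu>\<close>. A strictly
  positive \<open>lb \<in> S\<close> satisfies \<open>G zs (lb - ls) = 0\<close>, and this identity, tested with \<open>D\<close>, controls \<open>rr\<close> on
  \<open>Pos\<close> by \<open>- ls \<bullet> rr\<close>.\<close>

definition perturbation_constants :: "real \<Rightarrow> real \<Rightarrow> real \<Rightarrow> bool" where
  "perturbation_constants a \<theta> C \<longleftrightarrow> (\<forall>l0 ls lp D \<mu> rr E. l0 \<in> S \<longrightarrow> ls \<in> S \<longrightarrow>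
     0 \<le> lp \<longrightarrow> (\<forall>i. i \<notin> Act \<longrightarrow> lp $ i = 0) \<longrightarrow> 0 \<le> \<mu> \<longrightarrow> \<mu> \<le> \<theta> \<longrightarrow>
     (\<forall>i\<in>Act. A i \<bullet> D = \<mu> * (lp - ls) $ i + rr $ i - E $ i) \<longrightarrow>
     (\<forall>i\<in>Act. - \<theta> \<le> rr $ i \<and> rr $ i \<le> 0 \<and> lp $ i * rr $ i = 0) \<longrightarrow>
     a * (norm D)\<^sup>2 + \<mu> / 2 * (norm (lp - ls))\<^sup>2 \<le>
       norm (H zs l0 *v D + G zs (lp - ls)) * norm D + norm (lp - ls) * norm E + C * (norm E)\<^sup>2)"

text \<open>The violation \<open>viol D\<close> costs
  \<open>C0 * c1 * (\<mu>\<^sup>2 * n\<^sup>2)\<close> and \<open>C0 * c2 * p\<^sup>2\<close>. Both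
  have one factor more that is small with \<theta>, since \<open>\<mu> \<le> \<theta>\<close> and
  \<open>p \<le> m * R * \<theta>\<close>, and \<theta> is chosen so that they fit into half of the
  terms \<open>\<mu> * n\<^sup>2\<close> and \<open>p\<close> of the energy.\<close>

lemma perturbation_bound: "\<exists>a>0. \<exists>\<theta>>0. \<exists>C>0. perturbation_constants a \<theta> C"
proof -
  obtain a C0 where a: "a > 0" and C0: "C0 > 0"
    and coer: "\<And>l x. l \<in> S \<Longrightarrow> x \<bullet> (H zs l *v x) \<ge> a * (norm x)\<^sup>2 - C0 * viol x"
    using coercivity by blast
  obtain lb \<zeta> where lb: "lb \<in> S" and \<zeta>: "\<zeta> > 0" "\<And>i. i \<in> Pos \<Longrightarrow> \<zeta> \<le> lb $ i"
    using strictly_positive_multiplier by blast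
  \<comment> \<open>The numbers come from two uses of \<open>square_sum3_le\<close>: on the three
    parts of \<open>A i \<bullet> D\<close>, and on the three parts of the bound for
    \<open>\<zeta> * s\<close>.\<close>
  define c1 where "c1 = 3 + 36 * R\<^sup>2 / \<zeta>\<^sup>2"
  define c2 where "c2 = 9 / \<zeta>\<^sup>2"
  have c1: "c1 > 0" using \<zeta> by (simp add: c1_def add_pos_nonneg)
  have c2: "c2 > 0" using \<zeta> by (simp add: c2_def)
  define m where "m = real CARD('m)"
  have m: "m > 0" by (simp add: m_def)
  define \<theta> where "\<theta> = min (1 / (2 * C0 * c1)) (1 / (2 * C0 * c2 * m * R))"
  have \<theta>: "\<theta> > 0" using C0 c1 c2 m R by (auto simp: \<theta>_def)
  have \<theta>1: "C0 * c1 * \<theta> \<le> 1 / 2"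
  proof -
    have "C0 * c1 * \<theta> \<le> C0 * c1 * (1 / (2 * C0 * c1))"
      using C0 c1 by (intro mult_left_mono) (auto simp: \<theta>_def)
    also have "\<dots> = 1 / 2" using C0 c1 by simp
    finally show ?thesis .
  qed
  have \<theta>2: "C0 * c2 * (m * R * \<theta>) \<le> 1 / 2"
  proof -
    have "C0 * c2 * m * R * \<theta> \<le> C0 * c2 * m * R * (1 / (2 * C0 * c2 * m * R))"
      using C0 c2 m R by (intro mult_left_mono) (auto simp: \<theta>_def)
    also have "\<dots> = 1 / 2" using C0 c2 m R by simp
    finally show ?thesis by (simp add: mult_ac)
  qed
  have "a * (norm D)\<^sup>2 + \<mu> / 2 * (norm (lp - ls))\<^sup>2 \<le>
       norm (H zs l0 *v D + G zs (lp - ls)) * norm D + norm (lp - ls) * norm E + C0 * c1 * (norm E)\<^sup>2"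
    if l0: "l0 \<in> S" and ls: "ls \<in> S" and lp: "0 \<le> lp" "\<And>i. i \<notin> Act \<Longrightarrow> lp $ i = 0"
      and \<mu>: "0 \<le> \<mu>" "\<mu> \<le> \<theta>"
      and AD: "\<And>i. i \<in> Act \<Longrightarrow> A i \<bullet> D = \<mu> * (lp - ls) $ i + rr $ i - E $ i"
      and rr: "\<And>i. i \<in> Act \<Longrightarrow> - \<theta> \<le> rr $ i" "\<And>i. i \<in> Act \<Longrightarrow> rr $ i \<le> 0"
        "\<And>i. i \<in> Act \<Longrightarrow> lp $ i * rr $ i = 0"
    for l0 ls lp D \<mu> rr E
  proof -
    define \<nu> where "\<nu> = lp - ls"
    define n where "n = norm \<nu>"
    define e where "e = norm E"
    have ne: "n \<ge> 0" "e \<ge> 0" by (auto simp: n_def e_def)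
    define p where "p = - (ls \<bullet> rr)"
    have p_terms: "0 \<le> - (ls $ i * rr $ i)" "- (ls $ i * rr $ i) \<le> R * \<theta>" for i
    proof -
      show "0 \<le> - (ls $ i * rr $ i)"
        using S_nonneg[OF ls, of i] S_zero[OF ls, of i] rr(2)[of i]
        by (cases "i \<in> Act") (auto simp: mult_nonneg_nonpos)
      have "ls $ i \<le> R" using component_le_norm_cart[of ls i] R(2)[OF ls] by simp
      then have "i \<in> Act \<Longrightarrow> ls $ i * - rr $ i \<le> R * \<theta>"
        using rr(1,2)[of i] S_nonneg[OF ls, of i] \<theta> R by (intro mult_mono) auto
      then show "- (ls $ i * rr $ i) \<le> R * \<theta>"
        using S_zero[OF ls, of i] \<theta> R by (cases "i \<in> Act") auto
    qed
    have psum: "p = (\<Sum>i\<in>UNIV. - (ls $ i * rr $ i))" by (simp add: p_def inner_vec_def sum_negf)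
    have p0: "0 \<le> p" unfolding psum by (intro sum_nonneg p_terms)
    have pR: "p \<le> m * R * \<theta>"
    proof -
      have "p \<le> (\<Sum>i\<in>(UNIV::'m set). R * \<theta>)" unfolding psum by (intro sum_mono p_terms)
      then show ?thesis by (simp add: m_def)
    qed
    \<comment> \<open>Equation \<open>AD\<close> is available on \<open>Act\<close> only, hence the
      zeros required of \<open>v\<close>. It is used twice: with \<nu> for the energy and with
      \<open>lb - ls\<close> for the slacks on \<open>Pos\<close>.\<close>
    have vAD: "G zs v \<bullet> D = v \<bullet> (\<mu> *\<^sub>R \<nu> + rr - E)" if "\<And>i. i \<notin> Act \<Longrightarrow> v $ i = 0" for v
    proof -
      have "v $ i * (A i \<bullet> D) = v $ i * (\<mu> * \<nu> $ i + rr $ i - E $ i)" for i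
        using that[of i] AD[of i] by (cases "i \<in> Act") (auto simp: \<nu>_def)
      then have "G zs v \<bullet> D = (\<Sum>i\<in>UNIV. v $ i * (\<mu> * \<nu> $ i + rr $ i - E $ i))"
        unfolding lin_comb_inner by (simp only:)
      then show ?thesis by (simp add: inner_vec_def)
    qed
    have lprr: "lp \<bullet> rr = 0"
      unfolding inner_vec_def using lp(2) rr(3) by (intro sum.neutral) (metis UNIV_I inner_real_def mult_eq_0_iff)
    have "G zs \<nu> \<bullet> D = \<mu> * n\<^sup>2 + p - \<nu> \<bullet> E"
      using lprr S_zero[OF ls] lp(2)
      by (subst vAD) (auto simp: \<nu>_def n_def p_def inner_add_right inner_diff_right power2_norm_eq_inner inner_diff_left)
    moreover have "(H zs l0 *v D + G zs \<nu>) \<bullet> D = D \<bullet> (H zs l0 *v D) + G zs \<nu> \<bullet> D"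
      by (simp add: inner_add_left inner_add_right inner_commute)
    ultimately have "D \<bullet> (H zs l0 *v D) + \<mu> * n\<^sup>2 + p = (H zs l0 *v D + G zs \<nu>) \<bullet> D + \<nu> \<bullet> E" by simp
    also have "\<dots> \<le> norm (H zs l0 *v D + G zs \<nu>) * norm D + n * e"
      unfolding n_def e_def by (intro add_mono norm_cauchy_schwarz)
    finally have energy: "D \<bullet> (H zs l0 *v D) + \<mu> * n\<^sup>2 + p \<le> norm (H zs l0 *v D + G zs \<nu>) * norm D + n * e" .
    define s where "s = (\<Sum>i\<in>Pos. - rr $ i)"
    have rrP: "0 \<le> - rr $ i" if "i \<in> Pos" for i using rr(2)[of i] Pos_subset that by auto
    have s0: "0 \<le> s" unfolding s_def by (intro sum_nonneg rrP)
    have sq: "(\<Sum>i\<in>Pos. (rr $ i)\<^sup>2) \<le> s\<^sup>2"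
    proof -
      have "(\<Sum>i\<in>Pos. (rr $ i)\<^sup>2) \<le> (\<Sum>i\<in>Pos. s * (- rr $ i))"
      proof (rule sum_mono)
        fix i assume i: "i \<in> Pos"
        have "- rr $ i \<le> s" unfolding s_def using rrP i by (intro member_le_sum) auto
        then have "(- rr $ i) * (- rr $ i) \<le> s * (- rr $ i)" using rrP[OF i] by (rule mult_right_mono)
        then show "(rr $ i)\<^sup>2 \<le> s * (- rr $ i)" by (simp add: power2_eq_square)
      qed
      also have "\<dots> = s\<^sup>2" unfolding s_def by (simp only: sum_distrib_left[symmetric] power2_eq_square)
      finally show ?thesis .
    qed
    define w where "w = \<mu>\<^sup>2 * n\<^sup>2 + e\<^sup>2"
    have viol: "viol D \<le> 3 * w + 3 * s\<^sup>2"
    proof -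
      have "(A i \<bullet> D)\<^sup>2 \<le> 3 * (\<mu>\<^sup>2 * (\<nu> $ i)\<^sup>2 + (E $ i)\<^sup>2) + 3 * (rr $ i)\<^sup>2" if "i \<in> Pos" for i
      proof -
        have "A i \<bullet> D = \<mu> * \<nu> $ i + rr $ i + - E $ i"
          using AD[of i] Pos_subset that by (auto simp: \<nu>_def)
        then have "(A i \<bullet> D)\<^sup>2 \<le> 3 * ((\<mu> * \<nu> $ i)\<^sup>2 + (rr $ i)\<^sup>2 + (- E $ i)\<^sup>2)"
          using square_sum3_le by metis
        then show ?thesis by (simp add: power_mult_distrib)
      qed
      then have 1: "(\<Sum>i\<in>Pos. (A i \<bullet> D)\<^sup>2) \<le> (\<Sum>i\<in>Pos. 3 * (\<mu>\<^sup>2 * (\<nu> $ i)\<^sup>2 + (E $ i)\<^sup>2)) + 3 * (\<Sum>i\<in>Pos. (rr $ i)\<^sup>2)"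
        unfolding sum_distrib_left sum.distrib[symmetric] by (intro sum_mono) (simp add: sum_distrib_left)
      \<comment> \<open>On \<open>Zer\<close> only the positive part counts, and the slack
        \<open>rr $ i \<le> 0\<close> can only lower \<open>A i \<bullet> D\<close>; it drops
        out.\<close>
      have "(max 0 (A i \<bullet> D))\<^sup>2 \<le> 3 * (\<mu>\<^sup>2 * (\<nu> $ i)\<^sup>2 + (E $ i)\<^sup>2)" if "i \<in> Zer" for i
      proof -
        have iA: "i \<in> Act" using that by (simp add: active_zero_def)
        have "(max 0 (A i \<bullet> D))\<^sup>2 \<le> (\<mu> * \<nu> $ i - E $ i)\<^sup>2"
          using AD[OF iA] rr(2)[OF iA] by (cases "A i \<bullet> D \<le> 0") (auto simp: \<nu>_def max_def intro!: power_mono)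
        then show ?thesis using square_sum3_le[of "\<mu> * \<nu> $ i" 0 "- E $ i"] by (simp add: power_mult_distrib)
      qed
      then have 2: "(\<Sum>i\<in>Zer. (max 0 (A i \<bullet> D))\<^sup>2) \<le> (\<Sum>i\<in>Zer. 3 * (\<mu>\<^sup>2 * (\<nu> $ i)\<^sup>2 + (E $ i)\<^sup>2))"
        by (rule sum_mono)
      have "(\<Sum>i\<in>Pos. 3 * (\<mu>\<^sup>2 * (\<nu> $ i)\<^sup>2 + (E $ i)\<^sup>2)) + (\<Sum>i\<in>Zer. 3 * (\<mu>\<^sup>2 * (\<nu> $ i)\<^sup>2 + (E $ i)\<^sup>2))
          = (\<Sum>i\<in>Act. 3 * (\<mu>\<^sup>2 * (\<nu> $ i)\<^sup>2 + (E $ i)\<^sup>2))"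
        unfolding Act_eq(1) using Act_eq(2) by (intro sum.union_disjoint[symmetric]) auto
      also have "\<dots> = 3 * (\<mu>\<^sup>2 * (\<Sum>i\<in>Act. (\<nu> $ i)\<^sup>2) + (\<Sum>i\<in>Act. (E $ i)\<^sup>2))"
        by (simp add: sum_distrib_left sum.distrib distrib_left)
      also have "\<dots> \<le> 3 * w" unfolding w_def n_def e_def
        by (intro mult_left_mono add_mono sum_sq_le_norm) auto
      finally show ?thesis using 1 2 sq by (simp add: viol_def)
    qed
    have sp: "\<zeta> * s \<le> p + 2 * R * (\<mu> * n) + 2 * R * e"
    proof -
      have "G zs (lb - ls) = 0"
        using S_stationary[OF lb] S_stationary[OF ls] by (simp add: lin_comb_diff add_eq_0_iff)
      then have "0 = (lb - ls) \<bullet> (\<mu> *\<^sub>R \<nu> + rr - E)"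
        using vAD[of "lb - ls"] S_zero[OF lb] S_zero[OF ls] by simp
      then have "- (lb \<bullet> rr) = p + (lb - ls) \<bullet> (\<mu> *\<^sub>R \<nu> - E)"
        by (simp add: p_def inner_add_right inner_diff_right inner_diff_left algebra_simps)
      moreover have "(lb - ls) \<bullet> (\<mu> *\<^sub>R \<nu> - E) \<le> norm (lb - ls) * norm (\<mu> *\<^sub>R \<nu> - E)"
        by (rule norm_cauchy_schwarz)
      moreover have "\<dots> \<le> (2 * R) * (\<mu> * n + e)"
      proof (intro mult_mono)
        show "norm (lb - ls) \<le> 2 * R" using norm_triangle_ineq4[of lb ls] R(2)[OF lb] R(2)[OF ls] by simp
        show "norm (\<mu> *\<^sub>R \<nu> - E) \<le> \<mu> * n + e"
          using norm_triangle_ineq4[of "\<mu> *\<^sub>R \<nu>" E] \<mu> by (simp add: n_def e_def)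
      qed (use R in auto)
      moreover have "\<zeta> * s \<le> - (lb \<bullet> rr)"
      proof -
        have "\<zeta> * s = (\<Sum>i\<in>Pos. \<zeta> * (- rr $ i))" by (simp add: s_def sum_distrib_left)
        also have "\<dots> \<le> (\<Sum>i\<in>Pos. lb $ i * (- rr $ i))"
          using \<zeta>(2) rrP by (intro sum_mono mult_right_mono) auto
        also have "\<dots> = (\<Sum>i\<in>UNIV. lb $ i * (- rr $ i))"
          using S_zero_off_Pos[OF lb] by (intro sum.mono_neutral_left) auto
        finally show ?thesis by (simp add: inner_vec_def sum_negf)
      qed
      ultimately show ?thesis by (simp add: algebra_simps)
    qed
    have "\<zeta>\<^sup>2 * s\<^sup>2 \<le> 3 * (p\<^sup>2 + 4 * R\<^sup>2 * w)"
    proof -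
      have "(\<zeta> * s)\<^sup>2 \<le> (p + 2 * R * (\<mu> * n) + 2 * R * e)\<^sup>2"
        using sp s0 \<zeta> by (intro power_mono) auto
      also have "\<dots> \<le> 3 * (p\<^sup>2 + (2 * R * (\<mu> * n))\<^sup>2 + (2 * R * e)\<^sup>2)" by (rule square_sum3_le)
      finally show ?thesis by (simp add: w_def power_mult_distrib algebra_simps)
    qed
    then have "3 * s\<^sup>2 \<le> c2 * p\<^sup>2 + (c1 - 3) * w"
      using \<zeta> by (simp add: c1_def c2_def field_simps)
    then have "viol D \<le> c1 * w + c2 * p\<^sup>2" using viol by (simp add: algebra_simps)
    then have "C0 * viol D \<le> C0 * (c1 * w + c2 * p\<^sup>2)" using C0 by (intro mult_left_mono) auto
    moreover have "C0 * c1 * (\<mu>\<^sup>2 * n\<^sup>2) \<le> \<mu> / 2 * n\<^sup>2"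
    proof -
      have "C0 * c1 * \<mu> \<le> C0 * c1 * \<theta>" using \<mu> C0 c1 by (intro mult_left_mono) auto
      then have "(C0 * c1 * \<mu>) * (\<mu> * n\<^sup>2) \<le> 1 / 2 * (\<mu> * n\<^sup>2)"
        using \<theta>1 \<mu> by (intro mult_right_mono) auto
      then show ?thesis by (simp add: power2_eq_square mult_ac)
    qed
    moreover have "C0 * c2 * p\<^sup>2 \<le> p / 2"
    proof -
      have "C0 * c2 * p \<le> C0 * c2 * (m * R * \<theta>)" using pR C0 c2 by (intro mult_left_mono) auto
      then have "(C0 * c2 * p) * p \<le> 1 / 2 * p" using \<theta>2 p0 by (intro mult_right_mono) auto
      then show ?thesis by (simp add: power2_eq_square mult_ac)
    qed
    moreover have "a * (norm D)\<^sup>2 - C0 * viol D \<le> D \<bullet> (H zs l0 *v D)" by (rule coer[OF l0])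
    moreover have "C0 * (c1 * w + c2 * p\<^sup>2) = C0 * c1 * (\<mu>\<^sup>2 * n\<^sup>2) + C0 * c1 * e\<^sup>2 + C0 * c2 * p\<^sup>2"
      by (simp add: w_def algebra_simps)
    ultimately have "a * (norm D)\<^sup>2 + \<mu> / 2 * n\<^sup>2
        \<le> norm (H zs l0 *v D + G zs \<nu>) * norm D + n * e + C0 * c1 * e\<^sup>2"
      using energy p0 by linarith
    then show ?thesis by (simp add: \<nu>_def n_def e_def)
  qed
  then have "perturbation_constants a \<theta> (C0 * c1)"
    unfolding perturbation_constants_def by blast
  then show ?thesis using a \<theta> C0 c1 by (meson mult_pos_pos)
qed

section \<open>Two-sided comparison of the residual with the distance\<close>

abbreviation "eta0 z l \<equiv> eta \<phi> g z l"

lemma eta_nonneg: "0 \<le> eta0 z l"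
  by (simp add: eta_def)

lemma grad_le_eta: "z \<in> ball zs r \<Longrightarrow> norm (grad \<phi> z + G z l) \<le> eta0 z l"
  by (simp add: eta_def grad_lagrangian norm_Pair real_le_rsqrt)

lemma min_le_eta: "\<bar>min (l $ i) (- (g z $ i))\<bar> \<le> eta0 z l"
proof -
  have "\<bar>(\<chi> i. min (l $ i) (- (g z $ i))) $ i\<bar> \<le> norm (\<chi> i. min (l $ i) (- (g z $ i)))"
    by (rule component_le_norm_cart)
  also have "\<dots> \<le> eta0 z l" by (simp add: eta_def norm_Pair real_le_rsqrt)
  finally show ?thesis by simp
qed

lemma eta_leI:
  assumes "z \<in> ball zs r" "norm (grad \<phi> z + G z l) \<le> a" "\<And>i. \<bar>min (l $ i) (- (g z $ i))\<bar> \<le> b"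
  shows "eta0 z l \<le> a + real CARD('m) * b"
proof -
  have "eta0 z l \<le> norm (grad \<phi> z + G z l) + norm (\<chi> i. min (l $ i) (- (g z $ i)))"
    using assms(1) by (simp add: eta_def grad_lagrangian norm_Pair sqrt_sum_squares_le_sum)
  moreover have "norm (\<chi> i. min (l $ i) (- (g z $ i))) \<le> real CARD('m) * b"
    by (rule norm_vec_le_card) (use assms in simp)
  ultimately show ?thesis using assms(2) by simp
qed

text \<open>The residual vanishes on \<open>{zs} \<times> S\<close>, and both of its blocks are
  Lipschitz there, with \<open>l\<close> confined to norm at most \<open>R + 1\<close>.\<close>

lemma eta_upper: "\<exists>C>0. \<forall>z l. dS z l < r \<longrightarrow> eta0 z l \<le> C * dS z l"
proof -
  define C where "C = K * (2 + R) + K + real CARD('m) * (1 + K)"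
  have "C > 0" using R K_ge by (auto simp: C_def intro!: add_nonneg_pos mult_pos_pos)
  moreover have "eta0 z l \<le> C * dS z l" if \<delta>: "dS z l < r" for z l
  proof -
    obtain ls where ls: "ls \<in> S" "norm (z - zs) \<le> dS z l" "norm (l - ls) \<le> dS z l"
      using dist_sol_attained by blast
    have zb: "z \<in> ball zs r" using ls \<delta> by (intro in_ball_zs) simp
    have nl: "norm l \<le> R + 1"
      using norm_triangle_sub[of l ls] ls R(2)[OF ls(1)] \<delta> r_le by simp
    have "eta0 z l \<le> (K * (2 + R) + K) * dS z l + real CARD('m) * ((1 + K) * dS z l)"
    proof (rule eta_leI[OF zb])
      have "grad \<phi> z + G z l = (grad \<phi> z + G z l - (grad \<phi> zs + G zs l)) + G zs (l - ls)"
        using minus_unique[OF S_stationary[OF ls(1)]] by (simp add: lin_comb_diff)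
      also have "norm \<dots> \<le> K * (1 + norm l) * norm (z - zs) + K * norm (l - ls)"
        by (intro norm_triangle_mono grad_lagrangian_lipschitz norm_lin_comb_le zb zs_in_ball)
      also have "\<dots> \<le> K * (2 + R) * dS z l + K * dS z l"
      proof -
        have "K * (1 + norm l) \<le> K * (2 + R)" using nl K_ge by (intro mult_left_mono) auto
        then have "K * (1 + norm l) * norm (z - zs) \<le> K * (2 + R) * dS z l"
          by (rule mult_mono[OF _ ls(2)]) (use K_ge R in auto)
        then show ?thesis using mult_left_mono[OF ls(3) K_ge(5)] by simp
      qed
      finally show "norm (grad \<phi> z + G z l) \<le> (K * (2 + R) + K) * dS z l" by (simp add: distrib_right)
      fix i
      have "min (ls $ i) (- (g zs $ i)) = 0"
        using S_nonneg[OF ls(1), of i] S_zero[OF ls(1), of i] g_zs_le[of i]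
        by (cases "i \<in> Act") (auto simp: active_def)
      moreover have "\<bar>l $ i - ls $ i\<bar> \<le> dS z l"
        using component_le_norm_cart[of "l - ls" i] ls(3) by simp
      moreover have "\<bar>g z $ i - g zs $ i\<bar> \<le> K * dS z l"
        using constraint_lipschitz[OF zs_in_ball zb, of i] mult_left_mono[OF ls(2) K_ge(5)] by simp
      ultimately show "\<bar>min (l $ i) (- (g z $ i))\<bar> \<le> (1 + K) * dS z l"
        by (simp add: distrib_right min_def abs_le_iff split: if_splits)
    qed
    then show ?thesis by (simp add: C_def algebra_simps)
  qed
  ultimately show ?thesis by blast
qed

text \<open>\<open>perturbation_constants\<close> is applied with \<open>\<mu> = 0\<close> to the multiplier \<open>lp\<close> obtained from \<open>l\<close> by deleting
  the components where \<open>min (l $ i) (- g z $ i)\<close> is \<open>l $ i\<close>; \<open>ls\<close> is the Hoffman point of \<open>lp\<close>.\<close>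

lemma error_bound:
  "\<exists>C>0. \<exists>\<delta>1>0. \<forall>z l. 0 \<le> l \<longrightarrow> dS z l \<le> \<delta>1 \<longrightarrow> dS z l \<le> C * eta0 z l"
proof -
  obtain a \<theta> C5 where a: "a > 0" and \<theta>: "\<theta> > 0" and C5: "C5 > 0"
    and pc: "perturbation_constants a \<theta> C5"
    using perturbation_bound by blast
  note core = pc[unfolded perturbation_constants_def, rule_format (no_asm)]
  obtain CH where CH: "CH > 0"
    and hoff: "\<And>l. 0 \<le> l \<Longrightarrow> (\<forall>i. i \<notin> Act \<longrightarrow> l $ i = 0) \<Longrightarrow>
       \<exists>ls\<in>S. norm (l - ls) \<le> CH * norm (grad \<phi> zs + G zs l)"
    using S_hoffman by blast
  obtain c where c: "c > 0" "\<And>i. i \<notin> Act \<Longrightarrow> g zs $ i \<le> - c" using inactive_gap by blast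
  obtain Cu where Cu: "Cu > 0" "\<And>z l. dS z l < r \<Longrightarrow> eta0 z l \<le> Cu * dS z l"
    using eta_upper by blast
  define m where "m = real CARD('m)"
  have m: "m \<ge> 1" by (simp add: m_def)
  define P1 where "P1 = CH * (1 + K * m + K * (2 + R))"
  define P where "P = P1 + m * (1 + K) + (1 + K * (2 + R) + K * (m + P1) * 2 + K * m)"
  have K: "K \<ge> 1" "K \<ge> 0" using K_ge by auto
  have P1: "P1 \<ge> 0" using CH K m R by (simp add: P1_def)
  have P: "P \<ge> 0" "P1 \<le> P" "m * (1 + K) \<le> P" "1 + K * (2 + R) + K * (m + P1) * 2 + K * m \<le> P"
    using P1 K m R by (auto simp: P_def)
  define Q where "Q = P + P\<^sup>2 + C5 * P\<^sup>2"
  have Q: "Q \<ge> 0" using P C5 by (simp add: Q_def)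
  \<comment> \<open>\<open>\<theta> / K\<close> keeps \<open>g z\<close> on \<open>Act\<close>
    within the slack range of \<open>perturbation_constants\<close>;
    \<open>a / (2 * (Q + 1))\<close> absorbs the term cubic in \<open>d\<close>; the entries with
    \<open>c\<close> make the components of \<open>l\<close> at inactive constraints at most
    \<epsilon>.\<close>
  define \<delta>1 where "\<delta>1 = Min {r / 2, \<theta> / K, a / (2 * (Q + 1)), c / (2 * K), c / (4 * Cu), 1 / Cu}"
  have \<delta>1: "\<delta>1 > 0" using r_pos \<theta> K a Q c Cu by (auto simp: \<delta>1_def)
  have \<delta>s: "\<delta>1 \<le> r / 2" "\<delta>1 \<le> \<theta> / K" "\<delta>1 \<le> a / (2 * (Q + 1))" "\<delta>1 \<le> c / (2 * K)" "\<delta>1 \<le> c / (4 * Cu)" "\<delta>1 \<le> 1 / Cu"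
    unfolding \<delta>1_def by (rule Min_le; simp)+
  have \<delta>2: "K * \<delta>1 \<le> \<theta>" "K * \<delta>1 \<le> c / 2" "Cu * \<delta>1 \<le> c / 4" "Cu * \<delta>1 \<le> 1"
    using \<delta>s K Cu by (simp_all add: field_simps)
  have \<delta>3: "Q * \<delta>1 \<le> a / 2"
  proof -
    have "(Q + 1) * \<delta>1 \<le> a / 2" using \<delta>s(3) Q by (simp add: field_simps)
    then show ?thesis using \<delta>1 by (simp add: algebra_simps)
  qed
  define C6 where "C6 = 1 + 3 * Q / (a / 2)"
  have C6: "C6 \<ge> 0" using Q a by (simp add: C6_def)
  have "dS z l \<le> (C6 + m + P * (1 + C6)) * eta0 z l" if l: "0 \<le> l" and \<delta>: "dS z l \<le> \<delta>1" for z l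
  proof -
    define \<epsilon> where "\<epsilon> = eta0 z l"
    define D where "D = z - zs"
    define d where "d = norm D"
    obtain l1 where l1: "l1 \<in> S" "d \<le> dS z l" "norm (l - l1) \<le> dS z l"
      using dist_sol_attained unfolding d_def D_def by blast
    have d: "0 \<le> d" "d \<le> \<delta>1" "d \<le> 1" "d < r"
      using l1 \<delta> \<delta>s r_le r_pos by (auto simp: d_def)
    have zb: "z \<in> ball zs r" using d by (intro in_ball_zs) (simp add: d_def D_def)
    have "\<epsilon> \<le> Cu * dS z l" unfolding \<epsilon>_def using \<delta> \<delta>s r_pos by (intro Cu) simp
    also have "\<dots> \<le> Cu * \<delta>1" using \<delta> Cu by (intro mult_left_mono) auto
    finally have \<epsilon>: "0 \<le> \<epsilon>" "\<epsilon> \<le> c / 4" "\<epsilon> \<le> 1"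
      using \<delta>2 eta_nonneg by (auto simp: \<epsilon>_def)
    have l_i: "0 \<le> l $ i" for i using l by (simp add: less_eq_vec_def)
    have nl: "norm l \<le> R + 1"
      using norm_triangle_sub[of l l1] l1 R(2)[OF l1(1)] \<delta> \<delta>s r_le by simp
    have mine: "\<bar>min (l $ i) (- (g z $ i))\<bar> \<le> \<epsilon>" for i unfolding \<epsilon>_def by (rule min_le_eta)
    define T where "T = {i \<in> Act. - (g z $ i) < l $ i}"
    define lp where "lp = (\<chi> i. if i \<in> T then l $ i else 0)"
    define rr where "rr = (\<chi> i. if i \<in> Act - T then g z $ i else 0)"
    \<comment> \<open>\<open>E\<close> is whatever makes the linearised equation with
      \<open>\<mu> = 0\<close> exact. On \<open>T\<close> it is small because \<open>g z $ i\<close>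
      is itself part of the residual; on the rest of \<open>Act\<close> only the Taylor remainder is
      left.\<close>
    define E where "E = (\<chi> i. if i \<in> Act then rr $ i - A i \<bullet> D else 0)"
    have offT: "l $ i \<le> \<epsilon>" if "i \<notin> T" for i
    proof (cases "i \<in> Act")
      case True
      then show ?thesis using that mine[of i] l_i[of i] by (auto simp: T_def)
    next
      case False
      \<comment> \<open>For inactive \<open>i\<close> this gives
        \<open>- g z $ i \<ge> c / 2\<close>, more than the bound \<open>c / 4\<close> on
        \<epsilon>, so the minimum in the residual must be \<open>l $ i\<close>.\<close>
      have "\<bar>g z $ i - g zs $ i\<bar> \<le> K * d"
        unfolding d_def D_def by (rule constraint_lipschitz[OF zs_in_ball zb])
      also have "\<dots> \<le> K * \<delta>1" using d K by (intro mult_left_mono) auto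
      finally have "c / 2 \<le> - (g z $ i)" using \<delta>2(2) c(2)[OF False] by (simp add: abs_le_iff)
      then show ?thesis using mine[of i] \<epsilon> c l_i[of i] by (auto simp: min_def abs_le_iff split: if_splits)
    qed
    have llp: "norm (l - lp) \<le> m * \<epsilon>"
      unfolding m_def using offT l_i \<epsilon> by (intro norm_vec_le_card) (auto simp: lp_def)
    have lp0: "0 \<le> lp" "\<forall>i. i \<notin> Act \<longrightarrow> lp $ i = 0"
      using l_i by (auto simp: lp_def less_eq_vec_def T_def)
    have gA: "\<bar>g z $ i - A i \<bullet> D\<bar> \<le> K * d\<^sup>2" if "i \<in> Act" for i
      using constraint_taylor[OF zs_in_ball zb, of i] that by (simp add: active_def d_def D_def)
    have Ei: "\<bar>E $ i\<bar> \<le> (1 + K) * (\<epsilon> + d\<^sup>2)" for i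
    proof -
      have "\<bar>E $ i\<bar> \<le> \<epsilon> + K * d\<^sup>2"
      proof (cases "i \<in> Act")
        case False
        then show ?thesis using \<epsilon> K by (simp add: E_def)
      next
        case True
        show ?thesis
        proof (cases "i \<in> T")
          case False
          then show ?thesis using gA[OF True] True \<epsilon> by (simp add: E_def rr_def)
        next
          case T: True
          then have "\<bar>g z $ i\<bar> \<le> \<epsilon>" using mine[of i] by (auto simp: T_def min_def split: if_splits)
          then show ?thesis using T gA[OF True] by (auto simp: E_def rr_def True)
        qed
      qed
      also have "\<dots> \<le> (1 + K) * (\<epsilon> + d\<^sup>2)"
        using \<epsilon> K by (simp add: algebra_simps)
      finally show ?thesis .
    qed
    have nE: "norm E \<le> P * (\<epsilon> + d\<^sup>2)"
    proof -
      have "norm E \<le> m * ((1 + K) * (\<epsilon> + d\<^sup>2))" unfolding m_def by (rule norm_vec_le_card) (rule Ei)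
      also have "\<dots> = (m * (1 + K)) * (\<epsilon> + d\<^sup>2)" by simp
      also have "\<dots> \<le> P * (\<epsilon> + d\<^sup>2)" using P \<epsilon> by (intro mult_right_mono) auto
      finally show ?thesis .
    qed
    obtain ls where ls: "ls \<in> S" "norm (lp - ls) \<le> CH * norm (grad \<phi> zs + G zs lp)"
      using hoff[OF lp0] by blast
    define n where "n = norm (lp - ls)"
    have w: "grad \<phi> zs + G zs lp = (grad \<phi> z + G z l) - (grad \<phi> z + G z l - (grad \<phi> zs + G zs l)) - G zs (l - lp)"
      by (simp add: lin_comb_diff)
    have X: "norm (grad \<phi> z + G z l) \<le> \<epsilon>" unfolding \<epsilon>_def by (rule grad_le_eta[OF zb])
    have Gl: "norm (G zs (l - lp)) \<le> K * (m * \<epsilon>)"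
      using norm_lin_comb_le[OF zs_in_ball, of "l - lp"] mult_left_mono[OF llp K(2)] by simp
    have K2R: "K * (1 + norm l) * x \<le> K * (2 + R) * x" if "0 \<le> x" for x
      using nl K that by (intro mult_right_mono mult_left_mono) auto
    have "norm (grad \<phi> zs + G zs lp) \<le> \<epsilon> + K * (2 + R) * d + K * (m * \<epsilon>)"
    proof -
      have "norm (grad \<phi> z + G z l - (grad \<phi> zs + G zs l)) \<le> K * (2 + R) * d"
        using grad_lagrangian_lipschitz[OF zs_in_ball zb, of l] K2R[of d] d by (simp add: d_def D_def)
      then show ?thesis unfolding w using X Gl
        by (smt (verit) norm_triangle_ineq4)
    qed
    then have "n \<le> CH * (\<epsilon> + K * (2 + R) * d + K * (m * \<epsilon>))"
      using ls(2) CH unfolding n_def by (smt (verit) mult_left_mono)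
    also have "\<dots> \<le> P1 * (\<epsilon> + d)"
    proof -
      have "\<epsilon> + K * (2 + R) * d + K * (m * \<epsilon>) \<le> (1 + K * m + K * (2 + R)) * (\<epsilon> + d)"
        using \<epsilon> d K m R by (simp add: algebra_simps)
      then show ?thesis using CH by (simp add: P1_def mult.assoc)
    qed
    finally have n1: "n \<le> P1 * (\<epsilon> + d)" .
    have n2: "n \<le> P * (\<epsilon> + d)" using n1 P(2) \<epsilon> d by (smt (verit) mult_right_mono)
    define E1 where "E1 = H zs ls *v D + G zs (lp - ls)"
    have nE1: "norm E1 \<le> P * (\<epsilon> + d\<^sup>2)"
    proof -
      \<comment> \<open>Since \<open>grad \<phi> zs = - G zs ls\<close>, \<open>E1\<close> is the
        Lagrangian gradient at \<open>(z, l)\<close> corrected by a Taylor remainder, the change of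
        the Hessian from \<open>l\<close> to \<open>ls\<close> and the deleted components, all of
        order \<open>\<epsilon> + d\<^sup>2\<close>.\<close>
      have "E1 = (grad \<phi> z + G z l) - (grad \<phi> z + G z l - (grad \<phi> zs + G zs l) - H zs l *v D)
          - (H zs l *v D - H zs ls *v D) - G zs (l - lp)"
        using minus_unique[OF S_stationary[OF ls(1)], symmetric] by (simp add: E1_def lin_comb_diff)
      moreover have "norm (grad \<phi> z + G z l - (grad \<phi> zs + G zs l) - H zs l *v D) \<le> K * (2 + R) * d\<^sup>2"
        using grad_lagrangian_taylor[OF zs_in_ball zb, of l] K2R[of "d\<^sup>2"] by (simp add: d_def D_def)
      moreover have "norm (H zs l *v D - H zs ls *v D) \<le> K * (m + P1) * 2 * (\<epsilon> + d\<^sup>2)"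
      proof -
        have "norm (l - ls) \<le> norm (l - lp) + n"
          using norm_triangle_ineq[of "l - lp" "lp - ls"] by (simp add: n_def)
        also have "\<dots> \<le> m * (\<epsilon> + d) + P1 * (\<epsilon> + d)"
          using llp n1 m d by (smt (verit) mult_left_mono)
        finally have ll: "norm (l - ls) \<le> (m + P1) * (\<epsilon> + d)" by (simp add: distrib_right)
        have "norm (H zs l *v D - H zs ls *v D) \<le> K * norm (l - ls) * d"
          using norm_H_mult_diff_le[OF zs_in_ball zs_in_ball, of l D ls] by (simp add: d_def)
        also have "\<dots> \<le> K * ((m + P1) * (\<epsilon> + d)) * d"
          using ll K d by (intro mult_right_mono mult_left_mono) auto
        also have "\<dots> = K * (m + P1) * (\<epsilon> * d + d\<^sup>2)" by (simp add: power2_eq_square algebra_simps)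
        also have "\<dots> \<le> K * (m + P1) * (2 * (\<epsilon> + d\<^sup>2))"
        proof (intro mult_left_mono)
          have "\<epsilon> * d \<le> \<epsilon>" using \<epsilon> d by (simp add: mult_left_le)
          then have "\<epsilon> * d + d\<^sup>2 \<le> \<epsilon> + d\<^sup>2" by simp
          moreover have "0 \<le> \<epsilon> + d\<^sup>2" using \<epsilon> by simp
          ultimately show "\<epsilon> * d + d\<^sup>2 \<le> 2 * (\<epsilon> + d\<^sup>2)" by simp
        qed (use K m P1 in auto)
        finally show ?thesis by (simp only: mult.assoc mult.commute mult.left_commute)
      qed
      ultimately have "norm E1 \<le> \<epsilon> + K * (2 + R) * d\<^sup>2 + K * (m + P1) * 2 * (\<epsilon> + d\<^sup>2) + K * (m * \<epsilon>)"
        using X Gl by (smt (verit) norm_triangle_ineq4)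
      also have "\<dots> \<le> (1 + K * (2 + R) + K * (m + P1) * 2 + K * m) * (\<epsilon> + d\<^sup>2)"
      proof -
        have "\<epsilon> + K * (2 + R) * d\<^sup>2 + K * (m * \<epsilon>) \<le> (1 + K * (2 + R) + K * m) * (\<epsilon> + d\<^sup>2)"
          using \<epsilon> K m R by (simp add: algebra_simps)
        then show ?thesis by (simp add: distrib_right)
      qed
      also have "\<dots> \<le> P * (\<epsilon> + d\<^sup>2)" by (rule mult_right_mono[OF P(4)]) (use \<epsilon> in auto)
      finally show ?thesis .
    qed
    have "a * (norm D)\<^sup>2 + 0 / 2 * (norm (lp - ls))\<^sup>2 \<le>
       norm (H zs ls *v D + G zs (lp - ls)) * norm D + norm (lp - ls) * norm E + C5 * (norm E)\<^sup>2"
    proof (rule core[OF ls(1) ls(1) lp0])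
      show "\<forall>i\<in>Act. A i \<bullet> D = 0 * (lp - ls) $ i + rr $ i - E $ i" by (simp add: E_def)
      show "\<forall>i\<in>Act. - \<theta> \<le> rr $ i \<and> rr $ i \<le> 0 \<and> lp $ i * rr $ i = 0"
      proof
        fix i assume i: "i \<in> Act"
        have "\<bar>g z $ i\<bar> \<le> K * d"
          using constraint_lipschitz[OF zs_in_ball zb, of i] i by (simp add: active_def d_def D_def)
        also have "\<dots> \<le> K * \<delta>1" using d K by (intro mult_left_mono) auto
        finally have "\<bar>g z $ i\<bar> \<le> \<theta>" using \<delta>2 by simp
        moreover have "i \<notin> T \<Longrightarrow> g z $ i \<le> 0" using i l_i[of i] by (simp add: T_def)
        ultimately show "- \<theta> \<le> rr $ i \<and> rr $ i \<le> 0 \<and> lp $ i * rr $ i = 0"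
          using \<theta> by (auto simp: rr_def lp_def)
      qed
    qed (use \<theta> in auto)
    then have "a * d\<^sup>2 \<le> norm E1 * d + n * norm E + C5 * (norm E)\<^sup>2"
      by (simp add: d_def n_def E1_def)
    also have "\<dots> \<le> P * (\<epsilon> + d\<^sup>2) * (\<epsilon> + d) + P * (\<epsilon> + d) * (P * (\<epsilon> + d\<^sup>2)) + C5 * (P\<^sup>2 * ((\<epsilon> + d) * (\<epsilon> + d\<^sup>2)))"
    proof -
      have "(norm E)\<^sup>2 \<le> (P * (\<epsilon> + d\<^sup>2))\<^sup>2" using nE by (intro power_mono) auto
      also have "\<dots> = P\<^sup>2 * ((\<epsilon> + d\<^sup>2) * (\<epsilon> + d\<^sup>2))" by (simp add: power2_eq_square mult_ac)
      also have "\<dots> \<le> P\<^sup>2 * ((\<epsilon> + d) * (\<epsilon> + d\<^sup>2))"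
      proof (intro mult_left_mono mult_right_mono)
        have "d\<^sup>2 \<le> d" using d by (simp add: power2_eq_square mult_left_le)
        then show "\<epsilon> + d\<^sup>2 \<le> \<epsilon> + d" by simp
      qed (use \<epsilon> in auto)
      finally have "C5 * (norm E)\<^sup>2 \<le> C5 * (P\<^sup>2 * ((\<epsilon> + d) * (\<epsilon> + d\<^sup>2)))"
        using C5 by (intro mult_left_mono) auto
      moreover have "norm E1 * d \<le> P * (\<epsilon> + d\<^sup>2) * (\<epsilon> + d)"
        by (rule mult_mono[OF nE1]) (use \<epsilon> d P in auto)
      moreover have "n * norm E \<le> P * (\<epsilon> + d) * (P * (\<epsilon> + d\<^sup>2))"
        by (rule mult_mono[OF n2 nE]) (use \<epsilon> d P in auto)
      ultimately show ?thesis by linarith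
    qed
    also have "\<dots> = Q * ((\<epsilon> + d) * (\<epsilon> + d\<^sup>2))" by (simp add: Q_def power2_eq_square algebra_simps)
    also have "\<dots> = Q * (\<epsilon>\<^sup>2 + \<epsilon> * d + \<epsilon> * (d * d)) + (Q * d) * d\<^sup>2"
      by (simp add: power2_eq_square algebra_simps)
    \<comment> \<open>The only term without a factor \<epsilon> is cubic in \<open>d\<close>; by the
      choice of \<delta>1 its coefficient \<open>Q * d\<close> is at most \<open>a / 2\<close>, half
      of the coercivity constant.\<close>
    also have "\<dots> \<le> Q * (\<epsilon>\<^sup>2 + 2 * \<epsilon> * d) + a / 2 * d\<^sup>2"
    proof -
      have "\<epsilon> * (d * d) \<le> \<epsilon> * d" using \<epsilon> d by (intro mult_left_mono) (auto simp: mult_left_le)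
      then have "Q * (\<epsilon>\<^sup>2 + \<epsilon> * d + \<epsilon> * (d * d)) \<le> Q * (\<epsilon>\<^sup>2 + 2 * \<epsilon> * d)"
        using Q by (intro mult_left_mono) auto
      moreover have "Q * d \<le> Q * \<delta>1" using Q d by (intro mult_left_mono) auto
      then have "Q * d * d\<^sup>2 \<le> a / 2 * d\<^sup>2" using \<delta>3 by (intro mult_right_mono) auto
      ultimately show ?thesis by linarith
    qed
    finally have "(a / 2) * d\<^sup>2 \<le> Q * (\<epsilon>\<^sup>2 + 2 * \<epsilon> * d)" by simp
    then have dC: "d \<le> C6 * \<epsilon>"
      unfolding C6_def using a \<epsilon> d Q by (intro quadratic_le_imp_linear_le) auto
    have "dS z l \<le> d + norm (l - ls)"
      using dist_sol_le[OF ls(1), of z l] by (simp add: d_def D_def)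
    also have "norm (l - ls) \<le> m * \<epsilon> + n"
      using norm_triangle_ineq[of "l - lp" "lp - ls"] llp by (simp add: n_def)
    also have "n \<le> P * (\<epsilon> + C6 * \<epsilon>)"
      using n2 dC P by (smt (verit) mult_left_mono)
    finally show ?thesis using dC by (simp add: \<epsilon>_def algebra_simps)
  qed
  moreover have "C6 + m + P * (1 + C6) > 0" using C6 m P by (simp add: add_nonneg_pos add_pos_nonneg)
  ultimately show ?thesis using \<delta>1 by blast
qed

section \<open>The stabilized subproblem\<close>

abbreviation "obj \<equiv> ssqp_objective \<phi> g"

definition "lcon z d i = g z $ i + grad_comp g i z \<bullet> d"

text \<open>In \<open>l'\<close> the objective separates into one scalar concave problem per
  component, which is why the inner maximum can be treated componentwise.\<close>

lemma obj_eq: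
  "obj \<mu> z l d l' = d \<bullet> grad \<phi> z + 1/2 * (d \<bullet> (H z l *v d))
     + (\<Sum>i\<in>UNIV. l' $ i * lcon z d i - \<mu> / 2 * (l' $ i - l $ i)\<^sup>2)"
proof -
  have "l' \<bullet> (g z + (\<chi> i. grad_comp g i z \<bullet> d)) = (\<Sum>i\<in>UNIV. l' $ i * lcon z d i)"
    by (subst inner_vec_def) (simp add: lcon_def)
  moreover have "(norm (l' - l))\<^sup>2 = (\<Sum>i\<in>UNIV. (l' $ i - l $ i)\<^sup>2)"
    by (simp add: power2_norm_eq_inner inner_self_sum)
  ultimately show ?thesis
    by (simp add: ssqp_objective_def sum_subtractf sum_distrib_left sum_negf)
qed

lemma sum_lcon: "(\<Sum>i\<in>UNIV. l' $ i * lcon z d i) = l' \<bullet> g z + G z l' \<bullet> d"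
  by (simp add: lcon_def lin_comb_inner inner_vec_def[of l'] distrib_left sum.distrib)

lemma obj_gderiv:
  assumes "z \<in> ball zs r"
  shows "GDERIV (\<lambda>d. obj \<mu> z l d l') d :> grad \<phi> z + H z l *v d + G z l'"
proof -
  define c where "c = (\<Sum>i\<in>UNIV. \<mu> / 2 * (l' $ i - l $ i)\<^sup>2)"
  have 1: "(\<lambda>d. obj \<mu> z l d l') = (\<lambda>d. d \<bullet> grad \<phi> z + 1/2 * (d \<bullet> (H z l *v d)) + (l' \<bullet> g z + G z l' \<bullet> d) - c)"
    by (simp add: obj_eq c_def sum_subtractf sum_lcon fun_eq_iff)
  have Hd: "((\<lambda>d. H z l *v d) has_derivative (\<lambda>h. H z l *v h)) (at d)"
    by (rule bounded_linear_imp_has_derivative) (rule matrix_vector_mul_bounded_linear)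
  have "((\<lambda>d. d \<bullet> grad \<phi> z + 1/2 * (d \<bullet> (H z l *v d)) + (l' \<bullet> g z + G z l' \<bullet> d) - c) has_derivative
     (\<lambda>h. h \<bullet> grad \<phi> z + 1/2 * (d \<bullet> (H z l *v h) + h \<bullet> (H z l *v d)) + (0 + G z l' \<bullet> h) - 0)) (at d)"
    by (intro derivative_intros Hd)
  moreover have "h \<bullet> grad \<phi> z + 1/2 * (d \<bullet> (H z l *v h) + h \<bullet> (H z l *v d)) + (0 + G z l' \<bullet> h) - 0
     = h \<bullet> (grad \<phi> z + H z l *v d + G z l')" for h
    using H_symmetric[OF assms, of l h d] by (simp add: inner_add_right inner_commute)
  ultimately show ?thesis by (simp add: gderiv_def 1)
qed

text \<open>The partial derivative of the subproblem objective in the multiplier component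
  \<open>i\<close> at \<open>lp\<close>. In the energy estimate it plays the role of the slack
  \<open>rr\<close>.\<close>

definition "cres \<mu> z l d lp i = lcon z d i - \<mu> * (lp $ i - l $ i)"

definition ssqp_kkt where
  "ssqp_kkt \<mu> z l d lp \<longleftrightarrow> 0 \<le> lp \<and> grad \<phi> z + H z l *v d + G z lp = 0 \<and>
     (\<forall>i. cres \<mu> z l d lp i \<le> 0 \<and> lp $ i * cres \<mu> z l d lp i = 0)"

text \<open>A competitor that differs from \<open>lp\<close> in a single component isolates one
  scalar problem, to which \<open>concave_max_on_nonneg_iff\<close> applies; conversely the scalar
  inequalities add up.\<close>

lemma inner_max_iff:
  assumes "0 \<le> \<mu>" "0 \<le> lp"
  shows "(\<forall>l'\<ge>0. obj \<mu> z l d l' \<le> obj \<mu> z l d lp) \<longleftrightarrow>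
    (\<forall>i. cres \<mu> z l d lp i \<le> 0 \<and> lp $ i * cres \<mu> z l d lp i = 0)"
proof -
  let ?f = "\<lambda>i s. s * lcon z d i - \<mu> / 2 * (s - l $ i)\<^sup>2"
  have lp: "0 \<le> lp $ i" for i using assms(2) by (simp add: less_eq_vec_def)
  have cr: "(\<forall>s\<ge>0. ?f i s \<le> ?f i (lp $ i)) \<longleftrightarrow> cres \<mu> z l d lp i \<le> 0 \<and> lp $ i * cres \<mu> z l d lp i = 0" for i
    unfolding cres_def by (rule concave_max_on_nonneg_iff[OF assms(1) lp])
  show ?thesis
  proof
    assume max: "\<forall>l'\<ge>0. obj \<mu> z l d l' \<le> obj \<mu> z l d lp"
    show "\<forall>i. cres \<mu> z l d lp i \<le> 0 \<and> lp $ i * cres \<mu> z l d lp i = 0"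
    proof
      fix i
      have "?f i s \<le> ?f i (lp $ i)" if "s \<ge> 0" for s
      proof -
        define l' where "l' = (\<chi> j. if j = i then s else lp $ j)"
        have "0 \<le> l'" using lp that by (simp add: l'_def less_eq_vec_def)
        then have "(\<Sum>j\<in>UNIV. ?f j (l' $ j)) \<le> (\<Sum>j\<in>UNIV. ?f j (lp $ j))"
          using max by (simp add: obj_eq)
        moreover have "(\<Sum>j\<in>UNIV. ?f j (l' $ j)) = ?f i s + (\<Sum>j\<in>UNIV - {i}. ?f j (l' $ j))"
          by (subst sum.remove[of _ i]) (auto simp: l'_def)
        moreover have "(\<Sum>j\<in>UNIV - {i}. ?f j (l' $ j)) = (\<Sum>j\<in>UNIV - {i}. ?f j (lp $ j))"
          by (intro sum.cong) (auto simp: l'_def)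
        moreover have "(\<Sum>j\<in>UNIV. ?f j (lp $ j)) = ?f i (lp $ i) + (\<Sum>j\<in>UNIV - {i}. ?f j (lp $ j))"
          by (subst sum.remove[of _ i]) auto
        ultimately show ?thesis by linarith
      qed
      then show "cres \<mu> z l d lp i \<le> 0 \<and> lp $ i * cres \<mu> z l d lp i = 0" using cr[of i] by blast
    qed
  next
    assume "\<forall>i. cres \<mu> z l d lp i \<le> 0 \<and> lp $ i * cres \<mu> z l d lp i = 0"
    then have "?f i s \<le> ?f i (lp $ i)" if "s \<ge> 0" for i s using cr[of i] that by blast
    then show "\<forall>l'\<ge>0. obj \<mu> z l d l' \<le> obj \<mu> z l d lp"
      unfolding obj_eq by (auto simp: less_eq_vec_def intro!: sum_mono)
  qed
qed

lemma ssqp_solution_kkt: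
  assumes "z \<in> ball zs r" "0 \<le> \<mu>" "ssqp_solution \<phi> g \<mu> z l d lp"
  shows "ssqp_kkt \<mu> z l d lp"
proof -
  have am: "is_arg_max (obj \<mu> z l d) (\<lambda>l'. 0 \<le> l') lp" and gr: "grad (\<lambda>d'. obj \<mu> z l d' lp) d = 0"
    using assms(3) by (auto simp: ssqp_solution_def)
  have "0 \<le> lp" "\<forall>l'\<ge>0. obj \<mu> z l d l' \<le> obj \<mu> z l d lp"
    using am by (auto simp: is_arg_max_def not_less)
  moreover have "grad \<phi> z + H z l *v d + G z lp = 0"
    using grad_eqI[OF obj_gderiv[OF assms(1)]] gr by metis
  ultimately show ?thesis using inner_max_iff[OF assms(2)] by (auto simp: ssqp_kkt_def)
qed

section \<open>A priori estimates for solutions of the subproblem\<close>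

text \<open>Only the primal step is assumed small; the multiplier is bounded through stationarity
  and MFCQ. The premise \<open>dS z l \<le> \<kappa> * \<mu>\<close> makes the square of the
  distance of order \<open>\<mu> * dS z l\<close>, so that Taylor remainders match the order claimed
  for the residual. The distance bound is merely linear; it serves to keep the new point where the
  error bound holds.\<close>

lemma ssqp_estimate:
  assumes \<kappa>: "\<kappa> > 0"
  shows "\<exists>\<rho>0>0. \<exists>\<mu>1>0. \<exists>\<delta>1>0. \<exists>C>0. \<forall>z l \<mu> d lp. 0 \<le> l \<longrightarrow> dS z l \<le> \<delta>1 \<longrightarrow> 0 \<le> \<mu> \<longrightarrow> \<mu> \<le> \<mu>1 \<longrightarrow>
     dS z l \<le> \<kappa> * \<mu> \<longrightarrow> norm d \<le> \<rho>0 \<longrightarrow> ssqp_kkt \<mu> z l d lp \<longrightarrow>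
     norm d \<le> C * dS z l \<and> (\<mu> > 0 \<longrightarrow> norm (lp - l) \<le> C * dS z l) \<and>
     eta0 (z + d) lp \<le> C * (\<mu> * dS z l) \<and> dS (z + d) lp \<le> C * dS z l"
proof -
  obtain a \<theta> C5 where a: "a > 0" and \<theta>: "\<theta> > 0" and C5: "C5 > 0"
    and pc: "perturbation_constants a \<theta> C5"
    using perturbation_bound by blast
  note core = pc[unfolded perturbation_constants_def, rule_format (no_asm)]
  obtain CH where CH: "CH > 0"
    and hoff: "\<And>l. 0 \<le> l \<Longrightarrow> (\<forall>i. i \<notin> Act \<longrightarrow> l $ i = 0) \<Longrightarrow>
       \<exists>ls\<in>S. norm (l - ls) \<le> CH * norm (grad \<phi> zs + G zs l)"
    using S_hoffman by blast
  obtain c where c: "c > 0" "\<And>i. i \<notin> Act \<Longrightarrow> g zs $ i \<le> - c" using inactive_gap by blast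
  obtain Q s where Q: "Q > 0" and s: "s > 0" "s \<le> r" and mb: "\<And>z l. norm (z - zs) < s \<Longrightarrow> 0 \<le> l \<Longrightarrow>
      (\<forall>i. i \<notin> Act \<longrightarrow> l $ i = 0) \<Longrightarrow> norm l \<le> Q * (1 + norm (grad \<phi> z + G z l))"
    using multiplier_bound by metis
  define m where "m = real CARD('m)"
  have m: "m \<ge> 1" by (simp add: m_def)
  have K: "K \<ge> 1" "K \<ge> 0" using K_ge by auto
  define K2 where "K2 = K * (2 + R)"
  have K2: "K2 \<ge> K" "K2 \<ge> K * (1 + R)" "K2 \<ge> 0" using K R by (auto simp: K2_def algebra_simps)
  define R1 where "R1 = Q * (1 + K2)"
  have R1: "R1 \<ge> 0" using Q K2 by (simp add: R1_def)
  define Rn where "Rn = R1 + R + 1"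
  have Rn: "Rn > 0" using R1 R by (simp add: Rn_def)
  define P where "P = m * (1 + K * \<kappa> + K) + 2 * K2"
  have P: "P > 0" "P \<ge> m * (1 + K * \<kappa> + K)" "P \<ge> 2 * K2"
  proof -
    have "m * (1 + K * \<kappa> + K) > 0" using m K \<kappa> by (intro mult_pos_pos add_pos_nonneg) auto
    then show "P > 0" "P \<ge> m * (1 + K * \<kappa> + K)" "P \<ge> 2 * K2" using K2 by (simp_all add: P_def)
  qed
  obtain \<delta>a Ca where \<delta>a: "\<delta>a > 0" and Ca: "Ca > 0" and ab: "absorbs a P C5 \<kappa> \<delta>a Ca"
    using energy_absorb[OF a P(1) C5 \<kappa>] by blast
  note absorb = ab[unfolded absorbs_def, rule_format]
  \<comment> \<open>The entries with \<open>c\<close> in \<rho>0 and \<delta>1 keep linearised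
    inactive constraints at or below \<open>- c / 2\<close>. The entries with \<theta> contribute a
    third each, from \<open>g z\<close>, from the linear term and from the stabilisation, to the
    lower bound \<open>- \<theta>\<close> for the slack.\<close>
  define \<rho>0 where "\<rho>0 = Min {1, r / 2, c / (4 * K), \<theta> / (3 * K)}"
  define \<mu>1 where "\<mu>1 = Min {1, \<theta>, \<theta> / (3 * Rn)}"
  define \<delta>1 where "\<delta>1 = Min {\<delta>a, r / 4, s / 2, c / (4 * K), c / 4, \<theta> / (3 * K), 1}"
  have pos: "\<rho>0 > 0" "\<mu>1 > 0" "\<delta>1 > 0"
    unfolding \<rho>0_def \<mu>1_def \<delta>1_def
    using r_pos c(1) \<theta> K(1) Rn \<delta>a s(1) by (subst Min_gr_iff; simp)+
  have \<rho>s: "\<rho>0 \<le> 1" "\<rho>0 \<le> r / 2" "\<rho>0 \<le> c / (4 * K)" "\<rho>0 \<le> \<theta> / (3 * K)"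
    unfolding \<rho>0_def by (rule Min_le; simp)+
  have \<mu>s: "\<mu>1 \<le> 1" "\<mu>1 \<le> \<theta>" "\<mu>1 \<le> \<theta> / (3 * Rn)"
    unfolding \<mu>1_def by (rule Min_le; simp)+
  have \<delta>s: "\<delta>1 \<le> \<delta>a" "\<delta>1 \<le> r / 4" "\<delta>1 \<le> s / 2" "\<delta>1 \<le> c / (4 * K)" "\<delta>1 \<le> c / 4" "\<delta>1 \<le> \<theta> / (3 * K)" "\<delta>1 \<le> 1"
    unfolding \<delta>1_def by (rule Min_le; simp)+
  have Ks: "K * \<rho>0 \<le> c / 4" "K * \<rho>0 \<le> \<theta> / 3" "K * \<delta>1 \<le> c / 4" "K * \<delta>1 \<le> \<theta> / 3" "\<mu>1 * Rn \<le> \<theta> / 3"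
    using \<rho>s \<mu>s \<delta>s K Rn by (simp_all add: field_simps)
  define C1 where "C1 = Ca + 1"
  define C3 where "C3 = K * (1 + R1) * (C1\<^sup>2 * \<kappa>) + K * (C1\<^sup>2 * \<kappa>) + m * (C1 + K * (C1\<^sup>2 * \<kappa>))"
  define C4 where "C4 = Ca + CH * (K2 * C1 + K * (1 + R1))"
  have C1: "C1 > 0" using Ca by (simp add: C1_def)
  have C3: "C3 \<ge> 0" using C1 K R1 m \<kappa> by (simp add: C3_def)
  have C4: "C4 \<ge> 0" using C1 K2 K R1 Ca CH by (simp add: C4_def)
  have main: "norm d \<le> C1 * dS z l \<and> (\<mu> > 0 \<longrightarrow> norm (lp - l) \<le> C1 * dS z l) \<and>
     eta0 (z + d) lp \<le> C3 * (\<mu> * dS z l) \<and> dS (z + d) lp \<le> C4 * dS z l"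
    if l: "0 \<le> l" and \<delta>l: "dS z l \<le> \<delta>1" and \<mu>: "0 \<le> \<mu>" "\<mu> \<le> \<mu>1" and \<delta>\<mu>l: "dS z l \<le> \<kappa> * \<mu>"
      and d: "norm d \<le> \<rho>0" and kkt: "ssqp_kkt \<mu> z l d lp"
    for z l \<mu> d lp
  proof -
    define \<delta> where "\<delta> = dS z l"
    have \<delta>: "0 \<le> \<delta>" "\<delta> \<le> \<delta>1" "\<delta> \<le> \<kappa> * \<mu>" "\<delta> \<le> 1"
      using dist_sol_nonneg \<delta>l \<delta>\<mu>l \<delta>s by (auto simp: \<delta>_def)
    have \<mu>1': "\<mu> \<le> 1" "\<mu> \<le> \<theta>" using \<mu> \<mu>s by auto
    obtain ls where ls: "ls \<in> S" "norm (z - zs) \<le> \<delta>" "norm (l - ls) \<le> \<delta>"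
      using dist_sol_attained unfolding \<delta>_def by blast
    have zb: "z \<in> ball zs r" using ls \<delta> \<delta>s r_pos by (intro in_ball_zs) linarith
    have zdb: "z + d \<in> ball zs r"
    proof (rule in_ball_zs)
      have "norm (z + d - zs) \<le> norm (z - zs) + norm d"
        using norm_triangle_ineq[of "z - zs" d] by (simp add: algebra_simps)
      then show "norm (z + d - zs) < r" using ls \<delta> \<delta>s d \<rho>s r_pos by linarith
    qed
    have nl: "norm l \<le> R + 1"
      using norm_triangle_sub[of l ls] ls R(2)[OF ls(1)] \<delta> by simp
    have l_i: "0 \<le> l $ i" for i using l by (simp add: less_eq_vec_def)
    have lp0: "0 \<le> lp" and stat: "grad \<phi> z + H z l *v d + G z lp = 0"
      and comp: "\<And>i. cres \<mu> z l d lp i \<le> 0" "\<And>i. lp $ i * cres \<mu> z l d lp i = 0"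
      using kkt by (auto simp: ssqp_kkt_def)
    have lp_i: "0 \<le> lp $ i" for i using lp0 by (simp add: less_eq_vec_def)
    have gd: "\<bar>grad_comp g i z \<bullet> d\<bar> \<le> K * \<rho>0" for i
    proof -
      have "\<bar>grad_comp g i z \<bullet> d\<bar> \<le> norm (grad_comp g i z) * norm d" by (rule Cauchy_Schwarz_ineq2)
      also have "\<dots> \<le> K * \<rho>0" using norm_grad_comp_le[OF zb] d K by (intro mult_mono) auto
      finally show ?thesis .
    qed
    have gz: "\<bar>g z $ i - g zs $ i\<bar> \<le> K * \<delta>1" for i
    proof -
      have "\<bar>g z $ i - g zs $ i\<bar> \<le> K * norm (z - zs)" by (rule constraint_lipschitz[OF zs_in_ball zb])
      also have "\<dots> \<le> K * \<delta>1" using ls \<delta> K by (intro mult_left_mono) auto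
      finally show ?thesis .
    qed
    \<comment> \<open>A nonzero \<open>lp $ i\<close> would force \<open>cres = 0\<close>, hence a
      linearised constraint of at least \<open>- \<mu> * l $ i \<ge> - c / 4\<close>, whereas
      inactivity places it at or below \<open>- c / 2\<close>.\<close>
    have lp_off: "lp $ i = 0" if i: "i \<notin> Act" for i
    proof (rule ccontr)
      assume "lp $ i \<noteq> 0"
      then have "cres \<mu> z l d lp i = 0" using comp(2)[of i] by simp
      then have eq: "g z $ i + grad_comp g i z \<bullet> d = \<mu> * lp $ i - \<mu> * l $ i"
        by (simp add: cres_def lcon_def algebra_simps)
      have "l $ i \<le> \<delta>" using component_le_norm_cart[of "l - ls" i] ls(3) S_zero[OF ls(1) i] by simp
      moreover have "\<mu> * l $ i \<le> 1 * l $ i" using \<mu>1' l_i by (intro mult_right_mono) auto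
      moreover have "0 \<le> \<mu> * lp $ i" using \<mu> lp_i by simp
      ultimately have "- (c / 4) \<le> g z $ i + grad_comp g i z \<bullet> d"
        using eq \<delta> \<delta>s by linarith
      moreover have "g z $ i + grad_comp g i z \<bullet> d \<le> - c + c / 4 + c / 4"
        using gd[of i] gz[of i] Ks c(2)[OF i] unfolding abs_le_iff by linarith
      ultimately show False using c(1) by simp
    qed
    have nH: "norm (H z l) \<le> K2" unfolding K2_def by (rule norm_H_near_le[OF zb nl])
    have Hd: "norm (H z l *v d) \<le> K2 * norm d"
      using norm_matrix_vector_mult_le[of "H z l" d] mult_right_mono[OF nH, of "norm d"] by simp
    have gGlp: "grad \<phi> z + G z lp = - (H z l *v d)"
      using stat by (simp add: eq_neg_iff_add_eq_0 add_ac)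
    have nlp: "norm lp \<le> R1"
    proof -
      have "norm lp \<le> Q * (1 + norm (grad \<phi> z + G z lp))"
        using ls \<delta> \<delta>s s lp_off by (intro mb lp0) auto
      also have "\<dots> \<le> R1" unfolding R1_def
      proof (intro mult_left_mono add_left_mono)
        have "K2 * norm d \<le> K2 * 1" using d \<rho>s K2 by (intro mult_left_mono) auto
        then show "norm (grad \<phi> z + G z lp) \<le> K2" using Hd by (simp add: gGlp)
      qed (use Q in auto)
      finally show ?thesis .
    qed
    define D where "D = z + d - zs"
    define \<nu> where "\<nu> = lp - ls"
    define n where "n = norm \<nu>"
    define x where "x = z - zs"
    have dD: "d = D - x" by (simp add: D_def x_def)
    have x: "norm x \<le> \<delta>" using ls by (simp add: x_def)
    define rr where "rr = (\<chi> i. cres \<mu> z l d lp i)"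
    \<comment> \<open>As in the error bound, \<open>E\<close> closes the linearised equation, now
      with weight \<mu> and slack \<open>cres\<close>. It consists of the multiplier error of
      \<open>l\<close> with weight \<mu>, the change of the constraint gradients and a second-order
      remainder.\<close>
    define E where "E = (\<chi> i. if i \<in> Act then \<mu> * \<nu> $ i + rr $ i - A i \<bullet> D else 0)"
    have \<delta>2: "\<delta> * \<delta> \<le> \<kappa> * \<mu> * \<delta>" using \<delta> by (intro mult_right_mono) auto
    have Ei: "\<bar>E $ i\<bar> \<le> (1 + K * \<kappa> + K) * (\<mu> * \<delta> + \<delta> * norm D)" for i
    proof (cases "i \<in> Act")
      case False
      then show ?thesis using K \<kappa> \<delta> \<mu> by (simp add: E_def)
    next
      case True
      have "E $ i = \<mu> * (l - ls) $ i + (grad_comp g i z - A i) \<bullet> D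
          - (g zs $ i - g z $ i - grad_comp g i z \<bullet> (zs - z))"
        using True by (simp add: E_def rr_def cres_def lcon_def active_def \<nu>_def dD x_def inner_diff_left inner_diff_right algebra_simps)
      moreover have "\<bar>\<mu> * (l - ls) $ i\<bar> \<le> \<mu> * \<delta>"
        using component_le_norm_cart[of "l - ls" i] ls(3) \<mu> by (simp add: abs_mult mult_left_mono)
      moreover have "\<bar>(grad_comp g i z - A i) \<bullet> D\<bar> \<le> K * \<delta> * norm D"
      proof -
        have "\<bar>(grad_comp g i z - A i) \<bullet> D\<bar> \<le> norm (grad_comp g i z - A i) * norm D"
          by (rule Cauchy_Schwarz_ineq2)
        also have "\<dots> \<le> K * norm (z - zs) * norm D"
          by (intro mult_right_mono norm_grad_comp_diff_le zs_in_ball zb) auto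
        also have "\<dots> \<le> K * \<delta> * norm D" using ls K by (intro mult_right_mono mult_left_mono) auto
        finally show ?thesis .
      qed
      moreover have "\<bar>g zs $ i - g z $ i - grad_comp g i z \<bullet> (zs - z)\<bar> \<le> K * \<kappa> * (\<mu> * \<delta>)"
      proof -
        have "\<bar>g zs $ i - g z $ i - grad_comp g i z \<bullet> (zs - z)\<bar> \<le> K * (norm (zs - z))\<^sup>2"
          by (rule constraint_taylor[OF zb zs_in_ball])
        also have "\<dots> \<le> K * \<delta>\<^sup>2" using ls K by (intro mult_left_mono power_mono) (auto simp: norm_minus_commute)
        also have "\<dots> \<le> K * (\<kappa> * \<mu> * \<delta>)" using \<delta>2 K by (intro mult_left_mono) (auto simp: power2_eq_square)
        finally show ?thesis by (simp add: mult_ac)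
      qed
      ultimately have "\<bar>E $ i\<bar> \<le> \<mu> * \<delta> + K * \<delta> * norm D + K * \<kappa> * (\<mu> * \<delta>)" by linarith
      also have "\<dots> \<le> (1 + K * \<kappa> + K) * (\<mu> * \<delta> + \<delta> * norm D)"
      proof -
        have "0 \<le> K * (\<mu> * \<delta>)" "0 \<le> (1 + K * \<kappa>) * (\<delta> * norm D)" using K \<mu> \<delta> \<kappa> by auto
        then show ?thesis by (simp add: algebra_simps)
      qed
      finally show ?thesis .
    qed
    have nE: "norm E \<le> P * (\<mu> * \<delta> + \<delta> * norm D)"
    proof -
      have "norm E \<le> m * ((1 + K * \<kappa> + K) * (\<mu> * \<delta> + \<delta> * norm D))"
        unfolding m_def by (rule norm_vec_le_card) (rule Ei)
      also have "\<dots> = (m * (1 + K * \<kappa> + K)) * (\<mu> * \<delta> + \<delta> * norm D)" by (simp only: mult.assoc)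
      also have "\<dots> \<le> P * (\<mu> * \<delta> + \<delta> * norm D)"
        by (rule mult_right_mono[OF P(2)]) (use \<mu> \<delta> in auto)
      finally show ?thesis .
    qed
    define E1 where "E1 = H zs ls *v D + G zs \<nu>"
    have HD: "norm (H z l *v y - H zs ls *v y) \<le> K2 * \<delta> * norm y" for y
    proof -
      have "norm (H z l *v y - H zs ls *v y) \<le> K * ((1 + norm ls) * norm (z - zs) + norm (l - ls)) * norm y"
        by (rule norm_H_mult_diff_le[OF zs_in_ball zb])
      also have "\<dots> \<le> K * ((1 + R) * \<delta> + \<delta>) * norm y"
        using ls R K \<delta> by (intro mult_right_mono mult_left_mono add_mono mult_mono) auto
      finally show ?thesis by (simp add: K2_def algebra_simps)
    qed
    have nE1: "norm E1 \<le> P * (\<delta> * norm D + \<delta> * n + \<delta>\<^sup>2)"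
    proof -
      have "grad \<phi> zs = - G zs ls" using minus_unique[OF S_stationary[OF ls(1)], symmetric] by simp
      moreover have "grad \<phi> z = - (H z l *v D) + H z l *v x - G z lp"
        using stat by (simp add: dD matrix_vector_mult_diff_distrib algebra_simps eq_neg_iff_add_eq_0)
      \<comment> \<open>The stationarity of the subproblem is compared with that at
        \<open>(zs, ls)\<close>. Each of the four differences carries a factor \<delta> besides
        \<open>norm D\<close>, \<open>n\<close> or a second \<delta>.\<close>
      ultimately have E1eq: "E1 = - (H z l *v D - H zs ls *v D) - (G z \<nu> - G zs \<nu>)
          - (grad \<phi> z + G z ls - (grad \<phi> zs + G zs ls) - H zs ls *v x) + (H z l *v x - H zs ls *v x)"
        by (simp add: E1_def \<nu>_def lin_comb_diff)
      have "norm (H z l *v D - H zs ls *v D) \<le> K2 * \<delta> * norm D" by (rule HD)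
      moreover have "norm (H z l *v x - H zs ls *v x) \<le> K2 * \<delta>\<^sup>2"
      proof -
        have "K2 * \<delta> * norm x \<le> K2 * \<delta> * \<delta>" using x K2 \<delta> by (intro mult_left_mono) auto
        then show ?thesis using HD[of x] by (simp add: power2_eq_square)
      qed
      moreover have "norm (G z \<nu> - G zs \<nu>) \<le> K2 * (\<delta> * n)"
      proof -
        have "norm (G z \<nu> - G zs \<nu>) \<le> K * norm (z - zs) * norm \<nu>"
          by (rule norm_lin_comb_diff_le[OF zs_in_ball zb])
        also have "\<dots> \<le> K2 * \<delta> * n" using ls K K2 \<delta> by (auto simp: n_def intro!: mult_right_mono mult_mono)
        finally show ?thesis by simp
      qed
      moreover have "norm (grad \<phi> z + G z ls - (grad \<phi> zs + G zs ls) - H zs ls *v x) \<le> K2 * \<delta>\<^sup>2"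
      proof -
        have "norm (grad \<phi> z + G z ls - (grad \<phi> zs + G zs ls) - H zs ls *v x) \<le> K * (1 + norm ls) * (norm x)\<^sup>2"
          unfolding x_def by (rule grad_lagrangian_taylor[OF zs_in_ball zb])
        also have "\<dots> \<le> K2 * \<delta>\<^sup>2"
        proof (rule mult_mono)
          have "K * (1 + norm ls) \<le> K * (1 + R)" using R(2)[OF ls(1)] K by (intro mult_left_mono) auto
          then show "K * (1 + norm ls) \<le> K2" using K2 by simp
          show "(norm x)\<^sup>2 \<le> \<delta>\<^sup>2" using x by (intro power_mono) auto
        qed (use K2 in auto)
        finally show ?thesis .
      qed
      ultimately have "norm E1 \<le> K2 * \<delta> * norm D + K2 * (\<delta> * n) + K2 * \<delta>\<^sup>2 + K2 * \<delta>\<^sup>2"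
        using norm_four_le[OF E1eq]
        by linarith
      also have "\<dots> \<le> 2 * K2 * (\<delta> * norm D + \<delta> * n + \<delta>\<^sup>2)"
      proof -
        have "0 \<le> K2 * (\<delta> * norm D)" "0 \<le> K2 * (\<delta> * n)" using K2 \<delta> by (auto simp: n_def)
        then show ?thesis by (simp add: algebra_simps)
      qed
      also have "\<dots> \<le> P * (\<delta> * norm D + \<delta> * n + \<delta>\<^sup>2)"
        by (rule mult_right_mono[OF P(3)]) (use \<delta> in \<open>auto simp: n_def\<close>)
      finally show ?thesis .
    qed
    have "a * (norm D)\<^sup>2 + \<mu> / 2 * (norm (lp - ls))\<^sup>2 \<le>
       norm (H zs ls *v D + G zs (lp - ls)) * norm D + norm (lp - ls) * norm E + C5 * (norm E)\<^sup>2"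
    proof (rule core[OF ls(1) ls(1) lp0 _ \<mu>(1) \<mu>1'(2)])
      show "\<forall>i. i \<notin> Act \<longrightarrow> lp $ i = 0" using lp_off by blast
      show "\<forall>i\<in>Act. A i \<bullet> D = \<mu> * (lp - ls) $ i + rr $ i - E $ i" by (simp add: E_def \<nu>_def)
      show "\<forall>i\<in>Act. - \<theta> \<le> rr $ i \<and> rr $ i \<le> 0 \<and> lp $ i * rr $ i = 0"
      proof
        fix i assume i: "i \<in> Act"
        have "\<mu> * (lp $ i - l $ i) \<le> \<theta> / 3"
        proof -
          have "lp $ i - l $ i \<le> Rn"
            using component_le_norm_cart[of lp i] nlp l_i[of i] R by (simp add: Rn_def)
          then have "\<mu> * (lp $ i - l $ i) \<le> \<mu> * Rn" using \<mu> by (intro mult_left_mono) auto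
          also have "\<dots> \<le> \<mu>1 * Rn" using \<mu> Rn by (intro mult_right_mono) auto
          finally show ?thesis using Ks by simp
        qed
        then have "- \<theta> \<le> rr $ i"
          using gd[of i] gz[of i] i Ks unfolding rr_def cres_def lcon_def active_def abs_le_iff by simp
        then show "- \<theta> \<le> rr $ i \<and> rr $ i \<le> 0 \<and> lp $ i * rr $ i = 0"
          using comp by (simp add: rr_def)
      qed
    qed
    then have "a * (norm D)\<^sup>2 + \<mu> / 2 * n\<^sup>2 \<le> norm E1 * norm D + n * norm E + C5 * (norm E)\<^sup>2"
      by (simp add: E1_def n_def \<nu>_def)
    also have "\<dots> \<le> P * (\<delta> * norm D + \<delta> * n + \<delta>\<^sup>2) * norm D + n * (P * (\<mu> * \<delta> + \<delta> * norm D))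
        + C5 * (P * (\<mu> * \<delta> + \<delta> * norm D))\<^sup>2"
    proof -
      have "norm E1 * norm D \<le> P * (\<delta> * norm D + \<delta> * n + \<delta>\<^sup>2) * norm D"
        by (rule mult_right_mono[OF nE1]) simp
      moreover have "n * norm E \<le> n * (P * (\<mu> * \<delta> + \<delta> * norm D))"
        by (rule mult_left_mono[OF nE]) (simp add: n_def)
      moreover have "C5 * (norm E)\<^sup>2 \<le> C5 * (P * (\<mu> * \<delta> + \<delta> * norm D))\<^sup>2"
        using nE C5 by (intro mult_left_mono power_mono) auto
      ultimately show ?thesis by linarith
    qed
    finally have Dn: "norm D \<le> Ca * \<delta> \<and> (\<mu> > 0 \<longrightarrow> n \<le> Ca * \<delta>)"
      using \<delta> \<delta>s \<mu> \<mu>1' by (intro absorb) (auto simp: n_def)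
    have d1: "norm d \<le> C1 * \<delta>"
      using norm_triangle_ineq4[of D x] Dn x by (simp add: dD C1_def distrib_right)
    have lpl: "norm (lp - l) \<le> C1 * \<delta>" if "\<mu> > 0"
      using norm_triangle_ineq4[of \<nu> "l - ls"] Dn ls that by (simp add: \<nu>_def n_def C1_def distrib_right)
    have \<delta>\<delta>: "C1 * \<delta> * (C1 * \<delta>) \<le> C1\<^sup>2 * \<kappa> * (\<mu> * \<delta>)"
    proof -
      have "C1\<^sup>2 * (\<delta> * \<delta>) \<le> C1\<^sup>2 * (\<kappa> * \<mu> * \<delta>)" using \<delta>2 by (intro mult_left_mono) auto
      then show ?thesis by (simp add: power2_eq_square mult_ac)
    qed
    have dd: "(norm d)\<^sup>2 \<le> C1\<^sup>2 * \<kappa> * (\<mu> * \<delta>)"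
    proof -
      have "(norm d)\<^sup>2 \<le> (C1 * \<delta>)\<^sup>2" using d1 by (intro power_mono) auto
      then show ?thesis using \<delta>\<delta> by (simp add: power2_eq_square)
    qed
    have ld: "norm (lp - l) * norm d \<le> C1\<^sup>2 * \<kappa> * (\<mu> * \<delta>)"
    proof (cases "\<mu> > 0")
      case True
      have "norm (lp - l) * norm d \<le> C1 * \<delta> * (C1 * \<delta>)"
        using lpl[OF True] d1 C1 \<delta> by (intro mult_mono) auto
      then show ?thesis using \<delta>\<delta> by simp
    next
      \<comment> \<open>For \<open>\<mu> = 0\<close> the point is already a solution: \<delta> \<le>
        \<kappa> \<mu> gives \<open>\<delta> = 0\<close>, and the estimate for \<open>d\<close>
        gives \<open>d = 0\<close>.\<close>
      case False
      then have "\<delta> = 0" using \<mu> \<delta> by simp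
      then show ?thesis using d1 by simp
    qed
    have \<mu>l: "\<mu> * norm (lp - l) \<le> C1 * (\<mu> * \<delta>)"
    proof (cases "\<mu> > 0")
      case True
      then show ?thesis using mult_left_mono[OF lpl[OF True] \<mu>(1)] by (simp add: mult_ac)
    qed (use \<mu> in simp)
    \<comment> \<open>The equations of the subproblem are those of the new point up to Taylor
      remainders, the change of the Hessian from \<open>l\<close> to \<open>lp\<close> and the
      stabilisation term \<open>\<mu> * (lp - l)\<close>; each of these is of order
      \<open>\<mu> * \<delta>\<close>.\<close>
    have eta_new: "eta0 (z + d) lp \<le> (K * (1 + R1) * (C1\<^sup>2 * \<kappa> * (\<mu> * \<delta>)) + K * (C1\<^sup>2 * \<kappa> * (\<mu> * \<delta>)))
        + real CARD('m) * (C1 * (\<mu> * \<delta>) + K * (C1\<^sup>2 * \<kappa> * (\<mu> * \<delta>)))"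
    proof (rule eta_leI[OF zdb])
      have "grad \<phi> (z + d) + G (z + d) lp =
          (grad \<phi> (z + d) + G (z + d) lp - (grad \<phi> z + G z lp) - H z lp *v (z + d - z)) + (H z lp *v d - H z l *v d)"
        using gGlp by simp
      also have "norm \<dots> \<le> K * (1 + norm lp) * (norm (z + d - z))\<^sup>2 + K * ((1 + norm l) * norm (z - z) + norm (lp - l)) * norm d"
        by (intro norm_triangle_mono grad_lagrangian_taylor norm_H_mult_diff_le zb zdb)
      also have "\<dots> = K * (1 + norm lp) * (norm d)\<^sup>2 + K * (norm (lp - l) * norm d)" by simp
      also have "\<dots> \<le> K * (1 + R1) * (C1\<^sup>2 * \<kappa> * (\<mu> * \<delta>)) + K * (C1\<^sup>2 * \<kappa> * (\<mu> * \<delta>))"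
      proof (rule add_mono)
        have "K * (1 + norm lp) \<le> K * (1 + R1)" using nlp K by (intro mult_left_mono) auto
        then show "K * (1 + norm lp) * (norm d)\<^sup>2 \<le> K * (1 + R1) * (C1\<^sup>2 * \<kappa> * (\<mu> * \<delta>))"
          by (rule mult_mono[OF _ dd]) (use K R1 in auto)
        show "K * (norm (lp - l) * norm d) \<le> K * (C1\<^sup>2 * \<kappa> * (\<mu> * \<delta>))" using ld K by (intro mult_left_mono)
      qed
      finally show "norm (grad \<phi> (z + d) + G (z + d) lp) \<le> K * (1 + R1) * (C1\<^sup>2 * \<kappa> * (\<mu> * \<delta>)) + K * (C1\<^sup>2 * \<kappa> * (\<mu> * \<delta>))" .
      fix i
      have "\<bar>g (z + d) $ i - g z $ i - grad_comp g i z \<bullet> d\<bar> \<le> K * (norm d)\<^sup>2"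
        using constraint_taylor[OF zb zdb, of i] by simp
      also have "\<dots> \<le> K * (C1\<^sup>2 * \<kappa> * (\<mu> * \<delta>))" using dd K by (intro mult_left_mono)
      finally have 1: "\<bar>g (z + d) $ i - lcon z d i\<bar> \<le> K * (C1\<^sup>2 * \<kappa> * (\<mu> * \<delta>))" by (simp add: lcon_def algebra_simps)
      have "\<bar>\<mu> * (lp $ i - l $ i)\<bar> \<le> \<mu> * norm (lp - l)"
        using component_le_norm_cart[of "lp - l" i] \<mu> by (simp add: abs_mult mult_left_mono)
      then have 2: "\<bar>cres \<mu> z l d lp i - lcon z d i\<bar> \<le> C1 * (\<mu> * \<delta>)" using \<mu>l by (simp add: cres_def)
      \<comment> \<open>Complementarity as a vanishing minimum: the residual component differs from
        it only in the second argument, and \<open>min\<close> is 1-Lipschitz.\<close>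
      have 3: "min (lp $ i) (- cres \<mu> z l d lp i) = 0"
        using comp(1)[of i] comp(2)[of i] lp_i[of i] by (auto simp: min_def)
      show "\<bar>min (lp $ i) (- (g (z + d) $ i))\<bar> \<le> C1 * (\<mu> * \<delta>) + K * (C1\<^sup>2 * \<kappa> * (\<mu> * \<delta>))"
        using 1 2 3 lp_i[of i] by (auto simp: min_def abs_le_iff split: if_splits)
    qed
    have "eta0 (z + d) lp \<le> C3 * (\<mu> * \<delta>)"
      using eta_new by (simp add: C3_def m_def algebra_simps)
    moreover have "dS (z + d) lp \<le> C4 * \<delta>"
    proof -
      obtain l' where l': "l' \<in> S" "norm (lp - l') \<le> CH * norm (grad \<phi> zs + G zs lp)"
        using hoff[OF lp0] lp_off by blast
      have "norm (grad \<phi> zs + G zs lp) \<le> K2 * C1 * \<delta> + K * (1 + R1) * \<delta>"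
      proof -
        have "grad \<phi> zs + G zs lp = (grad \<phi> z + G z lp) - (grad \<phi> z + G z lp - (grad \<phi> zs + G zs lp))" by simp
        also have "norm \<dots> \<le> norm (grad \<phi> z + G z lp) + norm (grad \<phi> z + G z lp - (grad \<phi> zs + G zs lp))"
          by (rule norm_triangle_ineq4)
        also have "norm (grad \<phi> z + G z lp) \<le> K2 * C1 * \<delta>"
          using Hd mult_left_mono[OF d1 K2(3)] by (simp add: gGlp)
        also have "norm (grad \<phi> z + G z lp - (grad \<phi> zs + G zs lp)) \<le> K * (1 + norm lp) * norm (z - zs)"
          by (rule grad_lagrangian_lipschitz[OF zs_in_ball zb])
        also have "K * (1 + norm lp) * norm (z - zs) \<le> K * (1 + R1) * \<delta>"
        proof (rule mult_mono[OF _ ls(2)])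
          show "K * (1 + norm lp) \<le> K * (1 + R1)" using nlp K by (intro mult_left_mono) auto
        qed (use K R1 in auto)
        finally show ?thesis by simp
      qed
      then have "CH * norm (grad \<phi> zs + G zs lp) \<le> CH * ((K2 * C1 + K * (1 + R1)) * \<delta>)"
        using CH by (intro mult_left_mono) (auto simp: distrib_right)
      moreover have "dS (z + d) lp \<le> norm D + norm (lp - l')"
        using dist_sol_le[OF l'(1)] by (simp add: D_def)
      ultimately have "dS (z + d) lp \<le> Ca * \<delta> + CH * ((K2 * C1 + K * (1 + R1)) * \<delta>)"
        using Dn l' by linarith
      then show ?thesis by (simp add: C4_def algebra_simps)
    qed
    ultimately show ?thesis using d1 lpl by (simp add: \<delta>_def)
  qed
  define C where "C = C1 + C3 + C4"
  have C: "C > 0" "C1 \<le> C" "C3 \<le> C" "C4 \<le> C" using C1 C3 C4 by (auto simp: C_def)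
  have le: "x \<le> C' * y \<Longrightarrow> C' \<le> C \<Longrightarrow> 0 \<le> y \<Longrightarrow> x \<le> C * y" for x y C' :: real
    by (meson mult_right_mono order_trans)
  show ?thesis
  proof (rule exI[of _ \<rho>0], rule conjI[OF pos(1)], rule exI[of _ \<mu>1], rule conjI[OF pos(2)],
      rule exI[of _ \<delta>1], rule conjI[OF pos(3)], rule exI[of _ C], rule conjI[OF C(1)], intro allI impI)
    fix z l \<mu> d lp
    assume h: "0 \<le> l" "dS z l \<le> \<delta>1" "0 \<le> \<mu>" "\<mu> \<le> \<mu>1" "dS z l \<le> \<kappa> * \<mu>" "norm d \<le> \<rho>0" "ssqp_kkt \<mu> z l d lp"
    have m: "norm d \<le> C1 * dS z l" "\<mu> > 0 \<Longrightarrow> norm (lp - l) \<le> C1 * dS z l"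
      "eta0 (z + d) lp \<le> C3 * (\<mu> * dS z l)" "dS (z + d) lp \<le> C4 * dS z l"
      using main[OF h] by simp_all
    have nn: "0 \<le> dS z l" "0 \<le> \<mu> * dS z l" using h dist_sol_nonneg by auto
    show "norm d \<le> C * dS z l \<and> (\<mu> > 0 \<longrightarrow> norm (lp - l) \<le> C * dS z l) \<and>
       eta0 (z + d) lp \<le> C * (\<mu> * dS z l) \<and> dS (z + d) lp \<le> C * dS z l"
      using le[OF m(1) C(2) nn(1)] le[OF m(2) C(2) nn(1)] le[OF m(3) C(3) nn(2)] le[OF m(4) C(4) nn(1)]
      by simp
  qed
qed

text \<open>The test multiplier \<open>l' = lb + \<zeta> \<sigma>\<close> penalises the violation of each constraint of the critical
  cone. It is nonnegative because \<open>lb \<ge> \<zeta>\<close> on \<open>Pos\<close>, the only place where \<open>\<sigma>\<close> is negative.\<close>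

lemma quadratic_growth:
  "\<exists>r1>0. \<exists>a>0. \<exists>C>0. \<forall>z l \<mu> d. 0 \<le> l \<longrightarrow> 0 \<le> \<mu> \<longrightarrow> dS z l < r \<longrightarrow> norm (z + d - zs) \<le> r1 \<longrightarrow>
     (\<exists>l'\<ge>0. a * (norm (z + d - zs))\<^sup>2 - C * (dS z l + \<mu>) \<le> obj \<mu> z l d l')"
proof -
  obtain a0 C0 where a0: "a0 > 0" and C0: "C0 > 0"
    and coer: "\<And>l x. l \<in> S \<Longrightarrow> x \<bullet> (H zs l *v x) \<ge> a0 * (norm x)\<^sup>2 - C0 * viol x"
    using coercivity by blast
  obtain lb \<zeta> where lb: "lb \<in> S" and \<zeta>: "\<zeta> > 0" "\<And>i. i \<in> Pos \<Longrightarrow> \<zeta> \<le> lb $ i"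
    using strictly_positive_multiplier by blast
  define m where "m = real CARD('m)"
  have m: "m \<ge> 1" by (simp add: m_def)
  have K: "K \<ge> 1" "K \<ge> 0" using K_ge by auto
  define K2 where "K2 = K * (2 + R)"
  have K2: "K2 \<ge> 0" using K R by (simp add: K2_def)
  \<comment> \<open>A squared violation is at most \<open>K * r1\<close> times the violation itself,
    so the second bound lets the linear penalty \<open>\<zeta> * V\<close> dominate
    \<open>C0 / 2 * viol D\<close>.\<close>
  define r1 where "r1 = min 1 (2 * \<zeta> / (C0 * K))"
  have r1: "r1 > 0" "r1 \<le> 1" "C0 / 2 * (K * r1) \<le> \<zeta>"
  proof -
    show "r1 > 0" "r1 \<le> 1" using \<zeta>(1) C0 K by (auto simp: r1_def)
    have "r1 \<le> 2 * \<zeta> / (C0 * K)" by (simp add: r1_def)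
    then have "r1 * (C0 * K) \<le> 2 * \<zeta>" using C0 K by (simp add: pos_le_divide_eq)
    then show "C0 / 2 * (K * r1) \<le> \<zeta>" by (simp add: mult_ac)
  qed
  define RL where "RL = R + m * \<zeta>"
  have RL: "RL \<ge> 1" using R m \<zeta>(1) by (simp add: RL_def add_increasing2)
  define F0 where "F0 = norm (grad \<phi> zs) + K"
  have F0: "F0 \<ge> 0" using K by (simp add: F0_def)
  define C1 where "C1 = F0 + K + 2 * K2 + m * (RL * (3 * K))"
  define C2 where "C2 = (RL + R + 1)\<^sup>2"
  have "0 \<le> m * (RL * (3 * K))" using m RL K by simp
  then have C1: "C1 \<ge> 1" using F0 K K2 unfolding C1_def by linarith
  have C2: "C2 \<ge> 0" by (simp add: C2_def)
  have main: "\<exists>l'\<ge>0. a0 / 2 * (norm (z + d - zs))\<^sup>2 - (C1 + C2) * (dS z l + \<mu>) \<le> obj \<mu> z l d l'"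
    if l: "0 \<le> l" and \<mu>: "0 \<le> \<mu>" and \<delta>r: "dS z l < r" and Dr: "norm (z + d - zs) \<le> r1" for z l \<mu> d
  proof -
    define \<delta> where "\<delta> = dS z l"
    have \<delta>: "0 \<le> \<delta>" "\<delta> < r" "\<delta> \<le> 1" using dist_sol_nonneg \<delta>r r_le by (auto simp: \<delta>_def)
    obtain ls where ls: "ls \<in> S" "norm (z - zs) \<le> \<delta>" "norm (l - ls) \<le> \<delta>"
      and zb: "z \<in> ball zs r" and nl: "norm l \<le> R + 1"
      using near_solution[of z l] \<delta>(2) unfolding \<delta>_def by blast
    define D where "D = z + d - zs"
    define x where "x = z - zs"
    have dD: "d = D - x" by (simp add: D_def x_def)
    have x: "norm x \<le> \<delta>" using ls by (simp add: x_def)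
    have D: "norm D \<le> r1" "norm D \<le> 1" using Dr r1 by (auto simp: D_def)
    define \<sigma> where "\<sigma> i = (if i \<in> Act \<and> A i \<bullet> D > 0 then 1 else if i \<in> Pos \<and> A i \<bullet> D < 0 then - 1 else 0 :: real)" for i
    define l' where "l' = (\<chi> i. lb $ i + \<zeta> * \<sigma> i)"
    have l'0: "0 \<le> l'"
      using S_nonneg[OF lb] \<zeta> by (auto simp: l'_def \<sigma>_def less_eq_vec_def intro!: add_nonneg_nonneg)
    have l'off: "l' $ i = 0" if "i \<notin> Act" for i
      using that S_zero[OF lb] Pos_subset by (auto simp: l'_def \<sigma>_def)
    have l'lb: "norm (l' - lb) \<le> m * \<zeta>"
      unfolding m_def using \<zeta>(1) by (intro norm_vec_le_card) (auto simp: l'_def \<sigma>_def)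
    have l'n: "norm l' \<le> RL" using norm_triangle_sub[of l' lb] R(2)[OF lb] l'lb by (simp add: RL_def)
    define V where "V = (\<Sum>i\<in>Pos. \<bar>A i \<bullet> D\<bar>) + (\<Sum>i\<in>Zer. max 0 (A i \<bullet> D))"
    have sV: "(\<Sum>i\<in>UNIV. \<sigma> i * (A i \<bullet> D)) = V"
    proof -
      have "(\<Sum>i\<in>UNIV. \<sigma> i * (A i \<bullet> D)) = (\<Sum>i\<in>Act. \<sigma> i * (A i \<bullet> D))"
        using Pos_subset by (intro sum.mono_neutral_right) (auto simp: \<sigma>_def)
      also have "\<dots> = (\<Sum>i\<in>Pos. \<sigma> i * (A i \<bullet> D)) + (\<Sum>i\<in>Zer. \<sigma> i * (A i \<bullet> D))"
        unfolding Act_eq(1) using Act_eq(2) by (intro sum.union_disjoint) auto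
      also have "(\<Sum>i\<in>Pos. \<sigma> i * (A i \<bullet> D)) = (\<Sum>i\<in>Pos. \<bar>A i \<bullet> D\<bar>)"
        using Pos_subset by (intro sum.cong) (auto simp: \<sigma>_def)
      also have "(\<Sum>i\<in>Zer. \<sigma> i * (A i \<bullet> D)) = (\<Sum>i\<in>Zer. max 0 (A i \<bullet> D))"
        by (intro sum.cong) (auto simp: \<sigma>_def active_zero_def)
      finally show ?thesis by (simp add: V_def)
    qed
    have AD: "\<bar>A i \<bullet> D\<bar> \<le> K * r1" for i
    proof -
      have "\<bar>A i \<bullet> D\<bar> \<le> norm (A i) * norm D" by (rule Cauchy_Schwarz_ineq2)
      also have "\<dots> \<le> K * r1" using norm_grad_comp_le[OF zs_in_ball] D K by (intro mult_mono) auto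
      finally show ?thesis .
    qed
    have "viol D \<le> (\<Sum>i\<in>Pos. (K * r1) * \<bar>A i \<bullet> D\<bar>) + (\<Sum>i\<in>Zer. (K * r1) * max 0 (A i \<bullet> D))"
      unfolding viol_def
    proof (intro add_mono sum_mono)
      fix i
      have "\<bar>A i \<bullet> D\<bar> * \<bar>A i \<bullet> D\<bar> \<le> (K * r1) * \<bar>A i \<bullet> D\<bar>" by (rule mult_right_mono[OF AD]) simp
      then show 1: "(A i \<bullet> D)\<^sup>2 \<le> (K * r1) * \<bar>A i \<bullet> D\<bar>" by (simp add: power2_eq_square)
      show "(max 0 (A i \<bullet> D))\<^sup>2 \<le> (K * r1) * max 0 (A i \<bullet> D)" using 1 by (auto simp: max_def)
    qed
    also have "\<dots> = (K * r1) * V" by (simp add: V_def sum_distrib_left distrib_left)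
    finally have "C0 / 2 * viol D \<le> C0 / 2 * ((K * r1) * V)" using C0 by (intro mult_left_mono) auto
    also have "\<dots> = (C0 / 2 * (K * r1)) * V" by simp
    also have "\<dots> \<le> \<zeta> * V" by (rule mult_right_mono[OF r1(3)]) (simp add: V_def sum_nonneg)
    finally have viol: "C0 / 2 * viol D \<le> \<zeta> * V" .
    \<comment> \<open>The value of the model at \<open>zs\<close> for the multiplier
      \<open>l'\<close>: the first-order terms \<open>D \<bullet> grad \<phi> zs\<close> and
      \<open>G zs lb \<bullet> D\<close> cancel because \<open>lb \<in> S\<close>, leaving curvature
      and penalty.\<close>
    define W where "W = 1/2 * (D \<bullet> (H zs ls *v D)) + \<zeta> * V"
    have WD: "a0 / 2 * (norm D)\<^sup>2 \<le> W"
      using coer[OF ls(1), of D] viol unfolding W_def by simp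
    have W: "W = D \<bullet> grad \<phi> zs + 1/2 * (D \<bullet> (H zs ls *v D)) + (\<Sum>i\<in>UNIV. l' $ i * (A i \<bullet> D))"
    proof -
      have "(\<Sum>i\<in>UNIV. l' $ i * (A i \<bullet> D)) = G zs lb \<bullet> D + \<zeta> * V"
        by (simp add: l'_def lin_comb_inner distrib_right sum.distrib sum_distrib_left mult.assoc flip: sV)
      moreover have "G zs lb = - grad \<phi> zs" using minus_unique[OF S_stationary[OF lb]] by simp
      ultimately show ?thesis by (simp add: W_def inner_commute)
    qed
    have gz: "norm (grad \<phi> z - grad \<phi> zs) \<le> K * \<delta>"
      using norm_grad_obj_diff_le[OF zs_in_ball zb] mult_left_mono[OF ls(2) K(2)] by simp
    \<comment> \<open>\<open>e1\<close>, \<open>e2\<close>, \<open>e3\<close> pass from the model at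
      \<open>(zs, ls)\<close> to the one at \<open>(z, l)\<close> at a cost of order \<delta>, as
      \<open>norm D \<le> 1\<close>; \<open>e4\<close> bounds the cost of stabilisation by a
      multiple of \<mu>.\<close>
    have e1: "\<bar>d \<bullet> grad \<phi> z - D \<bullet> grad \<phi> zs\<bar> \<le> (F0 + K) * \<delta>"
    proof -
      have "norm (grad \<phi> z) \<le> F0"
      proof -
        have "K * \<delta> \<le> K * 1" using \<delta> K by (intro mult_left_mono) auto
        then show ?thesis using gz norm_triangle_sub[of "grad \<phi> z" "grad \<phi> zs"] by (simp add: F0_def)
      qed
      then have "\<bar>x \<bullet> grad \<phi> z\<bar> \<le> \<delta> * F0"
        using Cauchy_Schwarz_ineq2[of x "grad \<phi> z"] mult_mono[OF x, of "norm (grad \<phi> z)" F0] \<delta> by simp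
      moreover have "\<bar>D \<bullet> (grad \<phi> z - grad \<phi> zs)\<bar> \<le> 1 * (K * \<delta>)"
        using Cauchy_Schwarz_ineq2[of D "grad \<phi> z - grad \<phi> zs"] mult_mono[OF D(2) gz] by simp
      moreover have "d \<bullet> grad \<phi> z - D \<bullet> grad \<phi> zs = D \<bullet> (grad \<phi> z - grad \<phi> zs) - x \<bullet> grad \<phi> z"
        by (simp add: dD inner_diff_left inner_diff_right)
      ultimately show ?thesis by (simp add: algebra_simps abs_le_iff)
    qed
    have nH: "norm (H z l) \<le> K2" unfolding K2_def by (rule norm_H_near_le[OF zb nl])
    have bil: "\<bar>u \<bullet> (H z l *v v)\<bar> \<le> K2 * (norm u * norm v)" for u v
    proof -
      have "\<bar>u \<bullet> (H z l *v v)\<bar> \<le> norm u * norm (H z l *v v)" by (rule Cauchy_Schwarz_ineq2)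
      also have "\<dots> \<le> norm u * (K2 * norm v)"
        using norm_matrix_vector_mult_le[of "H z l" v] mult_right_mono[OF nH, of "norm v"]
        by (intro mult_left_mono) auto
      finally show ?thesis by (simp add: mult_ac)
    qed
    have e2: "\<bar>1/2 * (d \<bullet> (H z l *v d)) - 1/2 * (D \<bullet> (H zs ls *v D))\<bar> \<le> 2 * K2 * \<delta>"
    proof -
      have "d \<bullet> (H z l *v d) - D \<bullet> (H zs ls *v D) =
          D \<bullet> (H z l *v D - H zs ls *v D) - x \<bullet> (H z l *v D) - D \<bullet> (H z l *v x) + x \<bullet> (H z l *v x)"
        by (simp add: dD matrix_vector_mult_diff_distrib inner_diff_left inner_diff_right)
      moreover have "\<bar>D \<bullet> (H z l *v D - H zs ls *v D)\<bar> \<le> K2 * \<delta>"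
      proof -
        have "norm (H z l *v D - H zs ls *v D) \<le> K * ((1 + norm ls) * norm (z - zs) + norm (l - ls)) * norm D"
          by (rule norm_H_mult_diff_le[OF zs_in_ball zb])
        also have "\<dots> \<le> K * ((1 + R) * \<delta> + \<delta>) * 1"
          using ls R K \<delta> D by (intro mult_mono mult_left_mono add_mono) auto
        also have "\<dots> = K2 * \<delta>" by (simp add: K2_def algebra_simps)
        finally have "norm D * norm (H z l *v D - H zs ls *v D) \<le> 1 * (K2 * \<delta>)"
          using D by (intro mult_mono) auto
        then show ?thesis using Cauchy_Schwarz_ineq2[of D "H z l *v D - H zs ls *v D"] by simp
      qed
      moreover have "\<bar>x \<bullet> (H z l *v D)\<bar> \<le> K2 * \<delta>"
        using bil[of x D] mult_left_mono[OF mult_mono[OF x D(2)], of K2] K2 \<delta> by simp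
      moreover have "\<bar>D \<bullet> (H z l *v x)\<bar> \<le> K2 * \<delta>"
        using bil[of D x] mult_left_mono[OF mult_mono[OF D(2) x], of K2] K2 \<delta> by simp
      moreover have "\<bar>x \<bullet> (H z l *v x)\<bar> \<le> K2 * \<delta>"
        using bil[of x x] mult_left_mono[OF mult_mono[of "norm x" 1 "norm x" \<delta>], of K2] x K2 \<delta> by simp
      ultimately show ?thesis unfolding abs_le_iff by linarith
    qed
    have e3: "\<bar>(\<Sum>i\<in>UNIV. l' $ i * lcon z d i) - (\<Sum>i\<in>UNIV. l' $ i * (A i \<bullet> D))\<bar> \<le> m * (RL * (3 * K)) * \<delta>"
    proof -
      have t: "\<bar>l' $ i * lcon z d i - l' $ i * (A i \<bullet> D)\<bar> \<le> RL * (3 * K * \<delta>)" for i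
      proof (cases "i \<in> Act")
        case False
        then show ?thesis using l'off RL K \<delta> by simp
      next
        case True
        have "lcon z d i - A i \<bullet> D = (g z $ i - g zs $ i) + (grad_comp g i z - A i) \<bullet> D - grad_comp g i z \<bullet> x"
          using True by (simp add: lcon_def dD inner_diff_left inner_diff_right active_def)
        moreover have "\<bar>g z $ i - g zs $ i\<bar> \<le> K * \<delta>"
          using constraint_lipschitz[OF zs_in_ball zb, of i] mult_left_mono[OF ls(2) K(2)] by simp
        moreover have "\<bar>(grad_comp g i z - A i) \<bullet> D\<bar> \<le> K * \<delta>"
        proof -
          have "norm (grad_comp g i z - A i) \<le> K * \<delta>"
            using norm_grad_comp_diff_le[OF zs_in_ball zb, of i] mult_left_mono[OF ls(2) K(2)] by simp
          then have "norm (grad_comp g i z - A i) * norm D \<le> K * \<delta> * 1"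
            using D K \<delta> by (intro mult_mono) auto
          then show ?thesis using Cauchy_Schwarz_ineq2[of "grad_comp g i z - A i" D] by simp
        qed
        moreover have "\<bar>grad_comp g i z \<bullet> x\<bar> \<le> K * \<delta>"
        proof -
          have "norm (grad_comp g i z) * norm x \<le> K * \<delta>"
            using norm_grad_comp_le[OF zb] x K by (intro mult_mono) auto
          then show ?thesis using Cauchy_Schwarz_ineq2[of "grad_comp g i z" x] by simp
        qed
        ultimately have "\<bar>lcon z d i - A i \<bullet> D\<bar> \<le> 3 * K * \<delta>" by simp
        moreover have "\<bar>l' $ i\<bar> \<le> RL" using component_le_norm_cart[of l' i] l'n by simp
        ultimately have "\<bar>l' $ i\<bar> * \<bar>lcon z d i - A i \<bullet> D\<bar> \<le> RL * (3 * K * \<delta>)"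
          using RL by (intro mult_mono) auto
        then show ?thesis by (simp add: abs_mult flip: right_diff_distrib)
      qed
      have "\<bar>(\<Sum>i\<in>UNIV. l' $ i * lcon z d i - l' $ i * (A i \<bullet> D))\<bar> \<le> (\<Sum>i\<in>UNIV. \<bar>l' $ i * lcon z d i - l' $ i * (A i \<bullet> D)\<bar>)"
        by (rule sum_abs)
      also have "\<dots> \<le> (\<Sum>i\<in>(UNIV::'m set). RL * (3 * K * \<delta>))" by (intro sum_mono t)
      finally show ?thesis by (simp add: sum_subtractf m_def mult_ac)
    qed
    have e4: "(\<Sum>i\<in>UNIV. \<mu> / 2 * (l' $ i - l $ i)\<^sup>2) \<le> C2 * \<mu>"
    proof -
      have "(\<Sum>i\<in>UNIV. (l' $ i - l $ i)\<^sup>2) \<le> (norm (l' - l))\<^sup>2"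
        using sum_sq_le_norm[where I = UNIV and x = "l' - l"] by simp
      also have "\<dots> \<le> C2" unfolding C2_def using norm_triangle_ineq4[of l' l] l'n nl
        by (intro power_mono) auto
      finally have "\<mu> / 2 * (\<Sum>i\<in>UNIV. (l' $ i - l $ i)\<^sup>2) \<le> \<mu> / 2 * C2" using \<mu> by (intro mult_left_mono) auto
      moreover have "0 \<le> \<mu> * C2" using \<mu> C2 by simp
      ultimately have "\<mu> / 2 * (\<Sum>i\<in>UNIV. (l' $ i - l $ i)\<^sup>2) \<le> C2 * \<mu>" by (simp add: mult.commute)
      then show ?thesis by (simp only: sum_distrib_left)
    qed
    have "obj \<mu> z l d l' \<ge> W - ((F0 + K) * \<delta> + 2 * K2 * \<delta> + m * (RL * (3 * K)) * \<delta>) - C2 * \<mu>"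
      unfolding obj_eq sum_subtractf W using e1 e2 e3 e4 unfolding abs_le_iff by linarith
    also have "(F0 + K) * \<delta> + 2 * K2 * \<delta> + m * (RL * (3 * K)) * \<delta> = C1 * \<delta>"
      by (simp add: C1_def algebra_simps)
    finally have "obj \<mu> z l d l' \<ge> a0 / 2 * (norm D)\<^sup>2 - C1 * \<delta> - C2 * \<mu>" using WD by simp
    moreover have "0 \<le> C1 * \<mu>" "0 \<le> C2 * \<delta>" using C1 C2 \<mu> \<delta> by auto
    ultimately have "obj \<mu> z l d l' \<ge> a0 / 2 * (norm D)\<^sup>2 - (C1 + C2) * (\<delta> + \<mu>)"
      by (simp add: algebra_simps)
    then show ?thesis using l'0 by (auto simp: D_def \<delta>_def)
  qed
  show ?thesis
    by (rule exI[of _ r1], rule conjI[OF r1(1)], rule exI[of _ "a0/2"], rule conjI, use a0 in simp,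
        rule exI[of _ "C1 + C2"], rule conjI) (use C1 C2 main in auto)
qed

text \<open>At the step \<open>zs - z\<close> the linearised constraints exceed zero by at most
  \<open>K * \<delta>\<^sup>2\<close>, but \<open>l'\<close> is unbounded. The stabilisation term
  pays for it: Young's inequality leaves a multiple of
  \<open>(K * \<delta>\<^sup>2)\<^sup>2 / \<mu>\<close>, which is of order \<delta> because \<delta>
  \<le> \<kappa> \<mu>.\<close>

lemma obj_upper_at_solution:
  assumes \<kappa>: "\<kappa> > 0"
  shows "\<exists>C>0. \<forall>z l \<mu> l'. 0 \<le> l \<longrightarrow> 0 < \<mu> \<longrightarrow> dS z l < r \<longrightarrow> dS z l \<le> \<kappa> * \<mu> \<longrightarrow> 0 \<le> l' \<longrightarrow>
     obj \<mu> z l (zs - z) l' \<le> C * dS z l"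
proof -
  define m where "m = real CARD('m)"
  have m: "m \<ge> 1" by (simp add: m_def)
  have K: "K \<ge> 1" "K \<ge> 0" using K_ge by auto
  define K2 where "K2 = K * (2 + R)"
  have K2: "K2 \<ge> 0" using K R by (simp add: K2_def)
  define F0 where "F0 = norm (grad \<phi> zs) + K"
  have F0: "F0 \<ge> 1" using K by (simp add: F0_def add_increasing)
  define C where "C = F0 + K2 + m * ((R + 1) * K + K\<^sup>2 * \<kappa>)"
  have C: "C > 0" using F0 K2 m R K \<kappa> by (simp add: C_def add_pos_nonneg)
  have "obj \<mu> z l (zs - z) l' \<le> C * dS z l"
    if l: "0 \<le> l" and \<mu>: "0 < \<mu>" and \<delta>r: "dS z l < r" and \<delta>\<mu>: "dS z l \<le> \<kappa> * \<mu>" and l': "0 \<le> l'" for z l \<mu> l'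
  proof -
    define \<delta> where "\<delta> = dS z l"
    have \<delta>: "0 \<le> \<delta>" "\<delta> < r" "\<delta> \<le> 1" "\<delta> \<le> \<kappa> * \<mu>" using dist_sol_nonneg \<delta>r r_le \<delta>\<mu> by (auto simp: \<delta>_def)
    obtain ls where ls: "ls \<in> S" "norm (z - zs) \<le> \<delta>" "norm (l - ls) \<le> \<delta>"
      and zb: "z \<in> ball zs r" and nl: "norm l \<le> R + 1"
      using near_solution[of z l] \<delta>(2) unfolding \<delta>_def by blast
    define x where "x = zs - z"
    have x: "norm x \<le> \<delta>" using ls by (simp add: x_def norm_minus_commute)
    have \<delta>2: "\<delta>\<^sup>2 \<le> \<delta>" using \<delta> by (simp add: power2_eq_square mult_left_le)
    have e1: "x \<bullet> grad \<phi> z \<le> F0 * \<delta>"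
    proof -
      have "norm (grad \<phi> z - grad \<phi> zs) \<le> K * norm (z - zs)"
        by (rule norm_grad_obj_diff_le[OF zs_in_ball zb])
      also have "\<dots> \<le> K * 1" using ls \<delta> K by (intro mult_left_mono) auto
      finally have "norm (grad \<phi> z) \<le> F0"
        using norm_triangle_sub[of "grad \<phi> z" "grad \<phi> zs"] by (simp add: F0_def)
      then have "norm x * norm (grad \<phi> z) \<le> \<delta> * F0" using x \<delta> by (intro mult_mono) auto
      then show ?thesis using norm_cauchy_schwarz[of x "grad \<phi> z"] by (simp add: mult.commute)
    qed
    have e2: "1/2 * (x \<bullet> (H z l *v x)) \<le> K2 * \<delta>"
    proof -
      have nH: "norm (H z l) \<le> K2" unfolding K2_def by (rule norm_H_near_le[OF zb nl])
      have "x \<bullet> (H z l *v x) \<le> norm x * norm (H z l *v x)" by (rule norm_cauchy_schwarz)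
      also have "\<dots> \<le> norm x * (K2 * norm x)"
        using norm_matrix_vector_mult_le[of "H z l" x] mult_right_mono[OF nH, of "norm x"]
        by (intro mult_left_mono) auto
      also have "\<dots> \<le> \<delta> * (K2 * 1)"
        using x \<delta> K2 by (intro mult_mono) auto
      finally have "x \<bullet> (H z l *v x) \<le> K2 * \<delta>" by (simp add: mult.commute)
      moreover have "0 \<le> K2 * \<delta>" using K2 \<delta> by simp
      ultimately show ?thesis by simp
    qed
    have e3: "l' $ i * lcon z x i - \<mu> / 2 * (l' $ i - l $ i)\<^sup>2 \<le> ((R + 1) * K + K\<^sup>2 * \<kappa>) * \<delta>" for i
    proof -
      define y where "y = K * \<delta>\<^sup>2"
      define t where "t = l' $ i - l $ i"
      have "\<bar>g zs $ i - g z $ i - grad_comp g i z \<bullet> (zs - z)\<bar> \<le> K * (norm (zs - z))\<^sup>2"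
        by (rule constraint_taylor[OF zb zs_in_ball])
      also have "\<dots> \<le> K * \<delta>\<^sup>2" using x K by (intro mult_left_mono power_mono) (auto simp: x_def)
      finally have "lcon z x i \<le> y"
        using g_zs_le[of i] by (simp add: y_def lcon_def x_def abs_le_iff)
      then have "l' $ i * lcon z x i \<le> l' $ i * y"
        using l' by (intro mult_left_mono) (auto simp: less_eq_vec_def)
      also have "\<dots> = l $ i * y + t * y" by (simp add: t_def algebra_simps)
      also have "l $ i * y \<le> (R + 1) * K * \<delta>"
      proof -
        have "l $ i * y \<le> (R + 1) * (K * \<delta>)" unfolding y_def
          using component_le_norm_cart[of l i] nl K \<delta>2 l R by (intro mult_mono mult_left_mono) (auto simp: less_eq_vec_def)
        then show ?thesis by simp
      qed
      also have "t * y \<le> \<mu> / 2 * t\<^sup>2 + K\<^sup>2 * \<kappa> * \<delta>"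
      proof -
        have "0 \<le> (\<mu> * t - y)\<^sup>2" by simp
        then have "2 * \<mu> * (t * y) \<le> 2 * \<mu> * (\<mu> / 2 * t\<^sup>2) + y\<^sup>2" by (simp add: power2_eq_square algebra_simps)
        also have "y\<^sup>2 \<le> 2 * \<mu> * (K\<^sup>2 * \<kappa> * \<delta>)"
        proof -
          have "y\<^sup>2 = K\<^sup>2 * (\<delta>\<^sup>2 * \<delta>\<^sup>2)" by (simp add: y_def power2_eq_square)
          also have "\<dots> \<le> K\<^sup>2 * (\<delta> * \<delta>)" using \<delta>2 \<delta> by (intro mult_left_mono mult_mono) auto
          also have "\<dots> \<le> K\<^sup>2 * ((\<kappa> * \<mu>) * \<delta>)" using \<delta> by (intro mult_left_mono mult_right_mono) auto
          also have "\<dots> \<le> 2 * (K\<^sup>2 * ((\<kappa> * \<mu>) * \<delta>))" using \<kappa> \<mu> \<delta> by simp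
          finally show ?thesis by (simp add: mult_ac)
        qed
        finally have "2 * \<mu> * (t * y) \<le> 2 * \<mu> * (\<mu> / 2 * t\<^sup>2 + K\<^sup>2 * \<kappa> * \<delta>)" by (simp add: distrib_left)
        then show ?thesis using \<mu> by simp
      qed
      finally show ?thesis by (simp add: t_def algebra_simps)
    qed
    have "(\<Sum>i\<in>UNIV. l' $ i * lcon z x i - \<mu> / 2 * (l' $ i - l $ i)\<^sup>2) \<le> (\<Sum>i\<in>(UNIV::'m set). ((R + 1) * K + K\<^sup>2 * \<kappa>) * \<delta>)"
      by (intro sum_mono e3)
    also have "\<dots> = m * ((R + 1) * K + K\<^sup>2 * \<kappa>) * \<delta>" by (simp add: m_def)
    finally have "obj \<mu> z l x l' \<le> F0 * \<delta> + K2 * \<delta> + m * ((R + 1) * K + K\<^sup>2 * \<kappa>) * \<delta>"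
      unfolding obj_eq using e1 e2 by linarith
    then show ?thesis by (simp add: C_def x_def \<delta>_def algebra_simps)
  qed
  then show ?thesis using C by blast
qed

section \<open>The outer objective and existence of local solutions\<close>

text \<open>The unconstrained maximiser of each scalar problem, projected onto the nonnegative
  half-line; the optimality facts below assume \<open>0 < \<mu>\<close>.\<close>

definition "inner_maximizer \<mu> z l d = (\<chi> i. max 0 (l $ i + lcon z d i / \<mu>))"

lemma inner_maximizer_nonneg: "0 \<le> inner_maximizer \<mu> z l d"
  by (simp add: inner_maximizer_def less_eq_vec_def)

lemma inner_maximizer_cres:
  assumes "0 < \<mu>"
  shows "cres \<mu> z l d (inner_maximizer \<mu> z l d) i \<le> 0 \<and>
    inner_maximizer \<mu> z l d $ i * cres \<mu> z l d (inner_maximizer \<mu> z l d) i = 0"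
proof (cases "0 \<le> l $ i + lcon z d i / \<mu>")
  case True
  then show ?thesis using assms by (simp add: inner_maximizer_def cres_def max_def field_simps)
next
  case False
  then have "lcon z d i + \<mu> * l $ i < 0" using assms by (simp add: field_simps)
  then show ?thesis using False by (simp add: inner_maximizer_def cres_def max_def)
qed

lemma inner_maximizer_max:
  assumes "0 < \<mu>" "0 \<le> l'"
  shows "obj \<mu> z l d l' \<le> obj \<mu> z l d (inner_maximizer \<mu> z l d)"
  using inner_max_iff[of \<mu> "inner_maximizer \<mu> z l d" z l d] inner_maximizer_cres[OF assms(1)]
    inner_maximizer_nonneg assms by auto

lemma ssqp_outer_eq:
  assumes "0 < \<mu>"
  shows "ssqp_outer \<phi> g \<mu> z l d = ereal (obj \<mu> z l d (inner_maximizer \<mu> z l d))"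
  unfolding ssqp_outer_def
  by (rule antisym)
    (auto intro!: SUP_least SUP_upper2[of "inner_maximizer \<mu> z l d"]
      simp: inner_maximizer_nonneg inner_maximizer_max[OF assms])

lemma continuous_on_outer: "0 < \<mu> \<Longrightarrow> continuous_on X (\<lambda>d. obj \<mu> z l d (inner_maximizer \<mu> z l d))"
  unfolding obj_eq inner_maximizer_def lcon_def
  by (intro continuous_intros bounded_linear.continuous_on[OF matrix_vector_mul_bounded_linear]) auto

text \<open>The outer function lies above \<open>\<lambda>d'. obj \<mu> z l d' lp\<close> and touches it at \<open>d\<close>. This alone does not
  make \<open>d\<close> stationary for fixed \<open>lp\<close>; the quadratic bound from the other side does.\<close>

lemma outer_minimizer_stationary:
  assumes zb: "z \<in> ball zs r" and \<mu>: "0 < \<mu>" and e: "0 < e"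
    and min: "\<And>d'. d' \<in> ball d e \<Longrightarrow>
      obj \<mu> z l d (inner_maximizer \<mu> z l d) \<le> obj \<mu> z l d' (inner_maximizer \<mu> z l d')"
  shows "grad \<phi> z + H z l *v d + G z (inner_maximizer \<mu> z l d) = 0"
proof -
  define lp where "lp = inner_maximizer \<mu> z l d"
  define v where "v = grad \<phi> z + H z l *v d + G z lp"
  \<comment> \<open>Completing the square in the multiplier difference leaves
    \<open>y\<^sup>2 / (2 * \<mu>)\<close> per constraint, where \<open>y\<close> is the change of
    the linearised constraint and is at most \<open>K * norm (d' - d)\<close> in modulus.\<close>
  define Cq where "Cq = real CARD('m) * (K\<^sup>2 / (2 * \<mu>))"
  have upper: "obj \<mu> z l d' l' \<le> obj \<mu> z l d' lp + Cq * ((d' - d) \<bullet> (d' - d))" if l': "0 \<le> l'" for d' l'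
  proof -
    have t: "l' $ i * lcon z d' i - \<mu> / 2 * (l' $ i - l $ i)\<^sup>2
        \<le> (lp $ i * lcon z d' i - \<mu> / 2 * (lp $ i - l $ i)\<^sup>2) + K\<^sup>2 / (2 * \<mu>) * ((d' - d) \<bullet> (d' - d))" for i
    proof -
      define q where "q = cres \<mu> z l d lp i"
      define y where "y = lcon z d' i - lcon z d i"
      define s where "s = l' $ i - lp $ i"
      have q: "q \<le> 0" "lp $ i * q = 0"
        using inner_maximizer_cres[OF \<mu>, of z l d i] by (auto simp: q_def lp_def)
      have "l' $ i * q \<le> 0" using l' q by (simp add: less_eq_vec_def mult_nonneg_nonpos)
      then have sq: "s * q \<le> 0" unfolding s_def left_diff_distrib using q(2) by linarith
      have eq: "(l' $ i * lcon z d' i - \<mu> / 2 * (l' $ i - l $ i)\<^sup>2) - (lp $ i * lcon z d' i - \<mu> / 2 * (lp $ i - l $ i)\<^sup>2)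
          = s * y + s * q - \<mu> / 2 * s\<^sup>2"
        by (simp add: s_def y_def q_def cres_def power2_eq_square field_simps)
      have "0 \<le> (\<mu> * s - y)\<^sup>2" by simp
      then have "2 * \<mu> * (s * y) \<le> 2 * \<mu> * (\<mu> / 2 * s\<^sup>2) + y\<^sup>2" by (simp add: power2_eq_square algebra_simps)
      then have sy: "s * y - \<mu> / 2 * s\<^sup>2 \<le> y\<^sup>2 / (2 * \<mu>)" using \<mu> by (simp add: field_simps)
      have "y = grad_comp g i z \<bullet> (d' - d)" by (simp add: y_def lcon_def inner_diff_right)
      then have "\<bar>y\<bar> \<le> norm (grad_comp g i z) * norm (d' - d)" by (simp add: Cauchy_Schwarz_ineq2)
      also have "\<dots> \<le> K * norm (d' - d)" by (rule mult_right_mono[OF norm_grad_comp_le[OF zb]]) simp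
      finally have "\<bar>y\<bar>\<^sup>2 \<le> (K * norm (d' - d))\<^sup>2" by (rule power_mono) simp
      then have "y\<^sup>2 \<le> K\<^sup>2 * ((d' - d) \<bullet> (d' - d))" by (simp add: power_mult_distrib power2_norm_eq_inner)
      then have "y\<^sup>2 / (2 * \<mu>) \<le> K\<^sup>2 * ((d' - d) \<bullet> (d' - d)) / (2 * \<mu>)" using \<mu> by (intro divide_right_mono) auto
      then show ?thesis using eq sq sy by simp
    qed
    have "(\<Sum>i\<in>UNIV. l' $ i * lcon z d' i - \<mu> / 2 * (l' $ i - l $ i)\<^sup>2)
        \<le> (\<Sum>i\<in>UNIV. (lp $ i * lcon z d' i - \<mu> / 2 * (lp $ i - l $ i)\<^sup>2) + K\<^sup>2 / (2 * \<mu>) * ((d' - d) \<bullet> (d' - d)))"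
      by (intro sum_mono t)
    also have "\<dots> = (\<Sum>i\<in>UNIV. (lp $ i * lcon z d' i - \<mu> / 2 * (lp $ i - l $ i)\<^sup>2)) + Cq * ((d' - d) \<bullet> (d' - d))"
      by (subst sum.distrib) (simp add: Cq_def)
    finally show ?thesis unfolding obj_eq by linarith
  qed
  \<comment> \<open>A smooth majorant of the outer function that agrees with it at \<open>d\<close>.
    A local minimiser \<open>d\<close> of the outer function therefore minimises \<open>f\<close>
    locally, and the added quadratic has zero derivative at \<open>d\<close>.\<close>
  define f where "f d' = obj \<mu> z l d' lp + Cq * ((d' - d) \<bullet> (d' - d))" for d'
  have "(f has_derivative (\<lambda>h. h \<bullet> v + Cq * ((d - d) \<bullet> h + h \<bullet> (d - d)))) (at d)"
    unfolding f_def v_def using obj_gderiv[OF zb, of \<mu> l lp d, unfolded gderiv_def]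
    by (auto intro!: derivative_eq_intros)
  then have "(\<lambda>h. h \<bullet> v + Cq * ((d - d) \<bullet> h + h \<bullet> (d - d))) = (\<lambda>h. 0)"
  proof (rule differential_zero_maxmin[where S = "ball d e", rotated 2])
    have "f d \<le> f d'" if "d' \<in> ball d e" for d'
      using min[OF that] upper[OF inner_maximizer_nonneg[of \<mu> z l d'], of d'] by (simp add: f_def lp_def)
    then show "(\<forall>y\<in>ball d e. f y \<le> f d) \<or> (\<forall>y\<in>ball d e. f d \<le> f y)" by blast
  qed (use e in auto)
  then have "v \<bullet> v = 0" by (simp add: fun_eq_iff)
  then show ?thesis by (simp add: v_def lp_def)
qed

text \<open>The degenerate case in which the residual, and with it \<mu>, is zero: the outer
  objective may be infinite. \<open>quadratic_growth\<close> with zero distance and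
  \<open>\<mu> = 0\<close> still yields test multipliers showing that it is nonnegative nearby,
  while at the zero step it is at most 0.\<close>

lemma ssqp_solution_at_solution:
  assumes l: "l \<in> S"
  shows "ssqp_solution \<phi> g 0 zs l 0 l"
proof -
  have l0: "0 \<le> l" using l by (simp add: S_iff)
  have cr: "cres 0 zs l 0 l i \<le> 0 \<and> l $ i * cres 0 zs l 0 l i = 0" for i
    using g_zs_le[of i] S_zero[OF l, of i] by (cases "i \<in> Act") (auto simp: cres_def lcon_def active_def)
  then have max: "\<forall>l'\<ge>0. obj 0 zs l 0 l' \<le> obj 0 zs l 0 l"
    using inner_max_iff[of 0 l zs l 0] l0 by auto
  have "(\<Sum>i\<in>UNIV. l $ i * lcon zs 0 i) = 0"
    using cr by (intro sum.neutral) (simp add: cres_def)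
  then have obj0: "obj 0 zs l 0 l = 0" by (simp add: obj_eq)
  obtain r1 a C where r1: "r1 > 0" and a: "a > 0" and gr: "\<And>z l \<mu> d. 0 \<le> l \<Longrightarrow> 0 \<le> \<mu> \<Longrightarrow> dS z l < r \<Longrightarrow>
      norm (z + d - zs) \<le> r1 \<Longrightarrow> \<exists>l'\<ge>0. a * (norm (z + d - zs))\<^sup>2 - C * (dS z l + \<mu>) \<le> obj \<mu> z l d l'"
    using quadratic_growth by metis
  have dS0: "dS zs l = 0" unfolding dist_sol_def using l by simp
  have outer0: "ssqp_outer \<phi> g 0 zs l 0 \<le> 0"
    unfolding ssqp_outer_def using max obj0 by (intro SUP_least) auto
  have "ssqp_outer \<phi> g 0 zs l 0 \<le> ssqp_outer \<phi> g 0 zs l d'" if "d' \<in> ball 0 r1" for d'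
  proof -
    have "norm (zs + d' - zs) \<le> r1" using that by simp
    then have "\<exists>l'\<ge>0. a * (norm (zs + d' - zs))\<^sup>2 - C * (dS zs l + 0) \<le> obj 0 zs l d' l'"
      by (intro gr l0) (simp_all add: dS0 r_pos)
    then obtain l' where l': "l' \<ge> 0" "a * (norm (zs + d' - zs))\<^sup>2 - C * (dS zs l + 0) \<le> obj 0 zs l d' l'"
      by blast
    moreover have "0 \<le> a * (norm (zs + d' - zs))\<^sup>2" using a by simp
    ultimately have "0 \<le> obj 0 zs l d' l'" using dS0 by simp
    then have "0 \<le> ereal (obj 0 zs l d' l')" by simp
    also have "\<dots> \<le> ssqp_outer \<phi> g 0 zs l d'" unfolding ssqp_outer_def using l' by (intro SUP_upper) auto
    finally show ?thesis using outer0 by (rule order_trans[rotated])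
  qed
  moreover have "grad (\<lambda>d'. obj 0 zs l d' l) 0 = 0"
    using grad_eqI[OF obj_gderiv[OF zs_in_ball, of 0 l l 0]] S_stationary[OF l] by simp
  ultimately show ?thesis using max l0 r1 unfolding ssqp_solution_def is_arg_max_def by (auto simp: not_less)
qed

text \<open>For \<open>\<mu> > 0\<close> the outer function is minimised over a closed ball around
  \<open>zs - z\<close>. On the sphere \<open>quadratic_growth\<close> exceeds the bound from
  \<open>obj_upper_at_solution\<close> at the centre, so the minimiser is interior and hence a local
  solution. Its step is at most \<rho>0, so \<open>ssqp_estimate\<close> applies and sharpens this
  to the required \<rho>.\<close>

lemma ssqp_exists:
  assumes \<kappa>: "\<kappa> > 0" and \<rho>: "\<rho> > 0"
  shows "\<exists>\<mu>2>0. \<exists>\<delta>2>0. \<forall>z l \<mu>. 0 \<le> l \<longrightarrow> dS z l \<le> \<delta>2 \<longrightarrow> 0 \<le> \<mu> \<longrightarrow> \<mu> \<le> \<mu>2 \<longrightarrow> dS z l \<le> \<kappa> * \<mu> \<longrightarrow>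
     (\<exists>d lp. ssqp_solution \<phi> g \<mu> z l d lp \<and> norm (d, lp - l) \<le> \<rho>)"
proof -
  obtain \<rho>0 \<mu>1 \<delta>1 Ce where e: "\<rho>0 > 0" "\<mu>1 > 0" "\<delta>1 > 0" "Ce > 0"
    and est: "\<And>z l \<mu> d lp. 0 \<le> l \<Longrightarrow> dS z l \<le> \<delta>1 \<Longrightarrow> 0 \<le> \<mu> \<Longrightarrow> \<mu> \<le> \<mu>1 \<Longrightarrow>
     dS z l \<le> \<kappa> * \<mu> \<Longrightarrow> norm d \<le> \<rho>0 \<Longrightarrow> ssqp_kkt \<mu> z l d lp \<Longrightarrow>
     norm d \<le> Ce * dS z l \<and> (\<mu> > 0 \<longrightarrow> norm (lp - l) \<le> Ce * dS z l)"
    using ssqp_estimate[OF \<kappa>] by metis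
  obtain r1 a C where r1: "r1 > 0" and a: "a > 0" and C: "C > 0"
    and gr: "\<And>z l \<mu> d. 0 \<le> l \<Longrightarrow> 0 \<le> \<mu> \<Longrightarrow> dS z l < r \<Longrightarrow>
      norm (z + d - zs) \<le> r1 \<Longrightarrow> \<exists>l'\<ge>0. a * (norm (z + d - zs))\<^sup>2 - C * (dS z l + \<mu>) \<le> obj \<mu> z l d l'"
    using quadratic_growth by metis
  obtain C2 where C2: "C2 > 0" and up: "\<And>z l \<mu> l'. 0 \<le> l \<Longrightarrow> 0 < \<mu> \<Longrightarrow> dS z l < r \<Longrightarrow> dS z l \<le> \<kappa> * \<mu> \<Longrightarrow> 0 \<le> l' \<Longrightarrow>
     obj \<mu> z l (zs - z) l' \<le> C2 * dS z l"
    using obj_upper_at_solution[OF \<kappa>] by metis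
  define ra where "ra = min r1 (\<rho>0 / 2)"
  have ra: "ra > 0" "ra \<le> r1" "ra \<le> \<rho>0 / 2" using r1 e by (auto simp: ra_def)
  \<comment> \<open>\<mu>2 and the last entry of \<delta>2 use up a quarter of
    \<open>a * ra\<^sup>2\<close> each, so that growth prevails on the sphere.\<close>
  define \<mu>2 where "\<mu>2 = min \<mu>1 (a * ra\<^sup>2 / (4 * C))"
  define \<delta>2 where "\<delta>2 = Min {\<delta>1, r / 2, \<rho>0 / 2, \<rho> / (2 * Ce), a * ra\<^sup>2 / (4 * (C + C2))}"
  have "0 < a * ra\<^sup>2" using a ra by simp
  have pos1: "\<mu>2 > 0" using \<open>0 < a * ra\<^sup>2\<close> C e by (simp add: \<mu>2_def)
  have pos2: "\<delta>2 > 0"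
    unfolding \<delta>2_def using \<open>0 < a * ra\<^sup>2\<close> C C2 e r_pos \<rho> by (subst Min_gr_iff; simp)
  note pos = pos1 pos2
  have \<mu>s: "\<mu>2 \<le> \<mu>1" "\<mu>2 \<le> a * ra\<^sup>2 / (4 * C)" by (auto simp: \<mu>2_def)
  have \<delta>s: "\<delta>2 \<le> \<delta>1" "\<delta>2 \<le> r / 2" "\<delta>2 \<le> \<rho>0 / 2" "\<delta>2 \<le> \<rho> / (2 * Ce)" "\<delta>2 \<le> a * ra\<^sup>2 / (4 * (C + C2))"
    unfolding \<delta>2_def by (rule Min_le; simp)+
  have \<mu>C: "C * \<mu>2 \<le> a * ra\<^sup>2 / 4" using \<mu>s C by (simp add: field_simps)
  have \<delta>C: "(C + C2) * \<delta>2 \<le> a * ra\<^sup>2 / 4" using \<delta>s(5) C C2 by (simp add: field_simps add_pos_pos)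
  have \<delta>\<rho>: "2 * (Ce * \<delta>2) \<le> \<rho>" using \<delta>s(4) e by (simp add: field_simps)
  have main: "\<exists>d lp. ssqp_solution \<phi> g \<mu> z l d lp \<and> norm (d, lp - l) \<le> \<rho>"
    if l: "0 \<le> l" and \<delta>2: "dS z l \<le> \<delta>2" and \<mu>: "0 \<le> \<mu>" "\<mu> \<le> \<mu>2" and \<delta>\<mu>: "dS z l \<le> \<kappa> * \<mu>" for z l \<mu>
  proof (cases "\<mu> = 0")
    case True
    then have "dS z l \<le> 0" using \<delta>\<mu> by simp
    moreover obtain ls where ls: "ls \<in> S" "norm (z - zs) \<le> dS z l" "norm (l - ls) \<le> dS z l"
      using dist_sol_attained by blast
    ultimately have "norm (z - zs) \<le> 0" "norm (l - ls) \<le> 0" by linarith+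
    then have "z = zs" "l \<in> S" using ls(1) by simp_all
    then have "ssqp_solution \<phi> g \<mu> z l 0 l" using True ssqp_solution_at_solution by simp
    then show ?thesis using \<rho> by (intro exI[of _ 0] exI[of _ l]) (simp add: norm_Pair)
  next
    case False
    then have \<mu>0: "0 < \<mu>" using \<mu> by simp
    define \<delta> where "\<delta> = dS z l"
    have \<delta>: "0 \<le> \<delta>" "\<delta> \<le> \<delta>2" "\<delta> < r" "\<delta> \<le> \<kappa> * \<mu>"
      using dist_sol_nonneg \<delta>2 \<delta>s r_pos \<delta>\<mu> by (auto simp: \<delta>_def)
    obtain ls where ls: "ls \<in> S" "norm (z - zs) \<le> \<delta>" "norm (l - ls) \<le> \<delta>"
      using dist_sol_attained unfolding \<delta>_def by blast
    have zb: "z \<in> ball zs r" using ls \<delta> by (intro in_ball_zs) simp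
    define F where "F d = obj \<mu> z l d (inner_maximizer \<mu> z l d)" for d
    have "continuous_on (cball (zs - z) ra) F" unfolding F_def by (rule continuous_on_outer[OF \<mu>0])
    moreover have "cball (zs - z) ra \<noteq> {}" using ra by simp
    ultimately obtain d where d: "d \<in> cball (zs - z) ra" and dmin: "\<And>d'. d' \<in> cball (zs - z) ra \<Longrightarrow> F d \<le> F d'"
      using continuous_attains_inf[OF compact_cball] by metis
    have nD: "norm (z + d - zs) = dist (zs - z) d" by (simp add: dist_norm norm_minus_commute algebra_simps)
    have "norm (z + d - zs) \<noteq> ra"
    proof
      assume D: "norm (z + d - zs) = ra"
      obtain l' where l': "l' \<ge> 0" "a * (norm (z + d - zs))\<^sup>2 - C * (dS z l + \<mu>) \<le> obj \<mu> z l d l'"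
        using gr[OF l \<mu>(1), of z d] \<delta> D ra by (auto simp: \<delta>_def)
      note l'(2)
      also have "obj \<mu> z l d l' \<le> F d" unfolding F_def by (rule inner_maximizer_max[OF \<mu>0 l'(1)])
      also have "F d \<le> F (zs - z)" using ra by (intro dmin) simp
      also have "F (zs - z) \<le> C2 * dS z l"
        unfolding F_def using \<delta> by (intro up l \<mu>0 inner_maximizer_nonneg) (auto simp: \<delta>_def)
      finally have "a * ra\<^sup>2 - C * (\<delta> + \<mu>) \<le> C2 * \<delta>" by (simp add: D \<delta>_def)
      then have "a * ra\<^sup>2 \<le> (C + C2) * \<delta> + C * \<mu>" by (simp add: algebra_simps)
      also have "(C + C2) * \<delta> \<le> (C + C2) * \<delta>2" using \<delta> C C2 by (intro mult_left_mono) auto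
      also have "C * \<mu> \<le> C * \<mu>2" using \<mu> C by (intro mult_left_mono) auto
      finally show False using \<mu>C \<delta>C \<open>0 < a * ra\<^sup>2\<close> by simp
    qed
    then have "d \<in> ball (zs - z) ra" using d nD by simp
    then obtain e where e0: "e > 0" "ball d e \<subseteq> ball (zs - z) ra"
      using open_contains_ball_eq[OF open_ball[of "zs - z" ra]] by blast
    have lmin: "F d \<le> F d'" if "d' \<in> ball d e" for d'
      using that e0(2) dmin[of d'] by auto
    define lp where "lp = inner_maximizer \<mu> z l d"
    have stat: "grad \<phi> z + H z l *v d + G z lp = 0"
      unfolding lp_def by (rule outer_minimizer_stationary[OF zb \<mu>0 e0(1)]) (use lmin in \<open>simp add: F_def\<close>)
    have lp0: "0 \<le> lp" unfolding lp_def by (rule inner_maximizer_nonneg)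
    have "ssqp_solution \<phi> g \<mu> z l d lp"
      unfolding ssqp_solution_def
    proof (intro conjI)
      show "is_arg_max (obj \<mu> z l d) (\<lambda>l'. 0 \<le> l') lp"
        using lp0 inner_maximizer_max[OF \<mu>0] by (auto simp: is_arg_max_def lp_def not_less)
      show "\<exists>r>0. \<forall>d'\<in>ball d r. ssqp_outer \<phi> g \<mu> z l d \<le> ssqp_outer \<phi> g \<mu> z l d'"
        using e0(1) lmin unfolding ssqp_outer_eq[OF \<mu>0] by (auto simp: F_def intro!: exI[of _ e])
      show "grad (\<lambda>d'. obj \<mu> z l d' lp) d = 0"
        using grad_eqI[OF obj_gderiv[OF zb, of \<mu> l lp d]] stat by simp
    qed
    moreover have "norm (d, lp - l) \<le> \<rho>"
    proof -
      have kkt: "ssqp_kkt \<mu> z l d lp"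
        unfolding ssqp_kkt_def using lp0 stat inner_maximizer_cres[OF \<mu>0] by (auto simp: lp_def)
      have "norm d \<le> norm (z + d - zs) + norm (z - zs)"
        using norm_triangle_ineq4[of "z + d - zs" "z - zs"] by simp
      then have "norm d \<le> \<rho>0" using d nD ls \<delta> \<delta>s ra by simp
      then have "norm d \<le> Ce * dS z l" "norm (lp - l) \<le> Ce * dS z l"
        using est[OF l _ \<mu>(1) _ _ _ kkt] \<mu>0 \<mu> \<mu>s \<delta> \<delta>s by (auto simp: \<delta>_def)
      moreover have "Ce * dS z l \<le> Ce * \<delta>2" using \<delta>2 e by (intro mult_left_mono) auto
      moreover have "norm (d, lp - l) \<le> norm d + norm (lp - l)"
        by (simp add: norm_Pair sqrt_sum_squares_le_sum)
      ultimately show ?thesis using \<delta>\<rho> by linarith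
    qed
    ultimately show ?thesis by blast
  qed
  show ?thesis
    by (rule exI[of _ \<mu>2], rule conjI[OF pos1], rule exI[of _ \<delta>2], rule conjI[OF pos2], intro allI impI)
      (rule main)
qed

section \<open>Multiplier adjustment and convergence\<close>

lemma lp_feasible_iff:
  "lp_feasible \<phi> g \<tau> z l I lt \<longleftrightarrow> (\<forall>j. \<bar>(grad \<phi> z + G z lt) $ j\<bar> \<le> eta0 z l powr \<tau>) \<and>
     0 \<le> lt \<and> (\<forall>i. i \<notin> I \<longrightarrow> lt $ i = 0)"
proof (cases "\<forall>i. i \<notin> I \<longrightarrow> lt $ i = 0")
  case True
  then have "(\<Sum>i\<in>I. lt $ i *\<^sub>R grad_comp g i z) = G z lt" by (intro lin_comb_on) auto
  moreover have "(\<forall>i\<in>I. 0 \<le> lt $ i) \<longleftrightarrow> 0 \<le> lt"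
    using True unfolding less_eq_vec_def by (metis order_refl zero_index)
  moreover have "\<bar>x\<bar> \<le> t \<longleftrightarrow> - t \<le> x \<and> x \<le> t" for x t :: real by linarith
  ultimately show ?thesis using True
    by (auto simp: lp_feasible_def less_eq_vec_def vec_def)
qed (auto simp: lp_feasible_def)

text \<open>Each repetition removes a nonempty set from the working set, so its cardinality is a
  termination measure.\<close>

lemma id0_loop_exists:
  assumes "\<And>Ahat. \<exists>lt. id0_lp \<phi> g \<tau> z l Ahat lt"
  shows "\<exists>A0. id0_loop \<phi> g \<tau>hat \<tau> z l Ahat A0"
proof (induction "card Ahat" arbitrary: Ahat rule: less_induct)
  case less
  obtain lt where lt: "id0_lp \<phi> g \<tau> z l Ahat lt" using assms by blast
  define C where "C = {i \<in> Ahat. lt $ i \<ge> eta0 z l powr \<tau>hat}"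
  show ?case
  proof (cases "C = {}")
    case True
    then show ?thesis using stop_done[OF lt] by (auto simp: C_def)
  next
    case C: False
    show ?thesis
    proof (cases "Ahat - C = {}")
      case True
      then show ?thesis using stop_empty[OF lt C_def C] by blast
    next
      case False
      have "card (Ahat - C) < card Ahat"
        using C by (intro psubset_card_mono) (auto simp: C_def)
      then show ?thesis using less repeat_loop[OF lt C_def C False] by blast
    qed
  qed
qed

text \<open>If the loop stops because no component reaches the threshold, the optimal value of the
  linear program is at most \<open>CARD('m) * eta powr \<tau>hat\<close>. But \<open>lb\<close> is
  feasible and would yield at least \<zeta> if an index of \<open>Pos\<close> were left. The other
  rules return the empty set or pass the claim on.\<close>

lemma id0_loop_disjoint_Pos:
  assumes "id0_loop \<phi> g \<tau>hat \<tau> z l Ahat A0"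
    and feas: "lp_feasible \<phi> g \<tau> z l (act_est \<phi> g \<tau> z l) lb" and lb: "0 \<le> lb"
    and \<zeta>: "\<And>i. i \<in> Pos \<Longrightarrow> \<zeta> \<le> lb $ i" and small: "real CARD('m) * eta0 z l powr \<tau>hat < \<zeta>"
  shows "Pos \<inter> A0 = {}"
  using assms(1)
proof induction
  case (stop_done Ahat lt)
  show ?case
  proof (rule ccontr)
    assume "Pos \<inter> Ahat \<noteq> {}"
    then obtain i where i: "i \<in> Pos" "i \<in> Ahat" by blast
    have "\<zeta> \<le> lb $ i" by (rule \<zeta>[OF i(1)])
    also have "\<dots> \<le> (\<Sum>i\<in>Ahat. lb $ i)"
      using lb i by (intro member_le_sum) (auto simp: less_eq_vec_def)
    also have "\<dots> \<le> (\<Sum>i\<in>Ahat. lt $ i)"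
      using stop_done(1) feas by (auto simp: id0_lp_def is_arg_max_def not_less)
    also have "\<dots> \<le> (\<Sum>i\<in>Ahat. eta0 z l powr \<tau>hat)"
      using stop_done(2) by (intro sum_mono) force
    also have "\<dots> = real (card Ahat) * eta0 z l powr \<tau>hat" by simp
    also have "\<dots> \<le> real CARD('m) * eta0 z l powr \<tau>hat"
      by (intro mult_right_mono) (auto intro: card_mono)
    finally show False using small by simp
  qed
qed auto

text \<open>Near the solution set the estimated active set equals \<open>Act\<close>, and
  \<open>ID0\<close> keeps \<open>Pos\<close> inside its first result. The former lets any feasible
  \<open>lhat\<close> vanish off \<open>Act\<close>, so Hoffman's bound controls its distance by the
  tolerance of the program and \<open>dS z l\<close>; the latter makes \<open>lb\<close> feasible
  for the second program. Existence follows because \<open>multiplier_bound\<close> makes the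
  feasible sets compact.\<close>

lemma multiplier_adjustment_near:
  assumes \<tau>: "0 < \<tau>hat" "\<tau>hat < \<tau>" "\<tau> < 1" and \<epsilon>t: "0 < \<epsilon>t"
  shows "\<exists>\<delta>3>0. \<forall>z l. 0 \<le> l \<longrightarrow> dS z l \<le> \<delta>3 \<longrightarrow>
     (\<exists>lhat. multiplier_adjustment \<phi> g \<tau>hat \<tau> z l lhat) \<and>
     (\<forall>lhat. multiplier_adjustment \<phi> g \<tau>hat \<tau> z l lhat \<longrightarrow> 0 \<le> lhat \<and> dS z lhat \<le> \<epsilon>t)"
proof -
  obtain CH where CH: "CH > 0"
    and hoff: "\<And>l. 0 \<le> l \<Longrightarrow> (\<forall>i. i \<notin> Act \<longrightarrow> l $ i = 0) \<Longrightarrow>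
       \<exists>ls\<in>S. norm (l - ls) \<le> CH * norm (grad \<phi> zs + G zs l)"
    using S_hoffman by blast
  obtain c where c: "c > 0" "\<And>i. i \<notin> Act \<Longrightarrow> g zs $ i \<le> - c" using inactive_gap by blast
  obtain Q s where Q: "Q > 0" and s: "s > 0" "s \<le> r" and mb: "\<And>z l. norm (z - zs) < s \<Longrightarrow> 0 \<le> l \<Longrightarrow>
      (\<forall>i. i \<notin> Act \<longrightarrow> l $ i = 0) \<Longrightarrow> norm l \<le> Q * (1 + norm (grad \<phi> z + G z l))"
    using multiplier_bound by metis
  obtain Cu where Cu: "Cu > 0" "\<And>z l. dS z l < r \<Longrightarrow> eta0 z l \<le> Cu * dS z l"
    using eta_upper by blast
  obtain C \<delta>e where C: "C > 0" and \<delta>e: "\<delta>e > 0" and eb: "\<And>z l. 0 \<le> l \<Longrightarrow> dS z l \<le> \<delta>e \<Longrightarrow> dS z l \<le> C * eta0 z l"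
    using error_bound by metis
  obtain lb \<zeta> where lb: "lb \<in> S" and \<zeta>: "\<zeta> > 0" "\<And>i. i \<in> Pos \<Longrightarrow> \<zeta> \<le> lb $ i"
    using strictly_positive_multiplier by blast
  define m where "m = real CARD('m)"
  have m: "m \<ge> 1" by (simp add: m_def)
  define n where "n = real CARD('n)"
  have n: "n \<ge> 1" by (simp add: n_def)
  have K: "K \<ge> 1" "K \<ge> 0" using K_ge by auto
  define Cb where "Cb = K * (1 + R) * C"
  have Cb: "Cb > 0" using K R(1) C by (simp add: Cb_def)
  define RQ where "RQ = Q * (1 + n)"
  have RQ: "RQ > 0" using Q n by (simp add: RQ_def)
  define L where "L = CH * (K * (1 + RQ))"
  have L: "L > 0" using CH K RQ by (simp add: L_def add_pos_pos)
  \<comment> \<open>By the error bound, the stationarity residual of any \<open>ls \<in> S\<close>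
    at \<open>z\<close> is at most \<open>Cb * \<epsilon>\<close>; below \<open>e1\<close> it
    therefore fits into the tolerance \<open>\<epsilon> powr \<tau>\<close>.\<close>
  obtain e1 where e1: "e1 > 0" "\<And>e. 0 \<le> e \<Longrightarrow> e \<le> e1 \<Longrightarrow> Cb * e \<le> e powr \<tau>"
    using linear_le_powr[of \<tau> Cb] \<tau> Cb by auto
  define q where "q = Min {1, c / 4, \<epsilon>t / (4 * (CH * n))}"
  have q: "q > 0" unfolding q_def using c(1) \<epsilon>t CH n by (subst Min_gr_iff; simp)
  have qs: "q \<le> 1" "q \<le> c / 4" "q \<le> \<epsilon>t / (4 * (CH * n))" unfolding q_def by (rule Min_le; simp)+
  obtain e2 where e2: "e2 > 0" "\<And>e. 0 \<le> e \<Longrightarrow> e \<le> e2 \<Longrightarrow> e powr \<tau> \<le> q"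
    using powr_le_small[of \<tau> q] \<tau> q by auto
  obtain e3 where e3: "e3 > 0" "\<And>e. 0 \<le> e \<Longrightarrow> e \<le> e3 \<Longrightarrow> e powr \<tau>hat \<le> \<zeta> / (2 * m)"
    using powr_le_small[of \<tau>hat "\<zeta> / (2 * m)"] \<tau> \<zeta>(1) m by auto
  define \<delta>3 where "\<delta>3 = Min {e1 / Cu, e2 / Cu, e3 / Cu, \<delta>e, r / 2, s / 2, c / (4 * K), \<epsilon>t / 4, \<epsilon>t / (4 * L)}"
  have \<delta>3: "\<delta>3 > 0" unfolding \<delta>3_def
    using e1(1) e2(1) e3(1) Cu(1) \<delta>e r_pos s(1) c(1) K(1) \<epsilon>t L by (subst Min_gr_iff; simp)
  have \<delta>s: "\<delta>3 \<le> e1 / Cu" "\<delta>3 \<le> e2 / Cu" "\<delta>3 \<le> e3 / Cu" "\<delta>3 \<le> \<delta>e" "\<delta>3 \<le> r / 2" "\<delta>3 \<le> s / 2"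
      "\<delta>3 \<le> c / (4 * K)" "\<delta>3 \<le> \<epsilon>t / 4" "\<delta>3 \<le> \<epsilon>t / (4 * L)"
    unfolding \<delta>3_def by (rule Min_le; simp)+
  have \<delta>C: "Cu * \<delta>3 \<le> e1" "Cu * \<delta>3 \<le> e2" "Cu * \<delta>3 \<le> e3" "K * \<delta>3 \<le> c / 4" "L * \<delta>3 \<le> \<epsilon>t / 4"
    using \<delta>s(1,2,3,7,9) Cu(1) K(1) L by (simp_all add: field_simps)
  have qL: "CH * (n * q) \<le> \<epsilon>t / 4" using qs(3) CH n by (simp add: field_simps)
  have main: "(\<exists>lhat. multiplier_adjustment \<phi> g \<tau>hat \<tau> z l lhat) \<and>
     (\<forall>lhat. multiplier_adjustment \<phi> g \<tau>hat \<tau> z l lhat \<longrightarrow> 0 \<le> lhat \<and> dS z lhat \<le> \<epsilon>t)"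
    if l: "0 \<le> l" and \<delta>l: "dS z l \<le> \<delta>3" for z l
  proof -
    define \<delta> where "\<delta> = dS z l"
    define \<epsilon> where "\<epsilon> = eta0 z l"
    have \<delta>: "0 \<le> \<delta>" "\<delta> \<le> \<delta>3" "\<delta> < r" using dist_sol_nonneg \<delta>l \<delta>s(5) r_pos by (auto simp: \<delta>_def)
    have "\<epsilon> \<le> Cu * \<delta>" unfolding \<epsilon>_def \<delta>_def using \<delta> by (intro Cu(2)) (simp add: \<delta>_def)
    also have "\<dots> \<le> Cu * \<delta>3" using \<delta> Cu(1) by (intro mult_left_mono) auto
    finally have \<epsilon>: "0 \<le> \<epsilon>" "\<epsilon> \<le> e1" "\<epsilon> \<le> e2" "\<epsilon> \<le> e3"
      using \<delta>C eta_nonneg by (auto simp: \<epsilon>_def)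
    define t where "t = \<epsilon> powr \<tau>"
    have t: "0 \<le> t" "t \<le> q" "Cb * \<epsilon> \<le> t" using e1(2) e2(2) \<epsilon> by (auto simp: t_def)
    have th: "\<epsilon> powr \<tau>hat \<le> \<zeta> / (2 * m)" using e3(2) \<epsilon> by blast
    have "\<delta> \<le> C * \<epsilon>" unfolding \<delta>_def \<epsilon>_def using \<delta> \<delta>s(4) by (intro eb l) (simp add: \<delta>_def)
    then have KR: "K * (1 + R) * \<delta> \<le> t" "K * \<delta> \<le> t"
    proof -
      assume a: "\<delta> \<le> C * \<epsilon>"
      have "K * (1 + R) * \<delta> \<le> K * (1 + R) * (C * \<epsilon>)" using a K R(1) by (intro mult_left_mono) auto
      then show 1: "K * (1 + R) * \<delta> \<le> t" using t by (simp add: Cb_def mult_ac)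
      have "K * \<delta> \<le> K * (1 + R) * \<delta>" using K R(1) \<delta> by (intro mult_right_mono) auto
      then show "K * \<delta> \<le> t" using 1 by simp
    qed
    obtain l1 where l1: "l1 \<in> S" "norm (z - zs) \<le> \<delta>" "norm (l - l1) \<le> \<delta>"
      using dist_sol_attained unfolding \<delta>_def by blast
    have zb: "z \<in> ball zs r" using l1 \<delta> by (intro in_ball_zs) simp
    have zs: "norm (z - zs) < s" using l1 \<delta> \<delta>s(6) s(1) by linarith
    have gz: "\<bar>g z $ i - g zs $ i\<bar> \<le> K * \<delta>" for i
      using constraint_lipschitz[OF zs_in_ball zb, of i] mult_left_mono[OF l1(2) K(2)] by simp
    \<comment> \<open>The threshold \<open>t\<close> exceeds the error \<open>K * \<delta>\<close>
      of the active constraints because \<tau> < 1, yet stays below the gap of the inactive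
      ones.\<close>
    have act: "act_est \<phi> g \<tau> z l = Act"
    proof -
      have "g z $ i \<ge> - t" if "i \<in> Act" for i
        using gz[of i] KR that by (simp add: active_def abs_le_iff)
      moreover have "g z $ i < - t" if "i \<notin> Act" for i
      proof -
        have "K * \<delta> \<le> K * \<delta>3" using \<delta> K by (intro mult_left_mono) auto
        then show ?thesis using gz[of i] c(2)[OF that] c(1) \<delta>C(4) t qs by (simp add: abs_le_iff)
      qed
      ultimately show ?thesis by (fastforce simp: act_est_def t_def \<epsilon>_def)
    qed
    let ?feas = "lp_feasible \<phi> g \<tau> z l"
    have feasS: "?feas I ls" if ls: "ls \<in> S" and I: "Pos \<subseteq> I" for ls I
    proof -
      have "norm (grad \<phi> z + G z ls) \<le> t"
      proof -
        have "norm (grad \<phi> z + G z ls) \<le> K * (1 + norm ls) * norm (z - zs)"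
          using grad_lagrangian_lipschitz[OF zs_in_ball zb, of ls] S_stationary[OF ls] by simp
        also have "\<dots> \<le> K * (1 + R) * \<delta>"
        proof (rule mult_mono[OF _ l1(2)])
          show "K * (1 + norm ls) \<le> K * (1 + R)" using R(2)[OF ls] K by (intro mult_left_mono) auto
        qed (use K R(1) in auto)
        finally show ?thesis using KR by simp
      qed
      then have "\<bar>(grad \<phi> z + G z ls) $ j\<bar> \<le> t" for j
        using component_le_norm_cart[of "grad \<phi> z + G z ls" j] by linarith
      then show ?thesis
        using ls I S_zero_off_Pos[OF ls] unfolding lp_feasible_iff by (auto simp: t_def \<epsilon>_def S_iff)
    qed
    have fres: "norm (grad \<phi> z + G z lt) \<le> n * t" and fbd: "norm lt \<le> RQ"
      if I: "I \<subseteq> Act" and lt: "?feas I lt" for I lt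
    proof -
      show res: "norm (grad \<phi> z + G z lt) \<le> n * t" unfolding n_def
        using lt unfolding lp_feasible_iff by (intro norm_vec_le_card) (auto simp: t_def \<epsilon>_def)
      have "norm lt \<le> Q * (1 + norm (grad \<phi> z + G z lt))"
        using lt I unfolding lp_feasible_iff by (intro mb zs) auto
      also have "\<dots> \<le> RQ" unfolding RQ_def
      proof (intro mult_left_mono add_left_mono)
        have "n * t \<le> n * 1" using t qs n by (intro mult_left_mono) auto
        then show "norm (grad \<phi> z + G z lt) \<le> n" using res by simp
      qed (use Q in auto)
      finally show "norm lt \<le> RQ" .
    qed
    have cl: "closed {lt. ?feas I lt}" for I
    proof -
      have "{lt. ?feas I lt} = {lt. \<forall>j. \<bar>(grad \<phi> z + G z lt) $ j\<bar> \<le> t} \<inter> {lt. 0 \<le> lt} \<inter> {lt. \<forall>i. i \<notin> I \<longrightarrow> lt $ i = 0}"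
        by (auto simp: lp_feasible_iff t_def \<epsilon>_def)
      moreover have "closed {lt. \<forall>j. \<bar>(grad \<phi> z + G z lt) $ j\<bar> \<le> t}"
        by (intro closed_Collect_all closed_Collect_le continuous_intros continuous_on_lin_comb)
      moreover have "closed {lt::real^'m. \<forall>i. i \<notin> I \<longrightarrow> lt $ i = 0}"
        by (intro closed_Collect_all closed_Collect_imp open_Collect_const closed_Collect_eq continuous_intros)
      ultimately show ?thesis using closed_nonneg[where 'k='m] by (simp add: closed_Int)
    qed
    have co: "compact {lt. ?feas I lt}" if "I \<subseteq> Act" for I
      unfolding compact_eq_bounded_closed using cl fbd[OF that] by (auto simp: bounded_iff)
    have id0: "\<exists>lt. id0_lp \<phi> g \<tau> z l Ahat lt" for Ahat
    proof -
      have ne: "{lt. ?feas Act lt} \<noteq> {}" using feasS[OF lb Pos_subset] by auto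
      have "continuous_on {lt. ?feas Act lt} (\<lambda>l'. \<Sum>i\<in>Ahat. l' $ i)" by (intro continuous_intros)
      then obtain lt where "lt \<in> {lt. ?feas Act lt}"
          "\<And>l'. l' \<in> {lt. ?feas Act lt} \<Longrightarrow> (\<Sum>i\<in>Ahat. l' $ i) \<le> (\<Sum>i\<in>Ahat. lt $ i)"
        using continuous_attains_sup[OF co[OF order_refl] ne] by blast
      then show ?thesis unfolding id0_lp_def is_arg_max_def act by (intro exI[of _ lt]) (auto simp: not_less)
    qed
    have plus: "Pos \<subseteq> Ap" "Ap \<subseteq> Act" if "ID0 \<phi> g \<tau>hat \<tau> z l Ap A0" for Ap A0
    proof -
      have loop: "id0_loop \<phi> g \<tau>hat \<tau> z l (act_est \<phi> g \<tau> z l - {i. l $ i \<ge> \<epsilon> powr \<tau>hat}) A0"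
        and Ap: "Ap = Act - A0" using that by (auto simp: ID0_def act \<epsilon>_def)
      have "Pos \<inter> A0 = {}"
      proof (rule id0_loop_disjoint_Pos[OF loop])
        show "?feas (act_est \<phi> g \<tau> z l) lb" unfolding act by (rule feasS[OF lb Pos_subset])
        show "0 \<le> lb" using lb by (simp add: S_iff)
        show "\<And>i. i \<in> Pos \<Longrightarrow> \<zeta> \<le> lb $ i" by (rule \<zeta>)
        have "m * \<epsilon> powr \<tau>hat \<le> m * (\<zeta> / (2 * m))" using th m by (intro mult_left_mono) auto
        also have "\<dots> = \<zeta> / 2" using m by simp
        finally show "real CARD('m) * eta0 z l powr \<tau>hat < \<zeta>" using \<zeta>(1) by (simp add: m_def \<epsilon>_def)
      qed
      then show "Pos \<subseteq> Ap" "Ap \<subseteq> Act" using Pos_subset Ap by auto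
    qed
    have "\<exists>lhat. multiplier_adjustment \<phi> g \<tau>hat \<tau> z l lhat"
    proof -
      obtain A0 where "id0_loop \<phi> g \<tau>hat \<tau> z l (act_est \<phi> g \<tau> z l - {i. l $ i \<ge> eta0 z l powr \<tau>hat}) A0"
        using id0_loop_exists[OF id0] by blast
      then have ID: "ID0 \<phi> g \<tau>hat \<tau> z l (Act - A0) A0" by (simp add: ID0_def act)
      define Ap where "Ap = Act - A0"
      have Ap: "Pos \<subseteq> Ap" "Ap \<subseteq> Act" using plus[OF ID] by (auto simp: Ap_def)
      show ?thesis
      proof (cases "Ap = {}")
        case True
        then show ?thesis using ID feasS[OF lb Ap(1)] unfolding multiplier_adjustment_def Ap_def by metis
      next
        case False
        then obtain i0 where i0: "i0 \<in> Ap" by blast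
        \<comment> \<open>Restricting the scalar variable to \<open>{0..RQ}\<close> gives
          compactness. Nothing is lost: \<open>(0, lb)\<close> lies in \<open>P\<close>, and a
          feasible scalar is at most a component of a multiplier of norm at most
          \<open>RQ\<close>.\<close>
        define P where "P = ({0..RQ} \<times> {lt. ?feas Ap lt}) \<inter> {p. \<forall>i. i \<in> Ap \<longrightarrow> fst p \<le> snd p $ i}"
        have "closed {p::real \<times> (real^'m). \<forall>i. i \<in> Ap \<longrightarrow> fst p \<le> snd p $ i}"
          by (intro closed_Collect_all closed_Collect_imp open_Collect_const closed_Collect_le continuous_intros)
        then have coP: "compact P" unfolding P_def by (intro compact_Int_closed compact_Times co[OF Ap(2)]) auto
        have "(0, lb) \<in> P"
          using feasS[OF lb Ap(1)] S_nonneg[OF lb] RQ by (simp add: P_def)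
        then have neP: "P \<noteq> {}" by blast
        have contP: "continuous_on P fst" by (intro continuous_intros)
        obtain p where p: "p \<in> P" "\<And>p'. p' \<in> P \<Longrightarrow> fst p' \<le> fst p"
          using continuous_attains_sup[OF coP neP contP] by blast
        have max: "\<not> fst p < t'" if h: "\<forall>i\<in>Ap. t' \<le> l' $ i" "?feas Ap l'" for t' l'
        proof
          assume "fst p < t'"
          moreover have "0 \<le> fst p" using p(1) by (auto simp: P_def)
          moreover have "t' \<le> RQ"
            using h(1) i0 component_le_norm_cart[of l' i0] fbd[OF Ap(2) h(2)] by fastforce
          ultimately have "(t', l') \<in> P" using h by (auto simp: P_def)
          then show False using p(2) \<open>fst p < t'\<close> by fastforce
        qed
        have "is_arg_max fst (\<lambda>(t, l'). (\<forall>i\<in>Ap. t \<le> l' $ i) \<and> ?feas Ap l') (fst p, snd p)"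
          unfolding is_arg_max_def using p(1) max by (auto simp: P_def)
        moreover have "?feas Ap (snd p)" using p(1) by (auto simp: P_def)
        ultimately show ?thesis using ID unfolding multiplier_adjustment_def Ap_def by blast
      qed
    qed
    moreover have "0 \<le> lhat \<and> dS z lhat \<le> \<epsilon>t" if ma: "multiplier_adjustment \<phi> g \<tau>hat \<tau> z l lhat" for lhat
    proof -
      obtain Ap A0 where ID: "ID0 \<phi> g \<tau>hat \<tau> z l Ap A0" and f: "?feas Ap lhat"
        using ma unfolding multiplier_adjustment_def by blast
      have lh: "0 \<le> lhat" "\<forall>i. i \<notin> Act \<longrightarrow> lhat $ i = 0"
        using f plus[OF ID] unfolding lp_feasible_iff by auto
      obtain ls where ls: "ls \<in> S" "norm (lhat - ls) \<le> CH * norm (grad \<phi> zs + G zs lhat)"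
        using hoff[OF lh] by blast
      have "norm (grad \<phi> zs + G zs lhat) \<le> n * q + K * (1 + RQ) * \<delta>"
      proof -
        have "grad \<phi> zs + G zs lhat = (grad \<phi> z + G z lhat) - (grad \<phi> z + G z lhat - (grad \<phi> zs + G zs lhat))" by simp
        also have "norm \<dots> \<le> norm (grad \<phi> z + G z lhat) + norm (grad \<phi> z + G z lhat - (grad \<phi> zs + G zs lhat))"
          by (rule norm_triangle_ineq4)
        also have "norm (grad \<phi> z + G z lhat) \<le> n * q"
          using fres[OF plus(2)[OF ID] f] mult_left_mono[OF t(2), of n] n by linarith
        also have "norm (grad \<phi> z + G z lhat - (grad \<phi> zs + G zs lhat)) \<le> K * (1 + norm lhat) * norm (z - zs)"
          by (rule grad_lagrangian_lipschitz[OF zs_in_ball zb])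
        also have "K * (1 + norm lhat) * norm (z - zs) \<le> K * (1 + RQ) * \<delta>"
        proof (rule mult_mono[OF _ l1(2)])
          show "K * (1 + norm lhat) \<le> K * (1 + RQ)"
            using fbd[OF plus(2)[OF ID] f] K by (intro mult_left_mono) auto
        qed (use K RQ in auto)
        finally show ?thesis by simp
      qed
      then have "CH * norm (grad \<phi> zs + G zs lhat) \<le> CH * (n * q + K * (1 + RQ) * \<delta>)"
        using CH by (intro mult_left_mono) auto
      also have "\<dots> = CH * (n * q) + L * \<delta>" by (simp add: L_def algebra_simps)
      also have "L * \<delta> \<le> L * \<delta>3" using \<delta> L by (intro mult_left_mono) auto
      finally have "norm (lhat - ls) \<le> \<epsilon>t / 4 + \<epsilon>t / 4" using qL \<delta>C(5) ls by linarith
      moreover have "dS z lhat \<le> norm (z - zs) + norm (lhat - ls)" by (rule dist_sol_le[OF ls(1)])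
      ultimately have "dS z lhat \<le> \<epsilon>t" using l1 \<delta> \<delta>s(8) \<epsilon>t by linarith
      then show ?thesis using lh by simp
    qed
    ultimately show ?thesis by blast
  qed
  show ?thesis
    by (rule exI[of _ \<delta>3], rule conjI[OF \<delta>3], intro allI impI) (rule main)
qed

section \<open>Superlinear decrease in one step and convergence of the iteration\<close>

text \<open>The order of the quantifiers matters: the thresholds of \<open>ssqp_estimate\<close>
  depend on \<kappa>, so \<kappa> is fixed before \<mu>1, and only then is the neighbourhood shrunk
  to bring the residual below \<mu>1. The comparison with the power \<sigma> follows from the linear
  one, as \<open>e \<le> e powr \<sigma>\<close> for small \<open>e\<close>.\<close>

lemma eta_powr_bounds:
  assumes \<sigma>: "0 < \<sigma>" "\<sigma> < 1"
  shows "\<exists>\<kappa>>0. \<forall>\<mu>1>0. \<exists>\<delta>1>0. \<forall>z l. 0 \<le> l \<longrightarrow> dS z l \<le> \<delta>1 \<longrightarrow>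
     dS z l \<le> \<kappa> * eta0 z l \<and> dS z l \<le> \<kappa> * eta0 z l powr \<sigma> \<and> eta0 z l \<le> \<kappa> * dS z l \<and>
     eta0 z l \<le> \<mu>1 \<and> eta0 z l powr \<sigma> \<le> \<mu>1"
proof -
  obtain Cu where Cu: "Cu > 0" "\<And>z l. dS z l < r \<Longrightarrow> eta0 z l \<le> Cu * dS z l"
    using eta_upper by blast
  obtain C \<delta>e where C: "C > 0" and \<delta>e: "\<delta>e > 0" and eb: "\<And>z l. 0 \<le> l \<Longrightarrow> dS z l \<le> \<delta>e \<Longrightarrow> dS z l \<le> C * eta0 z l"
    using error_bound by metis
  define \<kappa> where "\<kappa> = C + Cu"
  have \<kappa>: "\<kappa> > 0" "C \<le> \<kappa>" "Cu \<le> \<kappa>" using C Cu(1) by (auto simp: \<kappa>_def)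
  have "\<exists>\<delta>1>0. \<forall>z l. 0 \<le> l \<longrightarrow> dS z l \<le> \<delta>1 \<longrightarrow>
     dS z l \<le> \<kappa> * eta0 z l \<and> dS z l \<le> \<kappa> * eta0 z l powr \<sigma> \<and> eta0 z l \<le> \<kappa> * dS z l \<and>
     eta0 z l \<le> \<mu>1 \<and> eta0 z l powr \<sigma> \<le> \<mu>1" if \<mu>1: "\<mu>1 > 0" for \<mu>1
  proof -
    obtain e1 where e1: "e1 > 0" "\<And>e. 0 \<le> e \<Longrightarrow> e \<le> e1 \<Longrightarrow> 1 * e \<le> e powr \<sigma>"
      using linear_le_powr[OF \<sigma>, of 1] by auto
    obtain e2 where e2: "e2 > 0" "\<And>e. 0 \<le> e \<Longrightarrow> e \<le> e2 \<Longrightarrow> e powr \<sigma> \<le> \<mu>1"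
      using powr_le_small[OF \<sigma>(1) \<mu>1] by blast
    define \<delta>1 where "\<delta>1 = Min {e1 / Cu, e2 / Cu, \<mu>1 / Cu, \<delta>e, r / 2}"
    have "\<delta>1 > 0" unfolding \<delta>1_def
      using e1(1) e2(1) Cu(1) \<mu>1 \<delta>e r_pos by (subst Min_gr_iff; simp)
    have \<delta>s: "\<delta>1 \<le> e1 / Cu" "\<delta>1 \<le> e2 / Cu" "\<delta>1 \<le> \<mu>1 / Cu" "\<delta>1 \<le> \<delta>e" "\<delta>1 \<le> r / 2"
      unfolding \<delta>1_def by (rule Min_le; simp)+
    have \<delta>C: "Cu * \<delta>1 \<le> e1" "Cu * \<delta>1 \<le> e2" "Cu * \<delta>1 \<le> \<mu>1"
      using \<delta>s(1-3) Cu(1) by (simp_all add: field_simps)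
    show ?thesis
    proof (intro exI[of _ \<delta>1] conjI[OF \<open>\<delta>1 > 0\<close>] allI impI)
      fix z l assume l: "0 \<le> l" and \<delta>: "dS z l \<le> \<delta>1"
      have 1: "eta0 z l \<le> Cu * dS z l" using \<delta> \<delta>s(5) r_pos by (intro Cu(2)) simp
      also have "\<dots> \<le> Cu * \<delta>1" using \<delta> Cu(1) by (intro mult_left_mono) auto
      finally have 2: "eta0 z l \<le> Cu * \<delta>1" .
      have 3: "dS z l \<le> C * eta0 z l" using \<delta> \<delta>s(4) by (intro eb l) simp
      have 4: "C * eta0 z l \<le> \<kappa> * eta0 z l" by (rule mult_right_mono[OF \<kappa>(2) eta_nonneg])
      have 5: "eta0 z l \<le> eta0 z l powr \<sigma>" using e1(2)[OF eta_nonneg, of z l] 2 \<delta>C by simp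
      have 6: "\<kappa> * eta0 z l \<le> \<kappa> * eta0 z l powr \<sigma>" using 5 \<kappa> by (intro mult_left_mono) auto
      have 7: "Cu * dS z l \<le> \<kappa> * dS z l" by (rule mult_right_mono[OF \<kappa>(3) dist_sol_nonneg])
      have 8: "eta0 z l powr \<sigma> \<le> \<mu>1" using e2(2)[OF eta_nonneg, of z l] 2 \<delta>C by simp
      show "dS z l \<le> \<kappa> * eta0 z l \<and> dS z l \<le> \<kappa> * eta0 z l powr \<sigma> \<and> eta0 z l \<le> \<kappa> * dS z l \<and>
         eta0 z l \<le> \<mu>1 \<and> eta0 z l powr \<sigma> \<le> \<mu>1"
        using 1 2 3 4 6 7 8 \<delta>C by linarith
    qed
  qed
  then show ?thesis using \<kappa>(1) by blast
qed

text \<open>The error bound turns the conditions of \<open>ssqp_exists\<close> on \<mu> into a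
  neighbourhood condition. That neighbourhood may depend on the radius \<rho>, which is arbitrary
  here.\<close>

lemma ssqp_step_exists:
  assumes \<sigma>: "0 < \<sigma>" "\<sigma> < 1" and \<rho>: "0 < \<rho>"
  shows "\<exists>\<delta>2>0. \<forall>z l. 0 \<le> l \<longrightarrow> dS z l \<le> \<delta>2 \<longrightarrow> (\<exists>d lp. ssqp_step \<phi> g \<sigma> \<rho> z l d lp)"
proof -
  obtain \<kappa> where \<kappa>: "\<kappa> > 0" and b: "\<And>\<mu>1. \<mu>1 > 0 \<Longrightarrow> \<exists>\<delta>1>0. \<forall>z l. 0 \<le> l \<longrightarrow> dS z l \<le> \<delta>1 \<longrightarrow>
     dS z l \<le> \<kappa> * eta0 z l \<and> dS z l \<le> \<kappa> * eta0 z l powr \<sigma> \<and> eta0 z l \<le> \<kappa> * dS z l \<and>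
     eta0 z l \<le> \<mu>1 \<and> eta0 z l powr \<sigma> \<le> \<mu>1"
    using eta_powr_bounds[OF \<sigma>] by blast
  obtain \<mu>2 \<delta>2 where ex: "\<mu>2 > 0" "\<delta>2 > 0" "\<forall>z l \<mu>. 0 \<le> l \<longrightarrow> dS z l \<le> \<delta>2 \<longrightarrow> 0 \<le> \<mu> \<longrightarrow> \<mu> \<le> \<mu>2 \<longrightarrow>
      dS z l \<le> \<kappa> * \<mu> \<longrightarrow> (\<exists>d lp. ssqp_solution \<phi> g \<mu> z l d lp \<and> norm (d, lp - l) \<le> \<rho>)"
    using ssqp_exists[OF \<kappa> \<rho>] by blast
  obtain \<delta>1 where \<delta>1: "\<delta>1 > 0" "\<forall>z l. 0 \<le> l \<longrightarrow> dS z l \<le> \<delta>1 \<longrightarrow>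
     dS z l \<le> \<kappa> * eta0 z l \<and> dS z l \<le> \<kappa> * eta0 z l powr \<sigma> \<and> eta0 z l \<le> \<kappa> * dS z l \<and>
     eta0 z l \<le> \<mu>2 \<and> eta0 z l powr \<sigma> \<le> \<mu>2"
    using b[OF ex(1)] by blast
  have "\<exists>d lp. ssqp_step \<phi> g \<sigma> \<rho> z l d lp" if l: "0 \<le> l" and \<delta>: "dS z l \<le> min \<delta>1 \<delta>2" for z l
  proof -
    have 1: "dS z l \<le> \<delta>1" "dS z l \<le> \<delta>2" using \<delta> by auto
    have "dS z l \<le> \<kappa> * eta0 z l powr \<sigma>" "eta0 z l powr \<sigma> \<le> \<mu>2"
      using \<delta>1(2)[rule_format, OF l 1(1)] by auto
    then show ?thesis
      unfolding ssqp_step_def using ex(3)[rule_format, OF l 1(2), of "eta0 z l powr \<sigma>"] by simp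
  qed
  then show ?thesis using ex(2) \<delta>1(1) by (intro exI[of _ "min \<delta>1 \<delta>2"]) auto
qed

text \<open>The new residual is of order \<mu> \<delta>. With
  \<open>\<mu> \<le> (\<kappa> * \<delta>) powr \<sigma>\<close> and the error bound at the new
  point this gives the rate. With \<open>\<delta> \<le> \<kappa> * \<epsilon>\<close> it gives
  residual order \<open>1 + \<sigma>\<close>; the test demands only \<open>1 + \<sigma> / 2\<close>,
  and the spare factor \<open>\<epsilon> powr (\<sigma> / 2)\<close> pays for the constant.\<close>

lemma ssqp_step_superlinear:
  assumes \<sigma>: "0 < \<sigma>" "\<sigma> < 1"
  shows "\<exists>\<rho>0>0. \<exists>\<delta>1>0. \<exists>C>0. \<forall>z l d lp. 0 \<le> l \<longrightarrow> dS z l \<le> \<delta>1 \<longrightarrow> ssqp_step \<phi> g \<sigma> \<rho>0 z l d lp \<longrightarrow>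
     0 \<le> lp \<and> dS (z + d) lp \<le> C * dS z l powr (1 + \<sigma>) \<and> if_condition \<phi> g \<sigma> z l d lp"
proof -
  obtain \<kappa> where \<kappa>: "\<kappa> > 0" and b: "\<And>\<mu>1. \<mu>1 > 0 \<Longrightarrow> \<exists>\<delta>1>0. \<forall>z l. 0 \<le> l \<longrightarrow> dS z l \<le> \<delta>1 \<longrightarrow>
     dS z l \<le> \<kappa> * eta0 z l \<and> dS z l \<le> \<kappa> * eta0 z l powr \<sigma> \<and> eta0 z l \<le> \<kappa> * dS z l \<and>
     eta0 z l \<le> \<mu>1 \<and> eta0 z l powr \<sigma> \<le> \<mu>1"
    using eta_powr_bounds[OF \<sigma>] by blast
  obtain \<rho>0 \<mu>1 \<delta>1 Ce where e: "\<rho>0 > 0" "\<mu>1 > 0" "\<delta>1 > 0" "Ce > 0"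
    and est: "\<forall>z l \<mu> d lp. 0 \<le> l \<longrightarrow> dS z l \<le> \<delta>1 \<longrightarrow> 0 \<le> \<mu> \<longrightarrow> \<mu> \<le> \<mu>1 \<longrightarrow>
     dS z l \<le> \<kappa> * \<mu> \<longrightarrow> norm d \<le> \<rho>0 \<longrightarrow> ssqp_kkt \<mu> z l d lp \<longrightarrow>
     norm d \<le> Ce * dS z l \<and> (\<mu> > 0 \<longrightarrow> norm (lp - l) \<le> Ce * dS z l) \<and>
     eta0 (z + d) lp \<le> Ce * (\<mu> * dS z l) \<and> dS (z + d) lp \<le> Ce * dS z l"
    using ssqp_estimate[OF \<kappa>] by blast
  have pos: "0 < 1 / (Ce * \<kappa>)" using e \<kappa> by simp
  obtain e1 where e1: "e1 > 0" "\<And>e. 0 \<le> e \<Longrightarrow> e \<le> e1 \<Longrightarrow> e powr (\<sigma> / 2) \<le> 1 / (Ce * \<kappa>)"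
    using powr_le_small[OF _ pos, of "\<sigma> / 2"] \<sigma> by auto
  define \<mu>2 where "\<mu>2 = min \<mu>1 e1"
  have \<mu>2: "\<mu>2 > 0" "\<mu>2 \<le> \<mu>1" "\<mu>2 \<le> e1" using e e1 by (auto simp: \<mu>2_def)
  obtain \<delta>b where \<delta>b: "\<delta>b > 0" "\<forall>z l. 0 \<le> l \<longrightarrow> dS z l \<le> \<delta>b \<longrightarrow>
     dS z l \<le> \<kappa> * eta0 z l \<and> dS z l \<le> \<kappa> * eta0 z l powr \<sigma> \<and> eta0 z l \<le> \<kappa> * dS z l \<and>
     eta0 z l \<le> \<mu>2 \<and> eta0 z l powr \<sigma> \<le> \<mu>2"
    using b[OF \<mu>2(1)] by blast
  \<comment> \<open>The entry \<open>\<delta>b / Ce\<close> places the new point where the error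
    bound is available.\<close>
  define \<delta>2 where "\<delta>2 = Min {\<delta>1, \<delta>b, \<delta>b / Ce, r / 2}"
  have "\<delta>2 > 0" unfolding \<delta>2_def using e \<delta>b(1) r_pos by (subst Min_gr_iff; simp)
  have \<delta>s: "\<delta>2 \<le> \<delta>1" "\<delta>2 \<le> \<delta>b" "\<delta>2 \<le> \<delta>b / Ce" "\<delta>2 \<le> r / 2"
    unfolding \<delta>2_def by (rule Min_le; simp)+
  have \<delta>C: "Ce * \<delta>2 \<le> \<delta>b" using \<delta>s(3) e by (simp add: field_simps)
  define C where "C = \<kappa> * Ce * \<kappa> powr \<sigma>"
  have C: "C > 0" using \<kappa> e by (simp add: C_def)
  have main: "0 \<le> lp \<and> dS (z + d) lp \<le> C * dS z l powr (1 + \<sigma>) \<and> if_condition \<phi> g \<sigma> z l d lp"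
    if l: "0 \<le> l" and \<delta>l: "dS z l \<le> \<delta>2" and step: "ssqp_step \<phi> g \<sigma> \<rho>0 z l d lp" for z l d lp
  proof -
    define \<delta> where "\<delta> = dS z l"
    define \<epsilon> where "\<epsilon> = eta0 z l"
    define \<mu> where "\<mu> = \<epsilon> powr \<sigma>"
    have \<delta>: "0 \<le> \<delta>" "\<delta> \<le> \<delta>1" "\<delta> \<le> \<delta>b" "\<delta> \<le> \<delta>2"
      using dist_sol_nonneg \<delta>l \<delta>s by (auto simp: \<delta>_def)
    have \<epsilon>: "0 \<le> \<epsilon>" "\<delta> \<le> \<kappa> * \<epsilon>" "\<delta> \<le> \<kappa> * \<mu>" "\<epsilon> \<le> \<kappa> * \<delta>" "\<epsilon> \<le> e1" "\<mu> \<le> \<mu>1" "0 \<le> \<mu>"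
      using \<delta>b(2)[rule_format, OF l, of z] \<delta> \<mu>2 eta_nonneg by (auto simp: \<delta>_def \<epsilon>_def \<mu>_def)
    obtain ls where ls: "ls \<in> S" "norm (z - zs) \<le> \<delta>"
      using dist_sol_attained unfolding \<delta>_def by blast
    have zb: "z \<in> ball zs r" using ls \<delta> \<delta>s(4) r_pos by (intro in_ball_zs) linarith
    have sol: "ssqp_solution \<phi> g \<mu> z l d lp" and nd: "norm (d, lp - l) \<le> \<rho>0"
      using step by (auto simp: ssqp_step_def \<mu>_def \<epsilon>_def)
    have kkt: "ssqp_kkt \<mu> z l d lp" by (rule ssqp_solution_kkt[OF zb \<epsilon>(7) sol])
    have "norm d \<le> norm (d, lp - l)" by (simp add: norm_Pair real_le_rsqrt)
    then have "norm d \<le> \<rho>0" using nd by simp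
    then have new: "eta0 (z + d) lp \<le> Ce * (\<mu> * \<delta>)" "dS (z + d) lp \<le> Ce * \<delta>"
      using est[rule_format, OF l, of z \<mu> d lp] \<delta> \<epsilon> kkt by (auto simp: \<delta>_def)
    have lp: "0 \<le> lp" using kkt by (simp add: ssqp_kkt_def)
    have "Ce * \<delta> \<le> Ce * \<delta>2" using \<delta> e by (intro mult_left_mono) auto
    then have "dS (z + d) lp \<le> \<delta>b" using new \<delta>C by simp
    then have "dS (z + d) lp \<le> \<kappa> * eta0 (z + d) lp" using \<delta>b(2) lp by blast
    also have "\<dots> \<le> \<kappa> * (Ce * (\<mu> * \<delta>))" using new \<kappa> by (intro mult_left_mono) auto
    also have "\<dots> \<le> \<kappa> * (Ce * ((\<kappa> powr \<sigma> * \<delta> powr \<sigma>) * \<delta>))"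
    proof -
      have "\<mu> \<le> (\<kappa> * \<delta>) powr \<sigma>" unfolding \<mu>_def using \<epsilon> \<sigma> by (intro powr_mono2) auto
      also have "\<dots> = \<kappa> powr \<sigma> * \<delta> powr \<sigma>" using \<kappa> \<delta> by (simp add: powr_mult)
      finally show ?thesis using \<kappa> e \<delta> by (intro mult_left_mono mult_right_mono) auto
    qed
    also have "\<dots> = C * \<delta> powr (1 + \<sigma>)"
      using \<delta> by (cases "\<delta> = 0") (auto simp: C_def powr_add)
    finally have dnew: "dS (z + d) lp \<le> C * dS z l powr (1 + \<sigma>)" by (simp add: \<delta>_def)
    have "eta0 (z + d) lp \<le> Ce * (\<mu> * (\<kappa> * \<epsilon>))"
    proof -
      have "Ce * (\<mu> * \<delta>) \<le> Ce * (\<mu> * (\<kappa> * \<epsilon>))" using \<epsilon> e by (intro mult_left_mono) auto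
      then show ?thesis using new by simp
    qed
    also have "\<dots> = (Ce * \<kappa>) * \<epsilon> powr (\<sigma> / 2) * \<epsilon> powr (1 + \<sigma> / 2)"
      using \<epsilon>(1) by (cases "\<epsilon> = 0") (auto simp: \<mu>_def powr_add[symmetric] powr_mult_base mult.commute mult.left_commute add.commute)
    also have "\<dots> \<le> (Ce * \<kappa>) * (1 / (Ce * \<kappa>)) * \<epsilon> powr (1 + \<sigma> / 2)"
      using e1(2)[of \<epsilon>] \<epsilon> e \<kappa> by (intro mult_right_mono mult_left_mono) auto
    also have "\<dots> = \<epsilon> powr (1 + \<sigma> / 2)" using e \<kappa> by simp
    finally have "if_condition \<phi> g \<sigma> z l d lp" by (simp add: if_condition_def \<epsilon>_def)
    then show ?thesis using lp dnew by blast
  qed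
  show ?thesis
    by (rule exI[of _ \<rho>0], rule conjI[OF e(1)], rule exI[of _ \<delta>2], rule conjI[OF \<open>\<delta>2 > 0\<close>],
        rule exI[of _ C], rule conjI[OF C], intro allI impI) (rule main)
qed

end

text \<open>\<rho>0 comes first because it is the radius within which every solution of the
  subproblem obeys the step estimate; \<open>\<delta>bar\<close> may depend on \<rho>, since a
  solution within \<rho> has to exist. The solvability claims keep the statement about runs from
  being vacuous.\<close>

theorem theorem7:
  fixes \<phi> :: "real ^ 'n \<Rightarrow> real" and g :: "real ^ 'n \<Rightarrow> real ^ 'm"
    and zs :: "real ^ 'n" and \<sigma> \<tau>hat \<tau> :: real
  assumes "assumption_A \<phi> g zs"
    and "0 < \<sigma>" and "\<sigma> < 1"
    and "0 < \<tau>hat" and "\<tau>hat < \<tau>" and "\<tau> < 1"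
  shows "\<exists>\<rho>0>0. \<forall>\<rho>. 0 < \<rho> \<and> \<rho> \<le> \<rho>0 \<longrightarrow>
    (\<exists>\<delta>bar>0. \<forall>z0 l0 tol. 0 \<le> l0 \<and> 0 \<le> tol \<and> dist_sol \<phi> g zs z0 l0 \<le> \<delta>bar \<longrightarrow>
       (\<exists>lhat. multiplier_adjustment \<phi> g \<tau>hat \<tau> z0 l0 lhat) \<and>
       (\<forall>N z l d lp. ssqpa_run \<phi> g \<sigma> \<tau>hat \<tau> tol \<rho> z0 l0 (enat N) z l d lp \<and>
            (N > 0 \<longrightarrow> \<not> eta \<phi> g (z N) (l N) < tol) \<longrightarrow>
          (\<exists>d' lp'. ssqp_step \<phi> g \<sigma> \<rho> (z N) (l N) d' lp')) \<and>
       (\<forall>N z l d lp. ssqpa_run \<phi> g \<sigma> \<tau>hat \<tau> tol \<rho> z0 l0 N z l d lp \<longrightarrow>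
          (\<forall>k. enat k < N \<longrightarrow> if_condition \<phi> g \<sigma> (z k) (l k) (d k) (lp k)) \<and>
          (N = \<infinity> \<longrightarrow>
             Q_superlinear_to_zero (\<lambda>k. dist_sol \<phi> g zs (z k) (l k)) \<and>
             Q_order (1 + \<sigma>) (\<lambda>k. dist_sol \<phi> g zs (z k) (l k)))))"
proof -
  \<comment> \<open>The pattern binds \<open>?Q\<close> to the conclusion for one starting
    point.\<close>
  let "\<exists>\<rho>0>0. \<forall>\<rho>. _ \<longrightarrow> (\<exists>\<delta>bar>0. \<forall>z0 l0 tol. _ \<longrightarrow> ?Q \<rho> z0 l0 tol)" = ?thesis
  have "twice_lipschitz_diff_near \<phi> zs" "\<And>i. twice_lipschitz_diff_near (\<lambda>z. g z $ i) zs"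
    using assms(1) by (auto simp: assumption_A_def)
  then obtain r M where "smooth_problem \<phi> g zs r M" by (rule twice_lipschitz_smooth_problem)
  then interpret kkt_problem \<phi> g zs r M
    using assms(1) by (simp add: kkt_problem_def kkt_problem_axioms_def)
  obtain \<rho>0 \<delta>1 C where \<rho>0: "\<rho>0 > 0" and \<delta>1: "\<delta>1 > 0" and C: "C > 0"
    and step: "\<forall>z l d lp. 0 \<le> l \<longrightarrow> dS z l \<le> \<delta>1 \<longrightarrow> ssqp_step \<phi> g \<sigma> \<rho>0 z l d lp \<longrightarrow>
      0 \<le> lp \<and> dS (z + d) lp \<le> C * dS z l powr (1 + \<sigma>) \<and> if_condition \<phi> g \<sigma> z l d lp"
    using ssqp_step_superlinear[OF assms(2,3)] by blast
  obtain e1 where e1: "e1 > 0" "\<And>e. 0 \<le> e \<Longrightarrow> e \<le> e1 \<Longrightarrow> e powr \<sigma> \<le> 1 / (2 * C)"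
    using powr_le_small[OF assms(2), of "1 / (2 * C)"] C by auto
  show ?thesis
  proof (rule exI[of _ \<rho>0], rule conjI[OF \<rho>0], intro allI impI)
    fix \<rho> assume \<rho>: "0 < \<rho> \<and> \<rho> \<le> \<rho>0"
    obtain \<delta>2 where \<delta>2: "\<delta>2 > 0" and ex: "\<And>z l. 0 \<le> l \<Longrightarrow> dS z l \<le> \<delta>2 \<Longrightarrow> \<exists>d lp. ssqp_step \<phi> g \<sigma> \<rho> z l d lp"
      using ssqp_step_exists[OF assms(2,3)] \<rho> by blast
    \<comment> \<open>\<delta>i is the neighbourhood in which the iteration stays, and \<delta>3 the
      radius for the starting point that the multiplier adjustment maps into it. The entry
      \<open>e1\<close> makes every step halve the distance, so the neighbourhood is never
      left.\<close>
    define \<delta>i where "\<delta>i = Min {\<delta>1, \<delta>2, e1}"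
    have \<delta>i: "\<delta>i > 0" unfolding \<delta>i_def using \<delta>1 \<delta>2 e1(1) by (subst Min_gr_iff; simp)
    have \<delta>s: "\<delta>i \<le> \<delta>1" "\<delta>i \<le> \<delta>2" "\<delta>i \<le> e1" unfolding \<delta>i_def by (rule Min_le; simp)+
    obtain \<delta>3 where \<delta>3: "\<delta>3 > 0" and adj: "\<And>z l. 0 \<le> l \<Longrightarrow> dS z l \<le> \<delta>3 \<Longrightarrow>
        (\<exists>lhat. multiplier_adjustment \<phi> g \<tau>hat \<tau> z l lhat) \<and>
        (\<forall>lhat. multiplier_adjustment \<phi> g \<tau>hat \<tau> z l lhat \<longrightarrow> 0 \<le> lhat \<and> dS z lhat \<le> \<delta>i)"
      using multiplier_adjustment_near[OF assms(4-6) \<delta>i] by blast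
    have step': "0 \<le> lp \<and> dS (z + d) lp \<le> C * dS z l powr (1 + \<sigma>) \<and> dS (z + d) lp \<le> dS z l / 2 \<and>
        if_condition \<phi> g \<sigma> z l d lp"
      if l: "0 \<le> l" and \<delta>: "dS z l \<le> \<delta>i" and s: "ssqp_step \<phi> g \<sigma> \<rho> z l d lp" for z l d lp
    proof -
      have s0: "ssqp_step \<phi> g \<sigma> \<rho>0 z l d lp" using s \<rho> by (auto simp: ssqp_step_def)
      have "dS z l \<le> \<delta>1" using \<delta> \<delta>s by simp
      then have new: "0 \<le> lp" "dS (z + d) lp \<le> C * dS z l powr (1 + \<sigma>)" "if_condition \<phi> g \<sigma> z l d lp"
        using step[rule_format, OF l _ s0] by auto
      have "C * dS z l powr (1 + \<sigma>) = C * dS z l powr \<sigma> * dS z l"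
        using dist_sol_nonneg[of z l] by (cases "dS z l = 0") (auto simp: powr_add)
      also have "\<dots> \<le> C * (1 / (2 * C)) * dS z l"
        using e1(2)[OF dist_sol_nonneg, of z l] \<delta> \<delta>s C dist_sol_nonneg[of z l]
        by (intro mult_right_mono mult_left_mono) auto
      also have "\<dots> = dS z l / 2" using C by simp
      finally show ?thesis using new by simp
    qed
    show "\<exists>\<delta>bar>0. \<forall>z0 l0 tol. 0 \<le> l0 \<and> 0 \<le> tol \<and> dS z0 l0 \<le> \<delta>bar \<longrightarrow> ?Q \<rho> z0 l0 tol"
    proof (rule exI[of _ \<delta>3], rule conjI[OF \<delta>3], intro allI impI)
      fix z0 :: "real^'n" and l0 :: "real^'m" and tol :: real
      assume h: "0 \<le> l0 \<and> 0 \<le> tol \<and> dS z0 l0 \<le> \<delta>3"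
      have adj0: "\<exists>lhat. multiplier_adjustment \<phi> g \<tau>hat \<tau> z0 l0 lhat"
          "\<And>lhat. multiplier_adjustment \<phi> g \<tau>hat \<tau> z0 l0 lhat \<Longrightarrow> 0 \<le> lhat \<and> dS z0 lhat \<le> \<delta>i"
        using adj h by auto
      have inv: "enat k \<le> N \<Longrightarrow> 0 \<le> l k \<and> dS (z k) (l k) \<le> \<delta>i"
        and pass: "enat k < N \<Longrightarrow> if_condition \<phi> g \<sigma> (z k) (l k) (d k) (lp k) \<and>
          dS (z (Suc k)) (l (Suc k)) \<le> C * dS (z k) (l k) powr (1 + \<sigma>) \<and>
          dS (z (Suc k)) (l (Suc k)) \<le> dS (z k) (l k) / 2"
        if run: "ssqpa_run \<phi> g \<sigma> \<tau>hat \<tau> tol \<rho> z0 l0 N z l d lp" for N z l d lp k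
      proof -
        have z0: "z 0 = z0" "multiplier_adjustment \<phi> g \<tau>hat \<tau> z0 l0 (l 0)"
          and r: "\<And>k. enat k < N \<Longrightarrow> ssqp_step \<phi> g \<sigma> \<rho> (z k) (l k) (d k) (lp k) \<and>
            (if if_condition \<phi> g \<sigma> (z k) (l k) (d k) (lp k)
             then z (Suc k) = z k + d k \<and> l (Suc k) = lp k
             else z (Suc k) = z k \<and> multiplier_adjustment \<phi> g \<tau>hat \<tau> (z k) (l k) (l (Suc k)))"
          using run unfolding ssqpa_run_def by blast+
        have one: "0 \<le> l (Suc k) \<and> if_condition \<phi> g \<sigma> (z k) (l k) (d k) (lp k) \<and>
          dS (z (Suc k)) (l (Suc k)) \<le> C * dS (z k) (l k) powr (1 + \<sigma>) \<and>
          dS (z (Suc k)) (l (Suc k)) \<le> dS (z k) (l k) / 2"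
          if "enat k < N" "0 \<le> l k \<and> dS (z k) (l k) \<le> \<delta>i" for k
          using step'[of "l k" "z k" "d k" "lp k"] r[OF that(1)] that(2) by auto
        \<comment> \<open>The invariant includes \<open>k = N\<close>: the point reached after the
          last executed pass is the one at which the next subproblem must be solvable.\<close>
        have I: "0 \<le> l k \<and> dS (z k) (l k) \<le> \<delta>i" if "enat k \<le> N" for k
          using that
        proof (induction k)
          case 0
          then show ?case using adj0(2)[OF z0(2)] z0(1) by simp
        next
          case (Suc k)
          then have k: "enat k < N" by (simp add: Suc_ile_eq)
          then have "0 \<le> l k \<and> dS (z k) (l k) \<le> \<delta>i" using Suc.IH by simp
          then show ?case using one[OF k] dist_sol_nonneg[of "z k" "l k"] by auto
        qed
        show "enat k \<le> N \<Longrightarrow> 0 \<le> l k \<and> dS (z k) (l k) \<le> \<delta>i" by (rule I)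
        show "enat k < N \<Longrightarrow> if_condition \<phi> g \<sigma> (z k) (l k) (d k) (lp k) \<and>
          dS (z (Suc k)) (l (Suc k)) \<le> C * dS (z k) (l k) powr (1 + \<sigma>) \<and>
          dS (z (Suc k)) (l (Suc k)) \<le> dS (z k) (l k) / 2"
          using one[of k] I[of k] by simp
      qed
      have A: "\<exists>d' lp'. ssqp_step \<phi> g \<sigma> \<rho> (z N) (l N) d' lp'"
        if "ssqpa_run \<phi> g \<sigma> \<tau>hat \<tau> tol \<rho> z0 l0 (enat N) z l d lp" for N z l d lp
      proof -
        have "0 \<le> l N \<and> dS (z N) (l N) \<le> \<delta>i" by (rule inv[OF that]) simp
        then show ?thesis using ex[of "l N" "z N"] \<delta>s by simp
      qed
      have B: "Q_superlinear_to_zero (\<lambda>k. dS (z k) (l k))" "Q_order (1 + \<sigma>) (\<lambda>k. dS (z k) (l k))"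
        if run: "ssqpa_run \<phi> g \<sigma> \<tau>hat \<tau> tol \<rho> z0 l0 \<infinity> z l d lp" for z l d lp
        using Q_order_imp_superlinear[OF assms(2) C dist_sol_nonneg, of "\<lambda>k. z k" "\<lambda>k. l k"] pass[OF run]
        by simp_all
      show "?Q \<rho> z0 l0 tol"
        using adj0(1) A B pass by blast
    qed
  qed
qed

end
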